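(* Let $S$ be a composable sketch, let SeqSketch denote the set of sequential histories of its de-randomised sequential executions, let $N\ge 1$ be the number of update threads and $b\ge 1$ the buffer constant. Then the algorithm OptParSketch (described in the context) instantiated with $S$ is a strongly linearisable implementation of an object whose sequential specification is $\mathrm{SeqSketch}^{2Nb}$, the $2Nb$-relaxation of SeqSketch.
   Context: Model: asynchronous threads in a shared memory that enforces program order; reads and writes of variables declared atomic are fenced, so all writes executed before a write $w$ to an atomic variable are visible to every read (on any thread) that follows a read $r$ of that variable occurring after $w$. An execution is an alternating sequence of states and steps; its history is its subsequence of operation invocations and responses. A sequential history has each invocation immediately followed by its response. A linearisation of execution $\sigma$ is a sequential history $H$ in the sequential specification such that, after completing some pending invocations and removing others, $H$ and $\sigma$ have the same invocations and responses, and $H$ preserves the real-time order of non-overlapping operations of $\sigma$. An implementation is strongly linearisable w.r.t. a specification if there is a function $f$ mapping each execution to a linearisation of it which is prefix preserving: whenever $\sigma$ is a prefix of $\sigma'$, $f(\sigma)$ is a prefix of $f(\sigma')$. Sketches: a sketch supports init() (summarise the empty stream), update($a$), query($arg$), merge($S'$) (afterwards $S$ summarises the concatenation $A\|A'$ of the streams $A$, $A'$ previously summarised by $S$, $S'$). A sketch state summarises a stream $a_1,\dots,a_n$ (equivalently the history of updates with these arguments) if it is the state reached by applying those updates to an initialised sketch. Randomness is delegated to an external oracle whose outputs are fixed (e.g. passed as a hidden input to init or to each update), making the sketch deterministic; SeqSketch is the set of histories of its sequential executions. A composable sketch additionally provides: calcHint(), returning a value $H\neq 0$; a static function shouldAdd($H,a$)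 such that if $S$ summarises stream $A$ and shouldAdd($S$.calcHint(), $a$) is false, then for all streams $B_1,B_2$, every sketch summarising $A\|B_1\|a\|B_2$ also summarises $A\|B_1\|B_2$; and snapshot(), returning a copy $S'$ of $S$ such that immediately after it returns, $S$.query($arg$) $=S'$.query($arg$) for all $arg$. Snapshot may run concurrently with snapshot and merge, and such concurrent executions are strongly linearisable. $r$-relaxation: a sequential history $H$ is an $r$-relaxation of a sequential history $H'$ if $H$ consists of all but at most $r$ of the invocations of $H'$ (with their responses), and each invocation in $H$ is preceded in $H$ by all but at most $r$ of the invocations preceding it in $H'$. $\mathrm{SeqSketch}^r=\{H' : \exists H\in\mathrm{SeqSketch}$ that is an $r$-relaxation of $H'\}$. Algorithm OptParSketch: there are $N$ update threads $t_1,\dots,t_N$, one propagator thread $t_0$, and any number of query threads. Shared: a composable sketch globalS, initially empty, and constant $b$. For each $i$: two sketches localS$_i[0]$, localS$_i[1]$ (initially empty), an integer $cur_i=0$, integer $counter_i=0$, value $hint_i=1$, and an atomic variable $prop_i=1$. Propagator: repeat forever: for every $i$ with $prop_i=0$: globalS.merge(localS$_i[1-cur_i]$); localS$_i[1-cur_i]\leftarrow$ empty sketch; $prop_i\leftarrow$ globalS.calcHint(). Query($arg$): localCopy $\leftarrow$ globalS.snapshot(); return localCopy.query($arg$). Update$_i(a)$ (executed by $t_i$): if not shouldAdd($hint_i,a$) return; $counter_i\leftarrow counter_i+1$; localS$_i[cur_i]$.update($a$); if $counter_i=b$: wait until $prop_i\neq 0$; $cur_i\leftarrow 1-cur_i$;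 $hint_i\leftarrow prop_i$; $counter_i\leftarrow 0$; $prop_i\leftarrow 0$.
   Formalization: Adds that the initial hint 1 satisfies the shouldAdd guarantee for the empty stream (otherwise all updates may be dropped and the claim fails), and that strong linearisability of the shared sketch also covers calcHint overlapping snapshots, as the algorithm needs. *)

theory Defs
  imports "HOL-Library.Multiset" "HOL-Library.Sublist"
begin

section \<open>Executions, histories and strong linearisability\<close>

text \<open>
  A step of a concurrent system is performed by one thread: it is an operation invocation, an
  operation response, or a step that does not appear in the history.
\<close>

datatype ('t, 'op, 'r) label = Call 't 'op | Ret 't 'r | Step 't

record ('c, 't, 'op, 'r) implementation =
  start :: "'c set"
  transition :: "'c \<Rightarrow> ('t, 'op, 'r) label \<Rightarrow> 'c \<Rightarrow> bool"

text \<open>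
  An execution is its first state together with the list of its steps, each paired with the state
  that it leads to.
\<close>

type_synonym ('c, 't, 'op, 'r) execution = "'c \<times> (('t, 'op, 'r) label \<times> 'c) list"

fun path :: "('c, 't, 'op, 'r) implementation \<Rightarrow> 'c \<Rightarrow> (('t, 'op, 'r) label \<times> 'c) list \<Rightarrow> bool" where
  "path I c [] \<longleftrightarrow> True"
| "path I c ((l, c') # xs) \<longleftrightarrow> transition I c l c' \<and> path I c' xs"

definition executions :: "('c, 't, 'op, 'r) implementation \<Rightarrow> ('c, 't, 'op, 'r) execution set" where
  "executions I = {(c, xs). c \<in> start I \<and> path I c xs}"

definition exec_prefix :: "('c, 't, 'op, 'r) execution \<Rightarrow> ('c, 't, 'op, 'r) execution \<Rightarrow> bool" where
  "exec_prefix \<sigma> \<sigma>' \<longleftrightarrow> fst \<sigma> = fst \<sigma>' \<and> prefix (snd \<sigma>) (snd \<sigma>')"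

definition labels :: "('c, 't, 'op, 'r) execution \<Rightarrow> ('t, 'op, 'r) label list" where
  "labels \<sigma> = map fst (snd \<sigma>)"

text \<open>
  Histories need to tell apart invocations of the same operation with the same arguments. An
  invocation is identified by its thread and its position among the invocations of that thread.
\<close>

type_synonym 't opid = "'t \<times> nat"

datatype ('t, 'op, 'r) event = Inv (event_id: "'t opid") 'op | Res (event_id: "'t opid") 'r

text \<open>The first argument counts, for each thread, its invocations so far.\<close>

fun history_from :: "('t \<Rightarrow> nat) \<Rightarrow> ('t, 'op, 'r) label list \<Rightarrow> ('t, 'op, 'r) event list" where
  "history_from n [] = []"
| "history_from n (Call t x # ls) = Inv (t, n t) x # history_from (n(t := Suc (n t))) ls"
| "history_from n (Ret t r # ls) = Res (t, n t - 1) r # history_from n ls"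
| "history_from n (Step t # ls) = history_from n ls"

definition history :: "('c, 't, 'op, 'r) execution \<Rightarrow> ('t, 'op, 'r) event list" where
  "history \<sigma> = history_from (\<lambda>_. 0) (labels \<sigma>)"

text \<open>
  In a sequential history each invocation is immediately followed by its response. It is
  represented by the list of these pairs: the entry \<open>(i, x, r)\<close> stands for the invocation of
  \<open>x\<close> with identity \<open>i\<close> followed by its response \<open>r\<close>.
\<close>

type_synonym ('t, 'op, 'r) seq_history = "('t opid \<times> 'op \<times> 'r) list"

definition wf_seq :: "('t, 'op, 'r) seq_history \<Rightarrow> bool" where
  "wf_seq H \<longleftrightarrow> distinct (map fst H)"

definition seq_events :: "('t, 'op, 'r) seq_history \<Rightarrow> ('t, 'op, 'r) event list" where
  "seq_events H = concat (map (\<lambda>(i, x, r). [Inv i x, Res i r]) H)"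

definition pending :: "('t, 'op, 'r) event list \<Rightarrow> 't opid set" where
  "pending h = {i. (\<exists>x. Inv i x \<in> set h) \<and> (\<nexists>r. Res i r \<in> set h)}"

text \<open>
  The pending invocations in \<open>R\<close> are removed, and all others are completed by the responses
  in \<open>rs\<close>.
\<close>

definition completion :: "('t, 'op, 'r) event list \<Rightarrow> ('t, 'op, 'r) event list \<Rightarrow> bool" where
  "completion h h' \<longleftrightarrow>
     (\<exists>R rs. R \<subseteq> pending h \<and> distinct (map fst rs) \<and> fst ` set rs = pending h - R \<and>
             h' = filter (\<lambda>e. event_id e \<notin> R) h @ map (\<lambda>(i, r). Res i r) rs)"

definition precedes :: "('t, 'op, 'r) event list \<Rightarrow> 't opid \<Rightarrow> 't opid \<Rightarrow> bool" where
  "precedes h i j \<longleftrightarrow>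
     (\<exists>k l r x. k < l \<and> l < length h \<and> h ! k = Res i r \<and> h ! l = Inv j x)"

definition linearisation ::
    "('t, 'op, 'r) seq_history set \<Rightarrow> ('t, 'op, 'r) event list \<Rightarrow> ('t, 'op, 'r) seq_history \<Rightarrow> bool"
  where
  "linearisation Spec h H \<longleftrightarrow>
     H \<in> Spec \<and>
     (\<exists>h'. completion h h' \<and> mset (seq_events H) = mset h') \<and>
     (\<forall>i j. precedes h i j \<and> j \<in> fst ` set H \<longrightarrow> precedes (seq_events H) i j)"

definition strongly_linearisable_on ::
    "('c, 't, 'op, 'r) execution set \<Rightarrow> ('t, 'op, 'r) seq_history set \<Rightarrow> bool" where
  "strongly_linearisable_on E Spec \<longleftrightarrow>
     (\<exists>f. (\<forall>\<sigma>\<in>E. linearisation Spec (history \<sigma>) (f \<sigma>)) \<and>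
          (\<forall>\<sigma>\<in>E. \<forall>\<sigma>'\<in>E. exec_prefix \<sigma> \<sigma>' \<longrightarrow> prefix (f \<sigma>) (f \<sigma>')))"

definition strongly_linearisable ::
    "('c, 't, 'op, 'r) implementation \<Rightarrow> ('t, 'op, 'r) seq_history set \<Rightarrow> bool" where
  "strongly_linearisable I Spec \<longleftrightarrow> strongly_linearisable_on (executions I) Spec"

section \<open>Relaxation\<close>

definition before :: "'x list \<Rightarrow> 'x \<Rightarrow> 'x set" where
  "before xs x = {xs ! k | k l. k < l \<and> l < length xs \<and> xs ! l = x}"

text \<open>For well-formed histories the entries are distinct, so that sets of entries count them.\<close>

definition r_relaxation ::
    "nat \<Rightarrow> ('t, 'op, 'r) seq_history \<Rightarrow> ('t, 'op, 'r) seq_history \<Rightarrow> bool" where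
  "r_relaxation r H H' \<longleftrightarrow>
     wf_seq H \<and> wf_seq H' \<and>
     set H \<subseteq> set H' \<and> card (set H' - set H) \<le> r \<and>
     (\<forall>x\<in>set H. card (before H' x - before H x) \<le> r)"

definition relaxed :: "nat \<Rightarrow> ('t, 'op, 'r) seq_history set \<Rightarrow> ('t, 'op, 'r) seq_history set" where
  "relaxed r Spec = {H'. \<exists>H\<in>Spec. r_relaxation r H H'}"

section \<open>Sketches\<close>

text \<open>
  A de-randomised sketch is deterministic; an oracle output consumed by an update is part of the
  argument of that update. Operations are given by their effect on sketch states of type
  \<open>'s\<close>; \<open>merge S s s'\<close> is the new state of the sketch \<open>s\<close> into which \<open>s'\<close> is merged.
\<close>

record ('s, 'a, 'q, 'v) sketch =
  init :: 's
  update :: "'s \<Rightarrow> 'a \<Rightarrow> 's"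
  query :: "'s \<Rightarrow> 'q \<Rightarrow> 'v"
  merge :: "'s \<Rightarrow> 's \<Rightarrow> 's"

definition summarises :: "('s, 'a, 'q, 'v, 'z) sketch_scheme \<Rightarrow> 's \<Rightarrow> 'a list \<Rightarrow> bool" where
  "summarises S s A \<longleftrightarrow> s = foldl (update S) (init S) A"

datatype ('a, 'q) sketch_op = Update 'a | Query 'q
datatype 'v sketch_ret = Ack | Val 'v

fun seq_run ::
    "('s, 'a, 'q, 'v, 'z) sketch_scheme \<Rightarrow> 's \<Rightarrow>
     ('t, ('a, 'q) sketch_op, 'v sketch_ret) seq_history \<Rightarrow> bool" where
  "seq_run S s [] \<longleftrightarrow> True"
| "seq_run S s ((i, Update a, r) # H) \<longleftrightarrow> r = Ack \<and> seq_run S (update S s a) H"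
| "seq_run S s ((i, Query q, r) # H) \<longleftrightarrow> r = Val (query S s q) \<and> seq_run S s H"

definition SeqSketch ::
    "('s, 'a, 'q, 'v, 'z) sketch_scheme \<Rightarrow>
     ('t, ('a, 'q) sketch_op, 'v sketch_ret) seq_history set" where
  "SeqSketch S = {H. wf_seq H \<and> seq_run S (init S) H}"

subsection \<open>Composable sketches\<close>

text \<open>
  Query threads are numbered by all natural numbers: an execution uses finitely many of them, and
  there is no bound on how many.
\<close>

datatype thread = Propagator | Updater nat | Querier nat

text \<open>
  A sketch that is shared between threads runs \<open>Merge\<close>, \<open>Snapshot\<close> and \<open>CalcHint\<close> in many
  steps, which may interleave. These steps are those of an arbitrary implementation, with states
  of a type \<open>'c\<close> of its own.
\<close>

datatype 's shared_op = Merge 's | Snapshot | CalcHint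
datatype ('s, 'h) shared_ret = Merged | Copy 's | Hinted 'h

record ('s, 'a, 'q, 'v, 'h, 'c) composable = "('s, 'a, 'q, 'v) sketch" +
  calc_hint :: "'s \<Rightarrow> 'h"
  should_add :: "'h \<Rightarrow> 'a \<Rightarrow> bool"
  shared :: "('c, thread, 's shared_op, ('s, 'h) shared_ret) implementation"

fun shared_run ::
    "('s, 'a, 'q, 'v, 'h, 'c) composable \<Rightarrow> 's \<Rightarrow>
     (thread, 's shared_op, ('s, 'h) shared_ret) seq_history \<Rightarrow> bool" where
  "shared_run S s [] \<longleftrightarrow> True"
| "shared_run S s ((i, Merge s', r) # H) \<longleftrightarrow> r = Merged \<and> shared_run S (merge S s s') H"
| "shared_run S s ((i, Snapshot, r) # H) \<longleftrightarrow>
     (\<exists>s'. r = Copy s' \<and> (\<forall>q. query S s' q = query S s q)) \<and> shared_run S s H"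
| "shared_run S s ((i, CalcHint, r) # H) \<longleftrightarrow> r = Hinted (calc_hint S s) \<and> shared_run S s H"

definition shared_spec ::
    "('s, 'a, 'q, 'v, 'h, 'c) composable \<Rightarrow>
     (thread, 's shared_op, ('s, 'h) shared_ret) seq_history set" where
  "shared_spec S = {H. wf_seq H \<and> shared_run S (init S) H}"

text \<open>
  Permitted use of a shared sketch: threads are sequential, snapshots may overlap all operations
  but other operations do not overlap each other, and merged sketches summarise a stream.
  The function argument gives the operation that is pending on each thread, if any.
\<close>

fun permitted_from ::
    "('s, 'a, 'q, 'v, 'h, 'c) composable \<Rightarrow> (thread \<Rightarrow> 's shared_op option) \<Rightarrow>
     (thread, 's shared_op, ('s, 'h) shared_ret) label list \<Rightarrow> bool" where
  "permitted_from S P [] \<longleftrightarrow> True"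
| "permitted_from S P (Call t x # ls) \<longleftrightarrow>
     P t = None \<and>
     (x \<noteq> Snapshot \<longrightarrow> (\<forall>t'. P t' = None \<or> P t' = Some Snapshot)) \<and>
     (\<forall>s. x = Merge s \<longrightarrow> (\<exists>A. summarises S s A)) \<and>
     permitted_from S (P(t := Some x)) ls"
| "permitted_from S P (Ret t r # ls) \<longleftrightarrow> P t \<noteq> None \<and> permitted_from S (P(t := None)) ls"
| "permitted_from S P (Step t # ls) \<longleftrightarrow> P t \<noteq> None \<and> permitted_from S P ls"

definition permitted ::
    "('s, 'a, 'q, 'v, 'h, 'c) composable \<Rightarrow>
     ('c, thread, 's shared_op, ('s, 'h) shared_ret) execution set" where
  "permitted S = {\<sigma>. permitted_from S (\<lambda>_. None) (labels \<sigma>)}"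

text \<open>
  \<open>sound_hint S A h\<close> is the guarantee given by a hint \<open>h\<close> that was calculated when the sketch
  summarised \<open>A\<close>. It is stated for arbitrary values since the initial hint of OptParSketch is
  the constant 1, which is not the result of a calculation.
\<close>

definition sound_hint ::
    "('s, 'a, 'q, 'v, 'h, 'c) composable \<Rightarrow> 'a list \<Rightarrow> 'h \<Rightarrow> bool" where
  "sound_hint S A h \<longleftrightarrow>
     (\<forall>a. \<not> should_add S h a \<longrightarrow>
        (\<forall>B1 B2 s. summarises S s (A @ B1 @ [a] @ B2) \<longrightarrow> summarises S s (A @ B1 @ B2)))"

definition composable_sketch ::
    "('s, 'a, 'q, 'v, 'h :: zero_neq_one, 'c) composable \<Rightarrow> bool" where
  "composable_sketch S \<longleftrightarrow>
     (\<forall>s s' A A'. summarises S s A \<and> summarises S s' A' \<longrightarrow> summarises S (merge S s s') (A @ A')) \<and>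
     (\<forall>s A. summarises S s A \<longrightarrow> calc_hint S s \<noteq> 0 \<and> sound_hint S A (calc_hint S s)) \<and>
     strongly_linearisable_on (executions (shared S) \<inter> permitted S) (shared_spec S)"

section \<open>Memory\<close>

datatype loc = LocalS nat nat | Cur nat | Counter nat | Hint nat
datatype ('s, 'h) val = SketchV 's | NatV nat | HintV 'h

text \<open>
  For a non-atomic location \<open>x\<close>, \<open>written m x\<close> lists all values written so far, the initial one
  first, and \<open>seen m t x\<close> is the index of the latest of these writes that is visible to
  thread \<open>t\<close>. A read may return that value or, since other threads' writes may be observed
  without synchronisation, any later one. The atomic variables \<open>prop\<^sub>i\<close> always have their current
  value \<open>prop_val m i\<close>. Writing \<open>prop\<^sub>i\<close> publishes all that is visible to the writer in
  \<open>published m i\<close>, and reading \<open>prop\<^sub>i\<close> makes visible all that was published by earlier writes.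
\<close>

record ('s, 'h) memory =
  written :: "loc \<Rightarrow> ('s, 'h) val list"
  seen :: "thread \<Rightarrow> loc \<Rightarrow> nat"
  prop_val :: "nat \<Rightarrow> 'h"
  published :: "nat \<Rightarrow> loc \<Rightarrow> nat"

definition reads :: "('s, 'h) memory \<Rightarrow> thread \<Rightarrow> loc \<Rightarrow> ('s, 'h) val \<Rightarrow> bool" where
  "reads m t x v \<longleftrightarrow> (\<exists>k. seen m t x \<le> k \<and> k < length (written m x) \<and> written m x ! k = v)"

definition store :: "thread \<Rightarrow> loc \<Rightarrow> ('s, 'h) val \<Rightarrow> ('s, 'h) memory \<Rightarrow> ('s, 'h) memory" where
  "store t x v m =
     m\<lparr>written := (written m)(x := written m x @ [v]),
       seen := (seen m)(t := (seen m t)(x := length (written m x)))\<rparr>"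

definition acquire :: "thread \<Rightarrow> nat \<Rightarrow> ('s, 'h) memory \<Rightarrow> ('s, 'h) memory" where
  "acquire t i m = m\<lparr>seen := (seen m)(t := sup (seen m t) (published m i))\<rparr>"

definition write_prop :: "thread \<Rightarrow> nat \<Rightarrow> 'h \<Rightarrow> ('s, 'h) memory \<Rightarrow> ('s, 'h) memory" where
  "write_prop t i h m =
     m\<lparr>prop_val := (prop_val m)(i := h),
       published := (published m)(i := sup (published m i) (seen m t))\<rparr>"

section \<open>OptParSketch\<close>

text \<open>
  Program counters name the next instruction; their arguments are the thread's registers.
  In the propagator, \<open>T\<close> is the set of indices that the current pass has still to visit.
\<close>

datatype ('s, 'h) prop_pc =
    PNext "nat set"                 \<comment> \<open>read \<open>prop\<^sub>i\<close> for some \<open>i \<in> T\<close>\<close>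
  | PCur "nat set" nat              \<comment> \<open>\<open>globalS.merge(localS\<^sub>i[1-cur\<^sub>i])\<close>: read \<open>cur\<^sub>i\<close>\<close>
  | PLocal "nat set" nat nat        \<comment> \<open>read \<open>localS\<^sub>i[1-cur\<^sub>i]\<close>\<close>
  | PCallMerge "nat set" nat 's
  | PMerge "nat set" nat
  | PCur' "nat set" nat             \<comment> \<open>\<open>localS\<^sub>i[1-cur\<^sub>i] \<leftarrow> empty sketch\<close>: read \<open>cur\<^sub>i\<close>\<close>
  | PClear "nat set" nat nat
  | PCallHint "nat set" nat         \<comment> \<open>\<open>prop\<^sub>i \<leftarrow> globalS.calcHint()\<close>\<close>
  | PHint "nat set" nat
  | PSetProp "nat set" nat 'h

datatype ('s, 'a, 'h) upd_pc =
    UIdle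
  | UCheck 'a                       \<comment> \<open>if not \<open>shouldAdd(hint\<^sub>i, a)\<close> return\<close>
  | UCount 'a                       \<comment> \<open>\<open>counter\<^sub>i \<leftarrow> counter\<^sub>i + 1\<close>: read\<close>
  | UCount' 'a nat
  | UCur 'a                         \<comment> \<open>\<open>localS\<^sub>i[cur\<^sub>i].update(a)\<close>: read \<open>cur\<^sub>i\<close>\<close>
  | ULocal 'a nat
  | ULocal' 'a nat 's
  | UTest                           \<comment> \<open>if \<open>counter\<^sub>i = b\<close>\<close>
  | UWait                           \<comment> \<open>wait until \<open>prop\<^sub>i \<noteq> 0\<close>\<close>
  | UFlip                           \<comment> \<open>\<open>cur\<^sub>i \<leftarrow> 1 - cur\<^sub>i\<close>: read\<close>
  | UFlip' nat
  | UHint                           \<comment> \<open>\<open>hint\<^sub>i \<leftarrow> prop\<^sub>i\<close>: read\<close>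
  | UHint' 'h
  | UReset                          \<comment> \<open>\<open>counter\<^sub>i \<leftarrow> 0\<close>\<close>
  | USignal                         \<comment> \<open>\<open>prop\<^sub>i \<leftarrow> 0\<close>\<close>
  | UReturn

datatype ('s, 'q, 'v) qry_pc =
    QIdle
  | QCall 'q
  | QSnapshot 'q
  | QQuery 'q 's                    \<comment> \<open>\<open>localCopy.query(arg)\<close>\<close>
  | QReturn 'v

record ('s, 'a, 'q, 'v, 'h, 'c) state =
  mem :: "('s, 'h) memory"
  globalS :: 'c
  ppc :: "('s, 'h) prop_pc"
  upc :: "nat \<Rightarrow> ('s, 'a, 'h) upd_pc"
  qpc :: "nat \<Rightarrow> ('s, 'q, 'v) qry_pc"

fun initial_val :: "('s, 'a, 'q, 'v, 'h :: zero_neq_one, 'c) composable \<Rightarrow> loc \<Rightarrow> ('s, 'h) val" where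
  "initial_val S (LocalS i j) = SketchV (init S)"
| "initial_val S (Cur i) = NatV 0"
| "initial_val S (Counter i) = NatV 0"
| "initial_val S (Hint i) = HintV 1"

definition initial_states ::
    "('s, 'a, 'q, 'v, 'h :: zero_neq_one, 'c) composable \<Rightarrow> nat \<Rightarrow> ('s, 'a, 'q, 'v, 'h, 'c) state set"
  where
  "initial_states S N =
     {\<lparr>mem = \<lparr>written = (\<lambda>x. [initial_val S x]), seen = (\<lambda>_ _. 0),
              prop_val = (\<lambda>_. 1), published = (\<lambda>_ _. 0)\<rparr>,
       globalS = g, ppc = PNext {1..N}, upc = (\<lambda>_. UIdle), qpc = (\<lambda>_. QIdle)\<rparr>
      | g. g \<in> start (shared S)}"

abbreviation goto_u ::
    "nat \<Rightarrow> ('s, 'a, 'h) upd_pc \<Rightarrow> ('s, 'a, 'q, 'v, 'h, 'c) state \<Rightarrow> ('s, 'a, 'q, 'v, 'h, 'c) state" where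
  "goto_u i pc st \<equiv> st\<lparr>upc := (upc st)(i := pc)\<rparr>"

abbreviation goto_q ::
    "nat \<Rightarrow> ('s, 'q, 'v) qry_pc \<Rightarrow> ('s, 'a, 'q, 'v, 'h, 'c) state \<Rightarrow> ('s, 'a, 'q, 'v, 'h, 'c) state" where
  "goto_q k pc st \<equiv> st\<lparr>qpc := (qpc st)(k := pc)\<rparr>"

inductive opt_step ::
    "('s, 'a, 'q, 'v, 'h :: zero_neq_one, 'c) composable \<Rightarrow> nat \<Rightarrow> nat \<Rightarrow>
     ('s, 'a, 'q, 'v, 'h, 'c) state \<Rightarrow>
     (thread, ('a, 'q) sketch_op, 'v sketch_ret) label \<Rightarrow>
     ('s, 'a, 'q, 'v, 'h, 'c) state \<Rightarrow> bool"
  for S N b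
  where
  p_restart:
    "ppc st = PNext {} \<Longrightarrow>
     opt_step S N b st (Step Propagator) (st\<lparr>ppc := PNext {1..N}\<rparr>)"
| p_skip:
    "ppc st = PNext T \<Longrightarrow> i \<in> T \<Longrightarrow> prop_val (mem st) i \<noteq> 0 \<Longrightarrow>
     opt_step S N b st (Step Propagator)
       (st\<lparr>ppc := PNext (T - {i}), mem := acquire Propagator i (mem st)\<rparr>)"
| p_visit:
    "ppc st = PNext T \<Longrightarrow> i \<in> T \<Longrightarrow> prop_val (mem st) i = 0 \<Longrightarrow>
     opt_step S N b st (Step Propagator)
       (st\<lparr>ppc := PCur (T - {i}) i, mem := acquire Propagator i (mem st)\<rparr>)"
| p_cur:
    "ppc st = PCur T i \<Longrightarrow> reads (mem st) Propagator (Cur i) (NatV j) \<Longrightarrow>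
     opt_step S N b st (Step Propagator) (st\<lparr>ppc := PLocal T i (1 - j)\<rparr>)"
| p_local:
    "ppc st = PLocal T i j \<Longrightarrow> reads (mem st) Propagator (LocalS i j) (SketchV s) \<Longrightarrow>
     opt_step S N b st (Step Propagator) (st\<lparr>ppc := PCallMerge T i s\<rparr>)"
| p_call_merge:
    "ppc st = PCallMerge T i s \<Longrightarrow>
     transition (shared S) (globalS st) (Call Propagator (Merge s)) g \<Longrightarrow>
     opt_step S N b st (Step Propagator) (st\<lparr>ppc := PMerge T i, globalS := g\<rparr>)"
| p_in_merge:
    "ppc st = PMerge T i \<Longrightarrow>
     transition (shared S) (globalS st) (Step Propagator) g \<Longrightarrow>
     opt_step S N b st (Step Propagator) (st\<lparr>globalS := g\<rparr>)"
| p_ret_merge: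
    "ppc st = PMerge T i \<Longrightarrow>
     transition (shared S) (globalS st) (Ret Propagator Merged) g \<Longrightarrow>
     opt_step S N b st (Step Propagator) (st\<lparr>ppc := PCur' T i, globalS := g\<rparr>)"
| p_cur':
    "ppc st = PCur' T i \<Longrightarrow> reads (mem st) Propagator (Cur i) (NatV j) \<Longrightarrow>
     opt_step S N b st (Step Propagator) (st\<lparr>ppc := PClear T i (1 - j)\<rparr>)"
| p_clear:
    "ppc st = PClear T i j \<Longrightarrow>
     opt_step S N b st (Step Propagator)
       (st\<lparr>ppc := PCallHint T i,
           mem := store Propagator (LocalS i j) (SketchV (init S)) (mem st)\<rparr>)"
| p_call_hint:
    "ppc st = PCallHint T i \<Longrightarrow>
     transition (shared S) (globalS st) (Call Propagator CalcHint) g \<Longrightarrow>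
     opt_step S N b st (Step Propagator) (st\<lparr>ppc := PHint T i, globalS := g\<rparr>)"
| p_in_hint:
    "ppc st = PHint T i \<Longrightarrow>
     transition (shared S) (globalS st) (Step Propagator) g \<Longrightarrow>
     opt_step S N b st (Step Propagator) (st\<lparr>globalS := g\<rparr>)"
| p_ret_hint:
    "ppc st = PHint T i \<Longrightarrow>
     transition (shared S) (globalS st) (Ret Propagator (Hinted h)) g \<Longrightarrow>
     opt_step S N b st (Step Propagator) (st\<lparr>ppc := PSetProp T i h, globalS := g\<rparr>)"
| p_set_prop:
    "ppc st = PSetProp T i h \<Longrightarrow>
     opt_step S N b st (Step Propagator)
       (st\<lparr>ppc := PNext T, mem := write_prop Propagator i h (mem st)\<rparr>)"

| q_call:
    "qpc st k = QIdle \<Longrightarrow>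
     opt_step S N b st (Call (Querier k) (Query q)) (goto_q k (QCall q) st)"
| q_call_snapshot:
    "qpc st k = QCall q \<Longrightarrow>
     transition (shared S) (globalS st) (Call (Querier k) Snapshot) g \<Longrightarrow>
     opt_step S N b st (Step (Querier k)) (goto_q k (QSnapshot q) (st\<lparr>globalS := g\<rparr>))"
| q_in_snapshot:
    "qpc st k = QSnapshot q \<Longrightarrow>
     transition (shared S) (globalS st) (Step (Querier k)) g \<Longrightarrow>
     opt_step S N b st (Step (Querier k)) (st\<lparr>globalS := g\<rparr>)"
| q_ret_snapshot:
    "qpc st k = QSnapshot q \<Longrightarrow>
     transition (shared S) (globalS st) (Ret (Querier k) (Copy s)) g \<Longrightarrow>
     opt_step S N b st (Step (Querier k)) (goto_q k (QQuery q s) (st\<lparr>globalS := g\<rparr>))"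
| q_query:
    "qpc st k = QQuery q s \<Longrightarrow>
     opt_step S N b st (Step (Querier k)) (goto_q k (QReturn (query S s q)) st)"
| q_return:
    "qpc st k = QReturn v \<Longrightarrow>
     opt_step S N b st (Ret (Querier k) (Val v)) (goto_q k QIdle st)"

| u_call:
    "i \<in> {1..N} \<Longrightarrow> upc st i = UIdle \<Longrightarrow>
     opt_step S N b st (Call (Updater i) (Update a)) (goto_u i (UCheck a) st)"
| u_filtered:
    "upc st i = UCheck a \<Longrightarrow> reads (mem st) (Updater i) (Hint i) (HintV h) \<Longrightarrow>
     \<not> should_add S h a \<Longrightarrow>
     opt_step S N b st (Step (Updater i)) (goto_u i UReturn st)"
| u_add:
    "upc st i = UCheck a \<Longrightarrow> reads (mem st) (Updater i) (Hint i) (HintV h) \<Longrightarrow>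
     should_add S h a \<Longrightarrow>
     opt_step S N b st (Step (Updater i)) (goto_u i (UCount a) st)"
| u_count:
    "upc st i = UCount a \<Longrightarrow> reads (mem st) (Updater i) (Counter i) (NatV c) \<Longrightarrow>
     opt_step S N b st (Step (Updater i)) (goto_u i (UCount' a c) st)"
| u_count':
    "upc st i = UCount' a c \<Longrightarrow>
     opt_step S N b st (Step (Updater i))
       (goto_u i (UCur a) (st\<lparr>mem := store (Updater i) (Counter i) (NatV (c + 1)) (mem st)\<rparr>))"
| u_cur:
    "upc st i = UCur a \<Longrightarrow> reads (mem st) (Updater i) (Cur i) (NatV j) \<Longrightarrow>
     opt_step S N b st (Step (Updater i)) (goto_u i (ULocal a j) st)"
| u_local:
    "upc st i = ULocal a j \<Longrightarrow> reads (mem st) (Updater i) (LocalS i j) (SketchV s) \<Longrightarrow>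
     opt_step S N b st (Step (Updater i)) (goto_u i (ULocal' a j s) st)"
| u_local':
    "upc st i = ULocal' a j s \<Longrightarrow>
     opt_step S N b st (Step (Updater i))
       (goto_u i UTest
         (st\<lparr>mem := store (Updater i) (LocalS i j) (SketchV (update S s a)) (mem st)\<rparr>))"
| u_not_full:
    "upc st i = UTest \<Longrightarrow> reads (mem st) (Updater i) (Counter i) (NatV c) \<Longrightarrow> c \<noteq> b \<Longrightarrow>
     opt_step S N b st (Step (Updater i)) (goto_u i UReturn st)"
| u_full:
    "upc st i = UTest \<Longrightarrow> reads (mem st) (Updater i) (Counter i) (NatV c) \<Longrightarrow> c = b \<Longrightarrow>
     opt_step S N b st (Step (Updater i)) (goto_u i UWait st)"
| u_wait:
    "upc st i = UWait \<Longrightarrow> prop_val (mem st) i = 0 \<Longrightarrow>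
     opt_step S N b st (Step (Updater i)) (st\<lparr>mem := acquire (Updater i) i (mem st)\<rparr>)"
| u_proceed:
    "upc st i = UWait \<Longrightarrow> prop_val (mem st) i \<noteq> 0 \<Longrightarrow>
     opt_step S N b st (Step (Updater i))
       (goto_u i UFlip (st\<lparr>mem := acquire (Updater i) i (mem st)\<rparr>))"
| u_flip:
    "upc st i = UFlip \<Longrightarrow> reads (mem st) (Updater i) (Cur i) (NatV j) \<Longrightarrow>
     opt_step S N b st (Step (Updater i)) (goto_u i (UFlip' j) st)"
| u_flip':
    "upc st i = UFlip' j \<Longrightarrow>
     opt_step S N b st (Step (Updater i))
       (goto_u i UHint (st\<lparr>mem := store (Updater i) (Cur i) (NatV (1 - j)) (mem st)\<rparr>))"
| u_hint:
    "upc st i = UHint \<Longrightarrow>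
     opt_step S N b st (Step (Updater i))
       (goto_u i (UHint' (prop_val (mem st) i)) (st\<lparr>mem := acquire (Updater i) i (mem st)\<rparr>))"
| u_hint':
    "upc st i = UHint' h \<Longrightarrow>
     opt_step S N b st (Step (Updater i))
       (goto_u i UReset (st\<lparr>mem := store (Updater i) (Hint i) (HintV h) (mem st)\<rparr>))"
| u_reset:
    "upc st i = UReset \<Longrightarrow>
     opt_step S N b st (Step (Updater i))
       (goto_u i USignal (st\<lparr>mem := store (Updater i) (Counter i) (NatV 0) (mem st)\<rparr>))"
| u_signal:
    "upc st i = USignal \<Longrightarrow>
     opt_step S N b st (Step (Updater i))
       (goto_u i UReturn (st\<lparr>mem := write_prop (Updater i) i 0 (mem st)\<rparr>))"
| u_return:
    "upc st i = UReturn \<Longrightarrow>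
     opt_step S N b st (Ret (Updater i) Ack) (goto_u i UIdle st)"

definition OptParSketch ::
    "('s, 'a, 'q, 'v, 'h :: zero_neq_one, 'c) composable \<Rightarrow> nat \<Rightarrow> nat \<Rightarrow>
     (('s, 'a, 'q, 'v, 'h, 'c) state, thread, ('a, 'q) sketch_op, 'v sketch_ret) implementation" where
  "OptParSketch S N b = \<lparr>start = initial_states S N, transition = opt_step S N b\<rparr>"

end

theory Submission
  imports Defs
begin

text \<open>
  An update that passes the filter is linearised when it is written to its local sketch, a filtered
  update when it is filtered, and a query when its snapshot is linearised by the shared sketch. The
  sequential history witnessing the relaxation orders the buffered updates differently: they are
  appended, a whole buffer at a time, when the shared sketch linearises the merge of that buffer.
  Hence this history describes exactly the state that snapshots see, and it lags behind the
  linearisation only by the updates in the \<open>2N\<close> local buffers, each of length at most \<open>b\<close>.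
  A filtered update enters both histories at once: the hint it was tested against was sound for a
  prefix of the stream merged so far, so it does not change the state. Since an operation that
  enters the linearisation is preceded by all but the buffered ones in the witness, the same bound
  controls the reordering. The writes to \<open>prop\<^sub>i\<close> hand each local sketch over between the update
  thread and the propagator, so all reads of shared locations return the latest value.
\<close>

section \<open>Histories and linearisations\<close>

text \<open>The operations of \<open>globalS\<close> are not atomic: all that is known of them is a
  prefix-preserving linearisation \<open>f\<close> of their interleaved steps. A merge, snapshot or
  hint calculation takes effect at a point that \<open>f\<close> chooses, possibly during a step of
  another thread, and several of them may do so at once. Prefix preservation makes these choices
  irrevocable, and the argument rests on it: after every step the ghost state replays, in order, the
  entries that the step has appended to the value of \<open>f\<close>. An appended entry always
  belongs to an operation that is still pending, so the program counters tell which buffer was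
  merged or which query was answered. The factor 2 in \<open>2 * N * b\<close> is due to double
  buffering: an update thread fills one local sketch while the other awaits its merge, and waiting
  for a non-zero \<open>prop\<^sub>i\<close> rules out a third batch. The hint 1 that every thread
  starts with is not calculated by the sketch, hence the separate hypothesis that it is sound for
  the empty stream.\<close>

fun count_call :: "('t \<Rightarrow> nat) \<Rightarrow> ('t, 'op, 'r) label \<Rightarrow> 't \<Rightarrow> nat" where
  "count_call n (Call t x) = n(t := Suc (n t))"
| "count_call n (Ret t r) = n"
| "count_call n (Step t) = n"

fun label_events :: "('t \<Rightarrow> nat) \<Rightarrow> ('t, 'op, 'r) label \<Rightarrow> ('t, 'op, 'r) event list" where
  "label_events n (Call t x) = [Inv (t, n t) x]"
| "label_events n (Ret t r) = [Res (t, n t - 1) r]"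
| "label_events n (Step t) = []"

lemma history_from_Cons:
  "history_from n (l # ls) = label_events n l @ history_from (count_call n l) ls"
  by (cases l) auto

text \<open>Executions grow at the end whereas \<open>history_from\<close> recurses from the front;
  the counters reached after \<open>ls\<close> connect the two.\<close>

lemma history_from_append:
  "history_from n (ls @ ls') = history_from n ls @ history_from (foldl count_call n ls) ls'"
  by (induction ls arbitrary: n) (simp_all add: history_from_Cons)

text \<open>
  \<open>n\<close> counts the invocations of each thread and \<open>B\<close> tells which threads have a pending
  operation. Together with the real-time order, this is what remains of linearisability when every
  operation is appended to \<open>H\<close> between its invocation and its response.
\<close>

definition tracks ::
    "('t \<Rightarrow> nat) \<Rightarrow> ('t \<Rightarrow> bool) \<Rightarrow> ('t, 'op, 'r) event list \<Rightarrow> ('t, 'op, 'r) seq_history \<Rightarrow> bool"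
  where
  "tracks n B h H \<longleftrightarrow>
     (\<forall>t k x. Inv (t, k) x \<in> set h \<longrightarrow> k < n t) \<and>
     (\<forall>t k r. Res (t, k) r \<in> set h \<longrightarrow> k < n t \<and> (B t \<longrightarrow> Suc k < n t)) \<and>
     (\<forall>t. B t \<longrightarrow> 0 < n t) \<and>
     distinct h \<and>
     (\<forall>i x y. Inv i x \<in> set h \<and> Inv i y \<in> set h \<longrightarrow> x = y) \<and>
     distinct (map fst H) \<and>
     (\<forall>i x r. (i, x, r) \<in> set H \<longrightarrow> Inv i x \<in> set h) \<and>
     (\<forall>i r. Res i r \<in> set h \<longrightarrow> (\<exists>x. (i, x, r) \<in> set H)) \<and>
     (\<forall>i j. precedes h i j \<and> j \<in> fst ` set H \<longrightarrow> precedes (seq_events H) i j)"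

lemma tracksD:
  assumes "tracks n B h H"
  shows tracks_inv_less: "Inv (t, k) x \<in> set h \<Longrightarrow> k < n t"
    and tracks_res_less: "Res (t, k) r \<in> set h \<Longrightarrow> k < n t"
    and tracks_res_busy: "Res (t, k) r \<in> set h \<Longrightarrow> B t \<Longrightarrow> Suc k < n t"
    and tracks_busy: "B t \<Longrightarrow> 0 < n t"
    and tracks_distinct: "distinct h"
    and tracks_inv_unique: "Inv i x \<in> set h \<Longrightarrow> Inv i y \<in> set h \<Longrightarrow> x = y"
    and tracks_wf: "distinct (map fst H)"
    and tracks_inv: "(i, x, r) \<in> set H \<Longrightarrow> Inv i x \<in> set h"
    and tracks_res: "Res i r \<in> set h \<Longrightarrow> \<exists>x. (i, x, r) \<in> set H"
    and tracks_precedes: "precedes h i j \<Longrightarrow> j \<in> fst ` set H \<Longrightarrow> precedes (seq_events H) i j"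
  using assms unfolding tracks_def by metis+

lemma tracksI:
  assumes "\<And>t k x. Inv (t, k) x \<in> set h \<Longrightarrow> k < n t"
    and "\<And>t k r. Res (t, k) r \<in> set h \<Longrightarrow> k < n t"
    and "\<And>t k r. Res (t, k) r \<in> set h \<Longrightarrow> B t \<Longrightarrow> Suc k < n t"
    and "\<And>t. B t \<Longrightarrow> 0 < n t"
    and "distinct h"
    and "\<And>i x y. Inv i x \<in> set h \<Longrightarrow> Inv i y \<in> set h \<Longrightarrow> x = y"
    and "distinct (map fst H)"
    and "\<And>i x r. (i, x, r) \<in> set H \<Longrightarrow> Inv i x \<in> set h"
    and "\<And>i r. Res i r \<in> set h \<Longrightarrow> \<exists>x. (i, x, r) \<in> set H"
    and "\<And>i j. precedes h i j \<Longrightarrow> j \<in> fst ` set H \<Longrightarrow> precedes (seq_events H) i j"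
  shows "tracks n B h H"
  unfolding tracks_def
proof (intro conjI allI impI)
  show "x = y" if "Inv i x \<in> set h \<and> Inv i y \<in> set h" for i x y
    using that by (elim conjE) (rule assms(6))
  show "precedes (seq_events H) i j" if "precedes h i j \<and> j \<in> fst ` set H" for i j
    using that by (elim conjE) (rule assms(10))
qed (fact assms(1-5,7-9))+

lemma tracks_Nil: "tracks n (\<lambda>_. False) [] []"
  by (auto simp: tracks_def precedes_def)

section \<open>Events of sequential histories and the real-time order\<close>

lemma set_seq_events: "set (seq_events H) = (\<Union>(i, x, r)\<in>set H. {Inv i x, Res i r})"
  by (auto simp: seq_events_def)

lemma seq_events_append: "seq_events (H @ H') = seq_events H @ seq_events H'"
  by (simp add: seq_events_def)

text \<open>Cutting the history between the two events avoids indices, so that the order can be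
  compared under \<open>@\<close>.\<close>

lemma precedes_iff:
  "precedes h i j \<longleftrightarrow> (\<exists>h1 h2 r x. h = h1 @ h2 \<and> Res i r \<in> set h1 \<and> Inv j x \<in> set h2)"
proof
  assume "precedes h i j"
  then obtain k l r x where "k < l" "l < length h" "h ! k = Res i r" "h ! l = Inv j x"
    by (auto simp: precedes_def)
  then have "Res i r \<in> set (take l h)" "Inv j x \<in> set (drop l h)"
    by (force simp: in_set_conv_nth, metis Cons_nth_drop_Suc list.set_intros(1))
  then show "\<exists>h1 h2 r x. h = h1 @ h2 \<and> Res i r \<in> set h1 \<and> Inv j x \<in> set h2"
    by (metis append_take_drop_id)
next
  assume "\<exists>h1 h2 r x. h = h1 @ h2 \<and> Res i r \<in> set h1 \<and> Inv j x \<in> set h2"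
  then obtain h1 h2 r x k l where "h = h1 @ h2" "k < length h1" "h1 ! k = Res i r"
    "l < length h2" "h2 ! l = Inv j x"
    by (auto simp: in_set_conv_nth)
  then have "k < length h1 + l" "length h1 + l < length h" "h ! k = Res i r"
    "h ! (length h1 + l) = Inv j x"
    by (auto simp: nth_append)
  then show "precedes h i j"
    unfolding precedes_def by blast
qed

lemma precedes_append: "precedes h i j \<Longrightarrow> precedes (h @ h') i j"
  unfolding precedes_iff by (metis append.assoc Un_iff set_append)

text \<open>Only a new invocation creates precedences, namely from every response so far; a response
  at the end creates none.\<close>

lemma precedes_snoc:
  "precedes (h @ [e]) i j \<longleftrightarrow>
     precedes h i j \<or> (\<exists>r x. Res i r \<in> set h \<and> e = Inv j x)"
proof
  assume "precedes (h @ [e]) i j"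
  then obtain k l r x where "k < l" "l < Suc (length h)" "(h @ [e]) ! k = Res i r"
    "(h @ [e]) ! l = Inv j x"
    by (auto simp: precedes_def)
  then show "precedes h i j \<or> (\<exists>r x. Res i r \<in> set h \<and> e = Inv j x)"
    unfolding precedes_def
    by (cases "l = length h") (auto simp: nth_append in_set_conv_nth less_Suc_eq split: if_splits)
next
  assume "precedes h i j \<or> (\<exists>r x. Res i r \<in> set h \<and> e = Inv j x)"
  then show "precedes (h @ [e]) i j"
    using precedes_append[of h i j "[e]"] precedes_iff[of "h @ [e]" i j] by (metis list.set_intros(1))
qed

text \<open>The identity \<open>(t, n t)\<close> is fresh, so the precedences created by the
  invocation concern an operation outside \<open>H\<close> and impose nothing yet.\<close>

lemma tracks_call:
  assumes tracks: "tracks n B h H" and idle: "\<not> B t"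
  shows "tracks (n(t := Suc (n t))) (B(t := True)) (h @ [Inv (t, n t) x]) H"
proof -
  note D = tracksD[OF tracks]
  have new: "(t, n t) \<notin> fst ` set H" "Inv (t, n t) y \<notin> set h" for y
    using D(1,8) by fastforce+
  show ?thesis
  proof (rule tracksI)
    show "k < (n(t := Suc (n t))) t'" if "Inv (t', k) y \<in> set (h @ [Inv (t, n t) x])" for t' k y
      using that D(1)[of t' k y] by auto
    show "k < (n(t := Suc (n t))) t'" if "Res (t', k) r \<in> set (h @ [Inv (t, n t) x])" for t' k r
      using that D(2)[of t' k r] by auto
    show "Suc k < (n(t := Suc (n t))) t'"
      if "Res (t', k) r \<in> set (h @ [Inv (t, n t) x])" "(B(t := True)) t'" for t' k r
      using that D(2,3)[of t' k r] by (auto split: if_splits)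
    show "0 < (n(t := Suc (n t))) t'" if "(B(t := True)) t'" for t'
      using that D(4)[of t'] by (auto split: if_splits)
    show "distinct (h @ [Inv (t, n t) x])"
      using D(5) new(2) by simp
    show "y = z" if "Inv i y \<in> set (h @ [Inv (t, n t) x])" "Inv i z \<in> set (h @ [Inv (t, n t) x])"
      for i y z
      using that new(2) D(6)[of i y z] by (cases "i = (t, n t)") auto
    show "Inv i y \<in> set (h @ [Inv (t, n t) x])" if "(i, y, r) \<in> set H" for i y r
      using D(8)[OF that] by simp
    show "\<exists>y. (i, y, r) \<in> set H" if "Res i r \<in> set (h @ [Inv (t, n t) x])" for i r
      using that D(9)[of i r] by simp
    show "precedes (seq_events H) i j"
      if "precedes (h @ [Inv (t, n t) x]) i j" "j \<in> fst ` set H" for i j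
      using that D(10)[of i j] new(1) unfolding precedes_snoc event.inject by blast
  qed (rule D(7))
qed

lemma tracks_ret:
  assumes tracks: "tracks n B h H" and "B t" and mem: "((t, n t - 1), x, r) \<in> set H"
  shows "tracks n (B(t := False)) (h @ [Res (t, n t - 1) r]) H"
proof -
  note D = tracksD[OF tracks]
  \<comment> \<open>The subtraction is truncated; a busy thread has at least one invocation, so
    \<open>n t - 1\<close> really is its latest number.\<close>
  have n: "Suc (n t - 1) = n t"
    using D(4)[OF \<open>B t\<close>] by simp
  have new: "Res (t, n t - 1) r \<notin> set h"
    using D(3)[of t "n t - 1" r] \<open>B t\<close> n by auto
  show ?thesis
  proof (rule tracksI)
    show "k < n t'" if "Inv (t', k) y \<in> set (h @ [Res (t, n t - 1) r])" for t' k y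
      using that D(1)[of t' k y] by simp
    show "k < n t'" if "Res (t', k) r' \<in> set (h @ [Res (t, n t - 1) r])" for t' k r'
      using that D(2)[of t' k r'] n by auto
    show "Suc k < n t'" if "Res (t', k) r' \<in> set (h @ [Res (t, n t - 1) r])" "(B(t := False)) t'"
      for t' k r'
      using that D(3)[of t' k r'] by (auto split: if_splits)
    show "0 < n t'" if "(B(t := False)) t'" for t'
      using that D(4)[of t'] by (auto split: if_splits)
    show "distinct (h @ [Res (t, n t - 1) r])"
      using D(5) new by simp
    show "y = z" if "Inv i y \<in> set (h @ [Res (t, n t - 1) r])" "Inv i z \<in> set (h @ [Res (t, n t - 1) r])"
      for i y z
      using that D(6)[of i y z] by simp
    show "Inv i y \<in> set (h @ [Res (t, n t - 1) r])" if "(i, y, r') \<in> set H" for i y r'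
      using D(8)[OF that] by simp
    show "\<exists>y. (i, y, r') \<in> set H" if "Res i r' \<in> set (h @ [Res (t, n t - 1) r])" for i r'
      using that D(9)[of i r'] mem by auto
    show "precedes (seq_events H) i j"
      if "precedes (h @ [Res (t, n t - 1) r]) i j" "j \<in> fst ` set H" for i j
      using that D(10)[of i j] by (simp add: precedes_snoc)
  qed (rule D(7))
qed

text \<open>Every operation that has responded is already in \<open>H\<close>, so a pending one may
  be appended at the end without violating real time.\<close>

lemma tracks_linearise:
  assumes tracks: "tracks n B h H" and inv: "Inv i x \<in> set h" and new: "i \<notin> fst ` set H"
  shows "tracks n B h (H @ [(i, x, r)])"
proof -
  note D = tracksD[OF tracks]
  have last: "precedes (seq_events (H @ [(i, x, r)])) j i" if "(j, y, r') \<in> set H" for j y r'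
  proof -
    have "Res j r' \<in> set (seq_events H)" "Inv i x \<in> set (seq_events [(i, x, r)])"
      using that by (force simp: set_seq_events)+
    then show ?thesis
      unfolding seq_events_append precedes_iff by blast
  qed
  show ?thesis
  proof (rule tracksI)
    show "Inv j y \<in> set h" if "(j, y, r') \<in> set (H @ [(i, x, r)])" for j y r'
      using that D(8)[of j y r'] inv by auto
    show "\<exists>y. (j, y, r') \<in> set (H @ [(i, x, r)])" if "Res j r' \<in> set h" for j r'
      using D(9)[OF that] by auto
    show "distinct (map fst (H @ [(i, x, r)]))"
      using D(7) new by simp
    show "precedes (seq_events (H @ [(i, x, r)])) j l"
      if "precedes h j l" "l \<in> fst ` set (H @ [(i, x, r)])" for j l
    proof (cases "l = i")
      case True
      obtain r' where "Res j r' \<in> set h"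
        using \<open>precedes h j l\<close> unfolding precedes_iff by (metis UnI1 set_append)
      then show ?thesis
        using D(9)[of j r'] last True by blast
    next
      case False
      then show ?thesis
        using that D(10)[of j l] by (simp add: seq_events_append precedes_append)
    qed
  qed (fact D)+
qed

lemma distinct_seq_events: "distinct (map fst H) \<Longrightarrow> distinct (seq_events H)"
  by (induction H) (force simp: set_seq_events seq_events_def)+

text \<open>\<open>H\<close> itself dictates the completion: a pending operation in \<open>H\<close>
  receives the response it has there, and one outside \<open>H\<close> is removed.\<close>

lemma tracks_linearisation:
  assumes "tracks n B h H" and "H \<in> Spec"
  shows "linearisation Spec h H"
proof -
  define R where "R = pending h - fst ` set H"
  define rs where "rs = map (\<lambda>(i, x, r). (i, r)) (filter (\<lambda>(i, x, r). i \<in> pending h) H)"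
  define h' where "h' = filter (\<lambda>e. event_id e \<notin> R) h @ map (\<lambda>(i, r). Res i r) rs"
  have inv_unique: "\<And>i x y. Inv i x \<in> set h \<Longrightarrow> Inv i y \<in> set h \<Longrightarrow> x = y"
    and inv: "\<And>i x r. (i, x, r) \<in> set H \<Longrightarrow> Inv i x \<in> set h"
    and res: "\<And>i r. Res i r \<in> set h \<Longrightarrow> \<exists>x. (i, x, r) \<in> set H"
    and dist: "distinct (map fst H)" "distinct h"
    using tracksD[OF assms(1)] by blast+
  have res_unique: "r = r'" if "(i, x, r) \<in> set H" "(i, x', r') \<in> set H" for i x r x' r'
    using eq_key_imp_eq_value[OF dist(1) that] by simp
  have rs_fst: "map fst rs = filter (\<lambda>i. i \<in> pending h) (map fst H)"
    unfolding rs_def by (induction H) auto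
  have pend: "\<exists>x. Inv i x \<in> set h" "Res i r \<notin> set h" if "i \<in> pending h" for i r
    using that by (auto simp: pending_def)
  have not_pend: "\<exists>r. Res i r \<in> set h" if "i \<notin> pending h" "Inv i x \<in> set h" for i x
    using that by (auto simp: pending_def)
  have set_rs: "(i, r) \<in> set rs \<longleftrightarrow> i \<in> pending h \<and> (\<exists>x. (i, x, r) \<in> set H)" for i r
    unfolding rs_def by force
  have fst_rs: "fst ` set rs = pending h - R"
    using arg_cong[OF rs_fst, of set] by (auto simp: R_def)
  have R: "i \<in> R \<longleftrightarrow> i \<in> pending h \<and> (\<forall>x r. (i, x, r) \<notin> set H)" for i
    unfolding R_def by force
  have "distinct rs"
    using rs_fst dist(1) by (metis distinct_filter distinct_map)
  then have "distinct (map (\<lambda>(i, r). Res i r) rs)"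
    by (auto simp: distinct_map inj_on_def)
  then have "distinct h'"
    unfolding h'_def using dist(2) pend(2) set_rs by fastforce
  \<comment> \<open>Both event lists are distinct, so equality of their sets is enough for equality
    of multisets.\<close>
  moreover have "set (seq_events H) = set h'"
  proof (rule set_eqI)
    fix e
    show "e \<in> set (seq_events H) \<longleftrightarrow> e \<in> set h'"
    proof (cases e)
      case (Inv i x)
      have "(\<exists>r. (i, x, r) \<in> set H) \<longleftrightarrow> Inv i x \<in> set h \<and> i \<notin> R"
      proof (intro iffI conjI)
        assume "Inv i x \<in> set h \<and> i \<notin> R"
        then obtain y r where "(i, y, r) \<in> set H"
          using R not_pend res by blast
        with inv inv_unique \<open>Inv i x \<in> set h \<and> i \<notin> R\<close> show "\<exists>r. (i, x, r) \<in> set H"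
          by blast
      qed (use inv R in blast)+
      then show ?thesis
        using Inv by (auto simp: set_seq_events h'_def)
    next
      case (Res i r)
      have "(\<exists>x. (i, x, r) \<in> set H) \<longleftrightarrow> (Res i r \<in> set h \<and> i \<notin> R) \<or> (i, r) \<in> set rs"
      proof
        assume "\<exists>x. (i, x, r) \<in> set H"
        then obtain x where x: "(i, x, r) \<in> set H" by blast
        show "(Res i r \<in> set h \<and> i \<notin> R) \<or> (i, r) \<in> set rs"
        proof (cases "i \<in> pending h")
          case True
          then show ?thesis
            using x set_rs by blast
        next
          case False
          then obtain r' where "Res i r' \<in> set h"
            using not_pend inv[OF x] by blast
          then show ?thesis
            using res res_unique[OF x] R x by blast
        qed
      qed (use res set_rs in blast)
      then show ?thesis
        using Res by (auto simp: set_seq_events h'_def)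
    qed
  qed
  ultimately have "mset (seq_events H) = mset h'"
    using set_eq_iff_mset_eq_distinct distinct_seq_events dist(1) by blast
  moreover have "completion h h'"
  proof -
    have "R \<subseteq> pending h" "distinct (map fst rs)"
      using dist(1) by (auto simp: R_def rs_fst)
    then show ?thesis
      unfolding completion_def using fst_rs h'_def by blast
  qed
  ultimately show ?thesis
    using assms(2) tracks_precedes[OF assms(1)] unfolding linearisation_def by blast
qed

text \<open>
  The function \<open>f\<close> is obtained by choosing, step by step, a ghost state that satisfies the
  invariant \<open>J\<close>; prefix preservation is then built in.
\<close>

lemma strongly_linearisable_by_ghost:
  fixes I :: "('c, 't, 'op, 'r) implementation"
    and J :: "('t \<Rightarrow> nat) \<Rightarrow> ('t, 'op, 'r) event list \<Rightarrow> 'c \<Rightarrow> 'g \<Rightarrow> bool"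
    and out :: "'g \<Rightarrow> ('t, 'op, 'r) seq_history"
  assumes start: "\<And>c. c \<in> start I \<Longrightarrow> \<exists>\<gamma>. J (\<lambda>_. 0) [] c \<gamma>"
    and step: "\<And>n h c \<gamma> l c'. J n h c \<gamma> \<Longrightarrow> transition I c l c' \<Longrightarrow>
      \<exists>\<gamma>'. J (count_call n l) (h @ label_events n l) c' \<gamma>' \<and> prefix (out \<gamma>) (out \<gamma>')"
    and lin: "\<And>n h c \<gamma>. J n h c \<gamma> \<Longrightarrow> linearisation Spec h (out \<gamma>)"
  shows "strongly_linearisable I Spec"
proof -
  \<comment> \<open>The choice depends only on the counters, history and ghost state so far and on
    the step, so two executions choose alike on their common prefix.\<close>
  define next_ghost where "next_ghost n h \<gamma> l c' =
      (SOME \<gamma>'. J (count_call n l) (h @ label_events n l) c' \<gamma>' \<and> prefix (out \<gamma>) (out \<gamma>'))"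
    for n h \<gamma> l c'
  define stp where "stp = (\<lambda>(n, h, \<gamma>) (l, c').
      (count_call n l, h @ label_events n l, next_ghost n h \<gamma> l c'))"
  define init_ghost where "init_ghost c = (SOME \<gamma>. J (\<lambda>_. 0) [] c \<gamma>)" for c
  define run where "run \<sigma> = foldl stp (\<lambda>_. 0, [], init_ghost (fst \<sigma>)) (snd \<sigma>)" for \<sigma>
  define f where "f \<sigma> = out (snd (snd (run \<sigma>)))" for \<sigma>
  \<comment> \<open>The last conjunct identifies \<open>c'\<close> as the state reached by
    \<open>xs\<close>, from which the run of a longer execution is resumed.\<close>
  have steps: "\<exists>n' \<gamma>' c'. foldl stp (n, h, \<gamma>) xs = (n', h @ history_from n (map fst xs), \<gamma>') \<and>
      J n' (h @ history_from n (map fst xs)) c' \<gamma>' \<and> prefix (out \<gamma>) (out \<gamma>') \<and>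
      (\<forall>ys. path I c (xs @ ys) \<longrightarrow> path I c' ys)"
    if "J n h c \<gamma>" "path I c xs" for n h c \<gamma> xs
    using that
  proof (induction xs arbitrary: n h c \<gamma>)
    case Nil
    then show ?case by auto
  next
    case (Cons y xs)
    obtain l c' where y: "y = (l, c')" by (cases y)
    have "transition I c l c'" "path I c' xs"
      using Cons.prems y by auto
    have ghost: "J (count_call n l) (h @ label_events n l) c' (next_ghost n h \<gamma> l c') \<and>
        prefix (out \<gamma>) (out (next_ghost n h \<gamma> l c'))"
      unfolding next_ghost_def by (rule someI_ex[OF step[OF Cons.prems(1) \<open>transition I c l c'\<close>]])
    from Cons.IH[OF conjunct1[OF this] \<open>path I c' xs\<close>]
    obtain n' \<gamma>' d where tail: "foldl stp (count_call n l, h @ label_events n l, next_ghost n h \<gamma> l c') xs =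
          (n', h @ history_from n (map fst (y # xs)), \<gamma>')"
        "J n' (h @ history_from n (map fst (y # xs))) d \<gamma>'"
        "prefix (out (next_ghost n h \<gamma> l c')) (out \<gamma>')"
        "\<forall>ys. path I c' (xs @ ys) \<longrightarrow> path I d ys"
      by (auto simp: y history_from_Cons)
    show ?case
    proof (intro exI conjI)
      show "foldl stp (n, h, \<gamma>) (y # xs) = (n', h @ history_from n (map fst (y # xs)), \<gamma>')"
        using tail(1) by (simp add: y stp_def)
      show "prefix (out \<gamma>) (out \<gamma>')"
        using tail(3) ghost prefix_order.trans by blast
      show "\<forall>ys. path I c ((y # xs) @ ys) \<longrightarrow> path I d ys"
        using tail(4) by (simp add: y)
    qed (rule tail(2))
  qed
  have init: "J (\<lambda>_. 0) [] c (init_ghost c)" if "c \<in> start I" for c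
    using someI_ex[OF start[OF that]] by (simp add: init_ghost_def)
  have "linearisation Spec (history \<sigma>) (f \<sigma>)" if \<sigma>: "\<sigma> \<in> executions I" for \<sigma>
  proof -
    obtain c xs where \<sigma>: "\<sigma> = (c, xs)" "c \<in> start I" "path I c xs"
      using \<sigma> unfolding executions_def by blast
    from steps[OF init[OF \<sigma>(2)] \<sigma>(3)] show ?thesis
      using lin \<sigma>(1) by (auto simp: f_def run_def history_def labels_def)
  qed
  moreover have "prefix (f \<sigma>) (f \<sigma>')"
    if exec: "\<sigma> \<in> executions I" "\<sigma>' \<in> executions I" "exec_prefix \<sigma> \<sigma>'" for \<sigma> \<sigma>'
  proof -
    obtain c xs ys where \<sigma>: "\<sigma> = (c, xs)" "\<sigma>' = (c, xs @ ys)" "c \<in> start I" "path I c (xs @ ys)"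
        "path I c xs"
      using exec by (cases \<sigma>; cases \<sigma>') (auto simp: executions_def exec_prefix_def prefix_def)
    from steps[OF init[OF \<sigma>(3)] \<sigma>(5)] obtain n' h' \<gamma>' c' where
        xs: "run \<sigma> = (n', h', \<gamma>')" "J n' h' c' \<gamma>'" "path I c' ys"
      using \<sigma> by (auto simp: run_def)
    have "run \<sigma>' = foldl stp (n', h', \<gamma>') ys"
      using xs(1) \<sigma> by (simp add: run_def)
    with steps[OF xs(2,3)] xs(1) show ?thesis
      by (auto simp: f_def)
  qed
  ultimately show ?thesis
    unfolding strongly_linearisable_def strongly_linearisable_on_def by blast
qed

section \<open>Relaxation\<close>

lemma before_subset: "before xs x \<subseteq> set xs"
  by (auto simp: before_def)

lemma before_append: "x \<notin> set ys \<Longrightarrow> before (xs @ ys) x = before xs x"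
proof (intro equalityI subsetI)
  fix y
  assume x: "x \<notin> set ys" and "y \<in> before (xs @ ys) x"
  then obtain k l where kl: "k < l" "l < length (xs @ ys)" "(xs @ ys) ! l = x" "(xs @ ys) ! k = y"
    by (auto simp: before_def)
  have "l < length xs"
  proof (rule ccontr)
    assume "\<not> l < length xs"
    then have "x = ys ! (l - length xs)" "l - length xs < length ys"
      using kl by (auto simp: nth_append)
    then show False
      using x nth_mem by blast
  qed
  with kl show "y \<in> before xs x"
    unfolding before_def by (auto simp: nth_append)
next
  fix y
  assume "y \<in> before xs x"
  then obtain k l where kl: "k < l" "l < length xs" "xs ! l = x" "xs ! k = y"
    by (auto simp: before_def)
  then have "k < l" "l < length (xs @ ys)" "(xs @ ys) ! l = x" "(xs @ ys) ! k = y"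
    by (auto simp: nth_append)
  then show "y \<in> before (xs @ ys) x"
    unfolding before_def by blast
qed

lemma set_subset_before:
  assumes "x \<in> set ys"
  shows "set xs \<subseteq> before (xs @ ys) x"
proof
  fix y
  assume "y \<in> set xs"
  then obtain k where k: "k < length xs" "xs ! k = y"
    by (auto simp: in_set_conv_nth)
  obtain l where l: "l < length ys" "ys ! l = x"
    using assms by (auto simp: in_set_conv_nth)
  have "k < length xs + l" "length xs + l < length (xs @ ys)" "(xs @ ys) ! k = y"
    "(xs @ ys) ! (length xs + l) = x"
    using k l by (auto simp: nth_append)
  then show "y \<in> before (xs @ ys) x"
    unfolding before_def by blast
qed

text \<open>The case of a buffered update. No entry of \<open>H\<close> gets a new predecessor, so
  only the number of omitted entries has to be bounded anew.\<close>

lemma r_relaxation_append_right: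
  assumes "r_relaxation r H H'" and "wf_seq (H' @ [e])" and "card (set (H' @ [e]) - set H) \<le> r"
  shows "r_relaxation r H (H' @ [e])"
proof -
  have "e \<notin> set H'"
    using assms(2) by (auto simp: wf_seq_def)
  then have "before (H' @ [e]) x = before H' x" if "x \<in> set H" for x
    using that assms(1) by (intro before_append) (auto simp: r_relaxation_def)
  then show ?thesis
    using assms by (auto simp: r_relaxation_def)
qed

text \<open>The case of a merged buffer. The late entries follow all of \<open>H\<close>, so each of
  them misses at most what \<open>H\<close> still lacked before the append.\<close>

lemma r_relaxation_append_left:
  assumes "r_relaxation r H H'" and "wf_seq (H @ D)" and "set D \<subseteq> set H'"
  shows "r_relaxation r (H @ D) H'"
proof -
  have card: "card (set H' - set H) \<le> r" and card_before: "\<forall>x\<in>set H. card (before H' x - before H x) \<le> r"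
    using assms(1) by (auto simp: r_relaxation_def)
  have card_before': "card (before H' x - before (H @ D) x) \<le> r" if "x \<in> set (H @ D)" for x
  proof (cases "x \<in> set D")
    case True
    then have "before H' x - before (H @ D) x \<subseteq> set H' - set H"
      using set_subset_before[of x D H] before_subset[of H' x] by blast
    then show ?thesis
      using card by (meson List.finite_set card_mono finite_Diff le_trans)
  next
    case False
    then show ?thesis
      using that card_before before_append[of x D H] by auto
  qed
  have "card (set H' - set (H @ D)) \<le> card (set H' - set H)"
    by (rule card_mono) auto
  with card card_before' show ?thesis
    using assms by (auto simp: r_relaxation_def)
qed

text \<open>The case of queries and filtered updates. The new entry misses exactly what
  \<open>H\<close> lacks of \<open>H'\<close>, so the bound on omissions also bounds the
  reordering.\<close>

lemma r_relaxation_append_both: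
  assumes "r_relaxation r H H'" and "wf_seq (H' @ [e])"
  shows "r_relaxation r (H @ [e]) (H' @ [e])"
proof -
  have card: "card (set H' - set H) \<le> r" and card_before: "\<forall>x\<in>set H. card (before H' x - before H x) \<le> r"
    and sub: "set H \<subseteq> set H'" and "wf_seq H"
    using assms(1) by (auto simp: r_relaxation_def)
  have "fst e \<notin> fst ` set H'"
    using assms(2) by (auto simp: wf_seq_def)
  then have fresh: "e \<notin> set H'" "fst e \<notin> fst ` set H"
    using sub by auto
  have "card (before (H' @ [e]) x - before (H @ [e]) x) \<le> r" if "x \<in> set (H @ [e])" for x
  proof (cases "x = e")
    case True
    have "before (H' @ [e]) e \<subseteq> set H'"
      using fresh(1) by (auto simp: before_def nth_append split: if_splits)
    then have "before (H' @ [e]) x - before (H @ [e]) x \<subseteq> set H' - set H"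
      using set_subset_before[of e "[e]" H] True by auto
    then show ?thesis
      using card by (meson List.finite_set card_mono finite_Diff le_trans)
  next
    case False
    then show ?thesis
      using that card_before before_append[of x "[e]" H] before_append[of x "[e]" H'] by auto
  qed
  moreover have "set (H' @ [e]) - set (H @ [e]) \<subseteq> set H' - set H" by auto
  then have "card (set (H' @ [e]) - set (H @ [e])) \<le> r"
    using card by (meson List.finite_set card_mono finite_Diff le_trans)
  ultimately show ?thesis
    using assms \<open>wf_seq H\<close> sub fresh(2) by (auto simp: r_relaxation_def wf_seq_def)
qed

section \<open>Executions of the shared sketch\<close>

fun pend :: "('t \<Rightarrow> 'op option) \<Rightarrow> ('t, 'op, 'r) label \<Rightarrow> 't \<Rightarrow> 'op option" where
  "pend P (Call t x) = P(t := Some x)"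
| "pend P (Ret t r) = P(t := None)"
| "pend P (Step t) = P"

fun permits ::
    "('s, 'a, 'q, 'v, 'h, 'c) composable \<Rightarrow> (thread \<Rightarrow> 's shared_op option) \<Rightarrow>
     (thread, 's shared_op, ('s, 'h) shared_ret) label \<Rightarrow> bool" where
  "permits S P (Call t x) \<longleftrightarrow> P t = None \<and>
     (x \<noteq> Snapshot \<longrightarrow> (\<forall>t'. P t' = None \<or> P t' = Some Snapshot)) \<and>
     (\<forall>s. x = Merge s \<longrightarrow> (\<exists>A. summarises S s A))"
| "permits S P (Ret t r) \<longleftrightarrow> P t \<noteq> None"
| "permits S P (Step t) \<longleftrightarrow> P t \<noteq> None"

lemma permitted_from_Cons:
  "permitted_from S P (l # ls) \<longleftrightarrow> permits S P l \<and> permitted_from S (pend P l) ls"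
  by (cases l) auto

lemma permitted_from_append:
  "permitted_from S P (ls @ ls') \<longleftrightarrow>
     permitted_from S P ls \<and> permitted_from S (foldl pend P ls) ls'"
  by (induction ls arbitrary: P) (simp_all add: permitted_from_Cons)

text \<open>Threads of a permitted execution are sequential, so an invocation without a response is
  the latest one of its thread and still pending. This later identifies the operations that
  \<open>f\<close> newly linearises.\<close>

lemma permitted_invocations:
  assumes "permitted_from S (\<lambda>_. None) ls" and "Inv (t, k) x \<in> set (history_from (\<lambda>_. 0) ls)"
  shows "k < foldl count_call (\<lambda>_. 0) ls t \<and>
    ((Suc k = foldl count_call (\<lambda>_. 0) ls t \<and> foldl pend (\<lambda>_. None) ls t = Some x) \<or>
     (\<exists>r. Res (t, k) r \<in> set (history_from (\<lambda>_. 0) ls)))"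
  using assms
proof (induction ls arbitrary: t k x rule: rev_induct)
  case (snoc l ls)
  let ?n = "foldl count_call (\<lambda>_. 0) ls" and ?h = "history_from (\<lambda>_. 0) ls"
  have perm: "permitted_from S (\<lambda>_. None) ls" "permits S (foldl pend (\<lambda>_. None) ls) l"
    using snoc.prems(1) by (simp_all add: permitted_from_append permitted_from_Cons)
  note IH = snoc.IH[OF perm(1)]
  have h: "history_from (\<lambda>_. 0) (ls @ [l]) = ?h @ label_events ?n l"
    by (simp add: history_from_append history_from_Cons)
  show ?case
  proof (cases l)
    case (Call t' y)
    then have "Inv (t, k) x \<in> set ?h \<or> t' = t \<and> k = ?n t \<and> y = x"
      using snoc.prems(2) unfolding h by auto
    then consider "Inv (t, k) x \<in> set ?h" | "t' = t" "k = ?n t" "y = x"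
      by blast
    then show ?thesis
      unfolding h using Call perm(2) by cases (auto dest!: IH)
  next
    case (Ret t' r)
    then have "Inv (t, k) x \<in> set ?h"
      using snoc.prems(2) unfolding h by simp
    from IH[OF this] show ?thesis
      unfolding h using Ret by auto
  next
    case (Step t')
    then have "Inv (t, k) x \<in> set ?h"
      using snoc.prems(2) unfolding h by simp
    from IH[OF this] show ?thesis
      unfolding h using Step by auto
  qed
qed simp

definition final :: "'c \<Rightarrow> ('l \<times> 'c) list \<Rightarrow> 'c" where
  "final c xs = last (c # map snd xs)"

lemma path_snoc: "path I c (xs @ [(l, c')]) \<longleftrightarrow> path I c xs \<and> transition I (final c xs) l c'"
  by (induction xs arbitrary: c) (auto simp: final_def)

lemma linearisation_inv:
  assumes "linearisation Spec h H" and "(i, x, r) \<in> set H"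
  shows "Inv i x \<in> set h"
proof -
  obtain h' where h': "completion h h'" "mset (seq_events H) = mset h'"
    using assms(1) by (auto simp: linearisation_def)
  have "Inv i x \<in> set h'"
    using mset_eq_setD[OF h'(2)] assms(2) by (fastforce simp: set_seq_events)
  then show ?thesis
    using h'(1) by (auto simp: completion_def)
qed

lemma linearisation_res:
  assumes "linearisation Spec h H" and "Res i r \<in> set h"
  shows "\<exists>x. (i, x, r) \<in> set H"
proof -
  obtain h' where h': "completion h h'" "mset (seq_events H) = mset h'"
    using assms(1) by (auto simp: linearisation_def)
  have "i \<notin> pending h"
    using assms(2) by (auto simp: pending_def)
  then have "Res i r \<in> set h'"
    using h'(1) assms(2) by (auto simp: completion_def)
  then show ?thesis
    using mset_eq_setD[OF h'(2)] by (auto simp: set_seq_events)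
qed

text \<open>\<open>P\<close> and \<open>n\<close> are determined by \<open>\<sigma>\<close>; as
  separate arguments they can be equated with what the program counters and the ghost counters
  say.\<close>

definition shared_exec ::
    "('s, 'a, 'q, 'v, 'h, 'c) composable \<Rightarrow>
     ('c, thread, 's shared_op, ('s, 'h) shared_ret) execution \<Rightarrow> 'c \<Rightarrow>
     (thread \<Rightarrow> 's shared_op option) \<Rightarrow> (thread \<Rightarrow> nat) \<Rightarrow> bool" where
  "shared_exec S \<sigma> c P n \<longleftrightarrow>
     \<sigma> \<in> executions (shared S) \<inter> permitted S \<and> c = final (fst \<sigma>) (snd \<sigma>) \<and>
     P = foldl pend (\<lambda>_. None) (labels \<sigma>) \<and> n = foldl count_call (\<lambda>_. 0) (labels \<sigma>)"

lemma shared_exec_start: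
  "c \<in> start (shared S) \<Longrightarrow> shared_exec S (c, []) c (\<lambda>_. None) (\<lambda>_. 0)"
  by (simp add: shared_exec_def executions_def permitted_def labels_def final_def)

text \<open>By prefix preservation the longer execution only appends a list \<open>D\<close>. An
  entry of \<open>D\<close> had not responded before, since it would then be in
  \<open>f \<sigma>\<close> and identities do not repeat; so it is the pending operation of its
  thread. Pending operations are taken after a call but before a response, because either kind of
  step may linearise its own operation.\<close>

lemma shared_exec_step:
  fixes S :: "('s, 'a, 'q, 'v, 'h, 'c) composable"
  assumes lin: "\<forall>\<sigma>\<in>executions (shared S) \<inter> permitted S. linearisation Spec (history \<sigma>) (f \<sigma>)"
    and pref: "\<forall>\<sigma>\<in>executions (shared S) \<inter> permitted S. \<forall>\<sigma>'\<in>executions (shared S) \<inter> permitted S.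
      exec_prefix \<sigma> \<sigma>' \<longrightarrow> prefix (f \<sigma>) (f \<sigma>')"
    and exec: "shared_exec S \<sigma> c P n" and trans: "transition (shared S) c l c'"
    and perm: "permits S P l"
    and wf: "\<And>H. H \<in> Spec \<Longrightarrow> wf_seq H"
  shows "\<exists>\<sigma>' D. shared_exec S \<sigma>' c' (pend P l) (count_call n l) \<and> f \<sigma>' = f \<sigma> @ D \<and> f \<sigma>' \<in> Spec \<and>
    (\<forall>t k x r. ((t, k), x, r) \<in> set D \<longrightarrow> Suc k = count_call n l t \<and>
       (case l of Call t' y \<Rightarrow> pend P l t | _ \<Rightarrow> P t) = Some x) \<and>
    (\<forall>t r. l = Ret t r \<longrightarrow> (\<exists>x. ((t, n t - 1), x, r) \<in> set (f \<sigma>')))"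
proof -
  define \<sigma>' where "\<sigma>' = (fst \<sigma>, snd \<sigma> @ [(l, c')])"
  have labels: "labels \<sigma>' = labels \<sigma> @ [l]"
    by (simp add: \<sigma>'_def labels_def)
  have \<sigma>: "\<sigma> \<in> executions (shared S) \<inter> permitted S" and c: "c = final (fst \<sigma>) (snd \<sigma>)"
    and P: "P = foldl pend (\<lambda>_. None) (labels \<sigma>)" and n: "n = foldl count_call (\<lambda>_. 0) (labels \<sigma>)"
    using exec by (auto simp: shared_exec_def)
  have perm_ls: "permitted_from S (\<lambda>_. None) (labels \<sigma>)"
    using \<sigma> by (simp add: permitted_def)
  have \<sigma>': "\<sigma>' \<in> executions (shared S) \<inter> permitted S"
  proof -
    have "permitted_from S (\<lambda>_. None) (labels \<sigma>')"
      using perm_ls perm by (simp add: labels permitted_from_append permitted_from_Cons P)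
    moreover have "\<sigma>' \<in> executions (shared S)"
      using \<sigma> trans unfolding executions_def \<sigma>'_def c by (auto simp: path_snoc)
    ultimately show ?thesis
      by (simp add: permitted_def)
  qed
  have history: "history \<sigma>' = history \<sigma> @ label_events n l"
    by (simp add: history_def labels history_from_append history_from_Cons n)
  have "prefix (f \<sigma>) (f \<sigma>')"
    using pref \<sigma> \<sigma>' by (auto simp: exec_prefix_def \<sigma>'_def)
  then obtain D where D: "f \<sigma>' = f \<sigma> @ D"
    by (auto elim: prefixE)
  have spec: "f \<sigma>' \<in> Spec"
    using lin \<sigma>' by (auto simp: linearisation_def)
  have "distinct (map fst (f \<sigma>'))"
    using wf[OF spec] by (simp add: wf_seq_def)
  then have disj: "fst ` set (f \<sigma>) \<inter> fst ` set D = {}"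
    by (simp add: D)
  have exec': "shared_exec S \<sigma>' c' (pend P l) (count_call n l)"
    using \<sigma>' by (simp add: shared_exec_def labels P n) (simp add: \<sigma>'_def final_def)
  have new: "Suc k = count_call n l t \<and> (case l of Call t' y \<Rightarrow> pend P l t | _ \<Rightarrow> P t) = Some x"
    if mem: "((t, k), x, r) \<in> set D" for t k x r
  proof -
    have no_res: "Res (t, k) r' \<notin> set (history \<sigma>)" for r'
    proof
      assume "Res (t, k) r' \<in> set (history \<sigma>)"
      then obtain y where "((t, k), y, r') \<in> set (f \<sigma>)"
        using linearisation_res lin \<sigma> by metis
      then show False
        using disj mem by (metis disjoint_iff fst_conv image_eqI)
    qed
    have inv: "Inv (t, k) x \<in> set (history \<sigma>')"
      using linearisation_inv lin \<sigma>' mem D by (metis Un_iff set_append)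
    have old: "Suc k = n t \<and> P t = Some x" if "Inv (t, k) x \<in> set (history \<sigma>)"
      using permitted_invocations[OF perm_ls, of t k x] that no_res
      by (auto simp: history_def n P)
    show ?thesis
    proof (cases l)
      case (Call t' y)
      show ?thesis
      proof (cases "Inv (t, k) x \<in> set (history \<sigma>)")
        case True
        then show ?thesis
          using old perm Call by (cases "t = t'") auto
      next
        case False
        then show ?thesis
          using inv Call by (auto simp: history)
      qed
    next
      case (Ret t' y)
      then show ?thesis
        using inv old by (auto simp: history)
    next
      case (Step t')
      then show ?thesis
        using inv old by (auto simp: history)
    qed
  qed
  have ret: "\<exists>x. ((t, n t - 1), x, r) \<in> set (f \<sigma>')" if "l = Ret t r" for t r
  proof -
    have "Res (t, n t - 1) r \<in> set (history \<sigma>')"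
      using that by (simp add: history)
    then show ?thesis
      using linearisation_res lin \<sigma>' by metis
  qed
  show ?thesis
    using exec' D spec new ret by blast
qed

section \<open>Memory\<close>

definition latest :: "('s, 'h) memory \<Rightarrow> loc \<Rightarrow> ('s, 'h) val" where
  "latest m x = last (written m x)"

definition fresh :: "('s, 'h) memory \<Rightarrow> thread \<Rightarrow> loc \<Rightarrow> bool" where
  "fresh m t x \<longleftrightarrow> Suc (seen m t x) = length (written m x)"

definition fresh_published :: "('s, 'h) memory \<Rightarrow> nat \<Rightarrow> loc \<Rightarrow> bool" where
  "fresh_published m i x \<longleftrightarrow> Suc (published m i x) = length (written m x)"

definition mem_ok :: "('s, 'h) memory \<Rightarrow> bool" where
  "mem_ok m \<longleftrightarrow> (\<forall>t x. seen m t x < length (written m x)) \<and>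
     (\<forall>i x. published m i x < length (written m x))"

text \<open>\<open>seen m t x\<close> is then the index of the last write, which leaves the weak
  read a single choice.\<close>

lemma reads_fresh:
  assumes "fresh m t x" and "reads m t x v"
  shows "latest m x = v"
proof -
  obtain k where "seen m t x \<le> k" "k < length (written m x)" "written m x ! k = v"
    using assms(2) by (auto simp: reads_def)
  with assms(1) show ?thesis
    by (cases "written m x" rule: rev_cases) (auto simp: fresh_def latest_def nth_append)
qed

lemma mem_ok_store [simp]: "mem_ok m \<Longrightarrow> mem_ok (store t x v m)"
  by (auto simp: mem_ok_def store_def less_SucI)

lemma mem_ok_acquire [simp]: "mem_ok m \<Longrightarrow> mem_ok (acquire t i m)"
  by (auto simp: mem_ok_def acquire_def sup_nat_def)

lemma mem_ok_write_prop [simp]: "mem_ok m \<Longrightarrow> mem_ok (write_prop t i h m)"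
  by (auto simp: mem_ok_def write_prop_def sup_nat_def)

lemma latest_simps [simp]:
  "latest (store t x v m) y = (if y = x then v else latest m y)"
  "latest (acquire t i m) y = latest m y"
  "latest (write_prop t i h m) y = latest m y"
  by (auto simp: latest_def store_def acquire_def write_prop_def)

lemma prop_val_simps [simp]:
  "prop_val (store t x v m) = prop_val m"
  "prop_val (acquire t i m) = prop_val m"
  "prop_val (write_prop t i h m) = (prop_val m)(i := h)"
  by (auto simp: store_def acquire_def write_prop_def)

text \<open>\<open>acquire\<close> takes the larger of two indices. Under \<open>mem_ok\<close>
  neither exceeds the last write, so the maximum reaches it only if one of them does. A store makes
  its location stale for all other threads.\<close>

lemma fresh_simps [simp]:
  assumes "mem_ok m"
  shows "fresh (store t x v m) t' y \<longleftrightarrow> (if y = x then t' = t else fresh m t' y)"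
    and "fresh (acquire t i m) t' y \<longleftrightarrow> fresh m t' y \<or> t' = t \<and> fresh_published m i y"
    and "fresh (write_prop t i h m) t' y \<longleftrightarrow> fresh m t' y"
proof -
  have *: "seen m t y < length (written m y)" "published m i y < length (written m y)" for t i y
    using assms by (auto simp: mem_ok_def)
  show "fresh (store t x v m) t' y \<longleftrightarrow> (if y = x then t' = t else fresh m t' y)"
    using *(1)[of t' y] by (auto simp: fresh_def store_def)
  show "fresh (acquire t i m) t' y \<longleftrightarrow> fresh m t' y \<or> t' = t \<and> fresh_published m i y"
    using *(1)[of t y] *(2)[of i y]
    by (auto simp: fresh_def fresh_published_def acquire_def sup_nat_def max_def)
  show "fresh (write_prop t i h m) t' y \<longleftrightarrow> fresh m t' y"
    by (simp add: fresh_def write_prop_def)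
qed

text \<open>A store outdates the published index of its location; it becomes current again only when
  a thread for which the location is fresh writes the atomic variable.\<close>

lemma fresh_published_simps [simp]:
  assumes "mem_ok m"
  shows "fresh_published (store t x v m) i y \<longleftrightarrow> y \<noteq> x \<and> fresh_published m i y"
    and "fresh_published (acquire t j m) i y \<longleftrightarrow> fresh_published m i y"
    and "fresh_published (write_prop t j h m) i y \<longleftrightarrow>
      fresh_published m i y \<or> i = j \<and> fresh m t y"
proof -
  have *: "seen m t y < length (written m y)" "published m i y < length (written m y)" for t i y
    using assms by (auto simp: mem_ok_def)
  show "fresh_published (store t x v m) i y \<longleftrightarrow> y \<noteq> x \<and> fresh_published m i y"
    using *(2)[of i y] by (auto simp: fresh_published_def store_def)
  show "fresh_published (acquire t j m) i y \<longleftrightarrow> fresh_published m i y"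
    by (simp add: fresh_published_def acquire_def)
  show "fresh_published (write_prop t j h m) i y \<longleftrightarrow>
      fresh_published m i y \<or> i = j \<and> fresh m t y"
    using *(1)[of t y] *(2)[of i y]
    by (auto simp: fresh_published_def fresh_def write_prop_def sup_nat_def max_def)
qed

section \<open>Sequential histories of a sketch\<close>

fun updates_of :: "('t, ('a, 'q) sketch_op, 'v sketch_ret) seq_history \<Rightarrow> 'a list" where
  "updates_of [] = []"
| "updates_of ((i, Update a, r) # H) = a # updates_of H"
| "updates_of ((i, Query q, r) # H) = updates_of H"

definition update_entry ::
    "'t opid \<times> 'a \<Rightarrow> 't opid \<times> ('a, 'q) sketch_op \<times> 'v sketch_ret" where
  "update_entry e = (fst e, Update (snd e), Ack)"

lemma updates_of_append: "updates_of (H @ H') = updates_of H @ updates_of H'"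
  by (induction H rule: updates_of.induct) auto

lemma seq_run_append:
  "seq_run S s (H @ H') \<longleftrightarrow> seq_run S s H \<and> seq_run S (foldl (update S) s (updates_of H)) H'"
  by (induction S s H rule: seq_run.induct) auto

lemma updates_of_entries [simp]: "updates_of (map update_entry xs) = map snd xs"
  by (induction xs) (auto simp: update_entry_def)

lemma seq_run_entries [simp]: "seq_run S s (map update_entry xs)"
  by (induction xs arbitrary: s) (auto simp: update_entry_def)

section \<open>Multisets and cardinalities\<close>

lemma distinct_if_mset_subset:
  assumes "mset xs \<subseteq># mset ys" and "distinct ys"
  shows "distinct xs"
  unfolding distinct_count_atmost_1
proof
  fix x
  have "count (mset xs) x \<le> count (mset ys) x"
    by (rule mset_subset_eq_count[OF assms(1)])
  moreover have "count (mset ys) x \<le> 1"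
    using assms(2) by (simp add: distinct_count_atmost_1)
  ultimately have "count (mset xs) x \<le> 1" by simp
  then show "count (mset xs) x = (if x \<in> set xs then 1 else 0)"
    using count_mset_0_iff[of xs x] by (auto simp del: count_mset_0_iff)
qed

lemma size_sum_mset:
  fixes M :: "'i \<Rightarrow> 'x multiset"
  shows "size (\<Sum>i\<in>I. M i) = (\<Sum>i\<in>I. size (M i))"
  by (induction I rule: infinite_finite_induct) auto

lemma card_set_mset_le: "card (set_mset M) \<le> size M"
  by (induction M) (auto simp: card_insert_if)

lemma card_set_diff_le:
  assumes "mset H' = mset H + M"
  shows "card (set H' - set H) \<le> size M"
proof -
  have "set H' = set H \<union> set_mset M"
    using arg_cong[OF assms, of set_mset] by simp
  then have "set H' - set H \<subseteq> set_mset M"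
    by blast
  then have "card (set H' - set H) \<le> card (set_mset M)"
    by (rule card_mono[OF finite_set_mset])
  then show ?thesis
    using card_set_mset_le[of M] by linarith
qed

section \<open>The invariant\<close>

text \<open>\<open>Some i\<close> from the read of a zero \<open>prop\<^sub>i\<close> until the
  write that makes it non-zero; during this time the non-current local sketch of \<open>i\<close>
  belongs to the propagator.\<close>

fun at_index :: "('s, 'h) prop_pc \<Rightarrow> nat option" where
  "at_index (PNext T) = None"
| "at_index (PCur T i) = Some i"
| "at_index (PLocal T i j) = Some i"
| "at_index (PCallMerge T i s) = Some i"
| "at_index (PMerge T i) = Some i"
| "at_index (PCur' T i) = Some i"
| "at_index (PClear T i j) = Some i"
| "at_index (PCallHint T i) = Some i"
| "at_index (PHint T i) = Some i"
| "at_index (PSetProp T i h) = Some i"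

fun remaining :: "('s, 'h) prop_pc \<Rightarrow> nat set" where
  "remaining (PNext T) = T"
| "remaining (PCur T i) = T"
| "remaining (PLocal T i j) = T"
| "remaining (PCallMerge T i s) = T"
| "remaining (PMerge T i) = T"
| "remaining (PCur' T i) = T"
| "remaining (PClear T i j) = T"
| "remaining (PCallHint T i) = T"
| "remaining (PHint T i) = T"
| "remaining (PSetProp T i h) = T"

text \<open>The merged sketch is not kept in the arguments of \<open>PMerge\<close>;
  \<open>s\<close> supplies it, from the ghost field \<open>other\<close>.\<close>

fun pending_of ::
    "('s, 'h) prop_pc \<Rightarrow> (nat \<Rightarrow> ('s, 'q, 'v) qry_pc) \<Rightarrow> (nat \<Rightarrow> 's) \<Rightarrow> thread \<Rightarrow> 's shared_op option"
  where
  "pending_of pp qp s Propagator =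
     (case pp of PMerge T i \<Rightarrow> Some (Merge (s i)) | PHint T i \<Rightarrow> Some CalcHint | _ \<Rightarrow> None)"
| "pending_of pp qp s (Updater i) = None"
| "pending_of pp qp s (Querier k) = (case qp k of QSnapshot q \<Rightarrow> Some Snapshot | _ \<Rightarrow> None)"

text \<open>\<open>Some a\<close> exactly as long as the update of \<open>a\<close> is not
  linearised: its linearisation point is the step that leaves these program counters.\<close>

fun update_arg :: "('s, 'a, 'h) upd_pc \<Rightarrow> 'a option" where
  "update_arg (UCheck a) = Some a"
| "update_arg (UCount a) = Some a"
| "update_arg (UCount' a c) = Some a"
| "update_arg (UCur a) = Some a"
| "update_arg (ULocal a j) = Some a"
| "update_arg (ULocal' a j s) = Some a"
| "update_arg _ = None"

fun before_flip :: "('s, 'a, 'h) upd_pc \<Rightarrow> bool" where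
  "before_flip UFlip = True"
| "before_flip (UFlip' j) = True"
| "before_flip _ = False"

text \<open>The window in which \<open>cur\<^sub>i\<close> has been written but
  \<open>prop\<^sub>i\<close> is still non-zero: the full buffer already counts as in flight
  although it has not been handed over.\<close>

fun after_flip :: "('s, 'a, 'h) upd_pc \<Rightarrow> bool" where
  "after_flip UHint = True"
| "after_flip (UHint' h) = True"
| "after_flip UReset = True"
| "after_flip USignal = True"
| "after_flip _ = False"

fun busy ::
    "(nat \<Rightarrow> ('s, 'a, 'h) upd_pc) \<Rightarrow> (nat \<Rightarrow> ('s, 'q, 'v) qry_pc) \<Rightarrow> thread \<Rightarrow> bool" where
  "busy up qp Propagator = False"
| "busy up qp (Updater i) = (up i \<noteq> UIdle)"
| "busy up qp (Querier k) = (qp k \<noteq> QIdle)"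

definition updater_inv ::
    "nat \<Rightarrow> (thread \<Rightarrow> nat) \<Rightarrow> (thread, ('a, 'q) sketch_op, 'v sketch_ret) event list \<Rightarrow>
     (thread, ('a, 'q) sketch_op, 'v sketch_ret) seq_history \<Rightarrow> nat \<Rightarrow> ('s, 'a, 'h) upd_pc \<Rightarrow> bool"
  where
  "updater_inv N n h H i pc \<longleftrightarrow>
     (pc \<noteq> UIdle \<longrightarrow> i \<in> {1..N}) \<and>
     (case update_arg pc of
        Some a \<Rightarrow> Inv (Updater i, n (Updater i) - 1) (Update a) \<in> set h \<and>
          (Updater i, n (Updater i) - 1) \<notin> fst ` set H
      | None \<Rightarrow> pc \<noteq> UIdle \<longrightarrow> (\<exists>x. ((Updater i, n (Updater i) - 1), x, Ack) \<in> set H))"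

text \<open>Each query calls \<open>Snapshot\<close> once, so the counters \<open>n\<close> and
  \<open>sn\<close> of a thread differ only between the invocation of the query and that call. Hence
  a query and its snapshot carry the same identity in the two histories.\<close>

fun querier_inv ::
    "('s, 'a, 'q, 'v, 'h, 'c) composable \<Rightarrow> nat \<Rightarrow> nat \<Rightarrow>
     (thread, ('a, 'q) sketch_op, 'v sketch_ret) event list \<Rightarrow>
     (thread, ('a, 'q) sketch_op, 'v sketch_ret) seq_history \<Rightarrow> nat \<Rightarrow> ('s, 'q, 'v) qry_pc \<Rightarrow> bool"
  where
  "querier_inv S n sn h H k QIdle \<longleftrightarrow> sn = n"
| "querier_inv S n sn h H k (QCall q) \<longleftrightarrow> Suc sn = n \<and> Inv (Querier k, n - 1) (Query q) \<in> set h"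
| "querier_inv S n sn h H k (QSnapshot q) \<longleftrightarrow> sn = n \<and> Inv (Querier k, n - 1) (Query q) \<in> set h"
| "querier_inv S n sn h H k (QQuery q s) \<longleftrightarrow>
     sn = n \<and> (\<exists>x. ((Querier k, n - 1), x, Val (query S s q)) \<in> set H)"
| "querier_inv S n sn h H k (QReturn v) \<longleftrightarrow> sn = n \<and> (\<exists>x. ((Querier k, n - 1), x, Val v) \<in> set H)"

text \<open>
  \<open>lin\<close> is the linearisation and \<open>propagated\<close> is the history in \<open>SeqSketch\<close> that it relaxes;
  \<open>stream\<close> lists the updates merged into \<open>globalS\<close>, without the filtered ones.
  \<open>active i\<close> is in \<open>localS\<^sub>i[cur\<^sub>i]\<close>, \<open>other i\<close> is the stream summarised by
  \<open>localS\<^sub>i[1-cur\<^sub>i]\<close>, and \<open>inflight i\<close> is the part of the latter that no linearised merge has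
  taken into account. \<open>slin\<close> linearises the execution \<open>sexec\<close> of the shared sketch.
\<close>

record ('s, 'a, 'q, 'v, 'h, 'c) ghost =
  lin :: "(thread, ('a, 'q) sketch_op, 'v sketch_ret) seq_history"
  propagated :: "(thread, ('a, 'q) sketch_op, 'v sketch_ret) seq_history"
  stream :: "'a list"
  active :: "nat \<Rightarrow> (thread opid \<times> 'a) list"
  inflight :: "nat \<Rightarrow> (thread opid \<times> 'a) list"
  other :: "nat \<Rightarrow> 'a list"
  cur :: "nat \<Rightarrow> nat"
  sexec :: "('c, thread, 's shared_op, ('s, 'h) shared_ret) execution"
  slin :: "(thread, 's shared_op, ('s, 'h) shared_ret) seq_history"
  scount :: "thread \<Rightarrow> nat"

text \<open>\<open>f\<close> is a fixed witness for the strong linearisability of the shared sketch,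
  so that the ghost state can refer to its values.\<close>

locale opt_par_sketch =
  fixes S :: "('s, 'a, 'q, 'v, 'h :: zero_neq_one, 'c) composable" and N b :: nat
    and f :: "('c, thread, 's shared_op, ('s, 'h) shared_ret) execution \<Rightarrow>
      (thread, 's shared_op, ('s, 'h) shared_ret) seq_history"
  assumes merge_summarises: "\<And>s s' A A'. summarises S s A \<Longrightarrow> summarises S s' A' \<Longrightarrow>
      summarises S (merge S s s') (A @ A')"
    and calc_hint_sound: "\<And>s A. summarises S s A \<Longrightarrow>
      calc_hint S s \<noteq> 0 \<and> sound_hint S A (calc_hint S s)"
    and f_linearisation: "\<forall>\<sigma>\<in>executions (shared S) \<inter> permitted S.
      linearisation (shared_spec S) (history \<sigma>) (f \<sigma>)"
    and f_prefix: "\<forall>\<sigma>\<in>executions (shared S) \<inter> permitted S.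
      \<forall>\<sigma>'\<in>executions (shared S) \<inter> permitted S. exec_prefix \<sigma> \<sigma>' \<longrightarrow> prefix (f \<sigma>) (f \<sigma>')"
    and initial_hint: "sound_hint S [] 1"
    and b_pos: "1 \<le> b"
begin

section \<open>Sketch states and soundness of hints\<close>

definition sk :: "'a list \<Rightarrow> 's" where
  "sk A = foldl (update S) (init S) A"

lemma update_sk: "update S (sk A) a = sk (A @ [a])"
  by (simp add: sk_def)

lemma sk_append_cong: "sk A = sk B \<Longrightarrow> sk (A @ C) = sk (B @ C)"
  by (simp add: sk_def)

lemma summarises_sk: "summarises S (sk A) A"
  by (simp add: summarises_def sk_def)

lemma summarisesD: "summarises S s A \<Longrightarrow> s = sk A"
  by (simp add: summarises_def sk_def)

lemma merge_sk: "merge S (sk A) (sk B) = sk (A @ B)"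
  by (intro summarisesD merge_summarises summarises_sk)

text \<open>A hint is tested after further buffers have been merged, so it is only required to be
  sound for some prefix of what is merged by now.\<close>

definition hint_ok :: "'a list \<Rightarrow> 'h \<Rightarrow> bool" where
  "hint_ok G h \<longleftrightarrow> (\<exists>A B. G = A @ B \<and> sound_hint S A h)"

lemma hint_ok_append: "hint_ok G h \<Longrightarrow> hint_ok (G @ G') h"
  unfolding hint_ok_def by (metis append.assoc)

lemma hint_ok_initial: "hint_ok G 1"
  unfolding hint_ok_def using initial_hint by (metis append_Nil)

text \<open>In \<open>sound_hint\<close> the list \<open>B1\<close> absorbs what was merged after
  the hint was calculated; \<open>B2\<close> is empty because the filtered update is placed
  last.\<close>

lemma hint_ok_filter:
  assumes "hint_ok G h" and "\<not> should_add S h a"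
  shows "sk (G @ [a]) = sk G"
proof -
  obtain A B where G: "G = A @ B" "sound_hint S A h"
    using assms(1) by (auto simp: hint_ok_def)
  have "summarises S (sk (G @ [a])) (A @ B @ [a] @ [])"
    using summarises_sk[of "G @ [a]"] by (simp add: G)
  then have "summarises S (sk (G @ [a])) (A @ B @ [])"
    using G(2) assms(2) unfolding sound_hint_def by blast
  then show ?thesis
    using summarisesD by (simp add: G)
qed

fun hint_val_ok :: "'a list \<Rightarrow> ('s, 'h) val \<Rightarrow> bool" where
  "hint_val_ok G (HintV h) = hint_ok G h"
| "hint_val_ok G _ = False"

text \<open>The third argument is the content of \<open>counter\<^sub>i\<close>, the last one that of the active buffer.\<close>

fun upc_ok ::
    "'a list \<Rightarrow> nat \<Rightarrow> ('s, 'h) val \<Rightarrow> (thread opid \<times> 'a) list \<Rightarrow> ('s, 'a, 'h) upd_pc \<Rightarrow> bool"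
  where
  "upc_ok G c kv A (UCount' a k) \<longleftrightarrow> k = length A \<and> length A < b \<and> kv = NatV k"
| "upc_ok G c kv A (UCur a) \<longleftrightarrow> kv = NatV (Suc (length A)) \<and> length A < b"
| "upc_ok G c kv A (ULocal a j) \<longleftrightarrow> kv = NatV (Suc (length A)) \<and> length A < b \<and> j = c"
| "upc_ok G c kv A (ULocal' a j s) \<longleftrightarrow>
     kv = NatV (Suc (length A)) \<and> length A < b \<and> j = c \<and> s = sk (map snd A)"
| "upc_ok G c kv A UTest \<longleftrightarrow> kv = NatV (length A) \<and> length A \<le> b"
| "upc_ok G c kv A UWait \<longleftrightarrow> length A = b"
| "upc_ok G c kv A UFlip \<longleftrightarrow> length A = b"
| "upc_ok G c kv A (UFlip' j) \<longleftrightarrow> length A = b \<and> j = c"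
| "upc_ok G c kv A UHint \<longleftrightarrow> A = []"
| "upc_ok G c kv A (UHint' h) \<longleftrightarrow> A = [] \<and> hint_ok G h"
| "upc_ok G c kv A UReset \<longleftrightarrow> A = []"
| "upc_ok G c kv A USignal \<longleftrightarrow> A = [] \<and> kv = NatV 0"
| "upc_ok G c kv A _ \<longleftrightarrow> kv = NatV (length A) \<and> length A < b"

text \<open>A merge may be linearised anywhere between its call and its response, and
  \<open>merged\<close> tells whether this has happened. At that moment \<open>F\<close> becomes
  empty while the local sketch keeps summarising \<open>B\<close> until it is cleared; this is why
  there are two lists.\<close>

fun ppc_ok ::
    "'a list \<Rightarrow> bool \<Rightarrow> (thread opid \<times> 'a) list \<Rightarrow> 'a list \<Rightarrow> nat \<Rightarrow> ('s, 'h) prop_pc \<Rightarrow> bool"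
  where
  "ppc_ok G merged F B c (PNext T) \<longleftrightarrow> True"
| "ppc_ok G merged F B c (PCur T i) \<longleftrightarrow> B = map snd F"
| "ppc_ok G merged F B c (PLocal T i j) \<longleftrightarrow> j = 1 - c \<and> B = map snd F"
| "ppc_ok G merged F B c (PCallMerge T i s) \<longleftrightarrow> s = sk B \<and> B = map snd F"
| "ppc_ok G merged F B c (PMerge T i) \<longleftrightarrow> (if merged then F = [] else B = map snd F)"
| "ppc_ok G merged F B c (PCur' T i) \<longleftrightarrow> F = []"
| "ppc_ok G merged F B c (PClear T i j) \<longleftrightarrow> j = 1 - c \<and> F = []"
| "ppc_ok G merged F B c (PCallHint T i) \<longleftrightarrow> F = [] \<and> B = []"
| "ppc_ok G merged F B c (PHint T i) \<longleftrightarrow> F = [] \<and> B = []"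
| "ppc_ok G merged F B c (PSetProp T i h) \<longleftrightarrow> F = [] \<and> B = [] \<and> h \<noteq> 0 \<and> hint_ok G h"

text \<open>Ownership of the non-current local sketch passes with \<open>prop\<^sub>i\<close>. While
  it is non-zero, the sketch is empty and published to the update thread; while it is zero, the
  sketch holds a batch published to the propagator or is in the propagator's hands. Between flip and
  signal the update thread still holds the batch, although it already counts as
  \<open>F\<close>.\<close>

definition buffer_inv ::
    "'a list \<Rightarrow> ('s, 'h) memory \<Rightarrow> nat \<Rightarrow> ('s, 'a, 'h) upd_pc \<Rightarrow> ('s, 'h) prop_pc \<Rightarrow> bool \<Rightarrow>
     (thread opid \<times> 'a) list \<Rightarrow> (thread opid \<times> 'a) list \<Rightarrow> 'a list \<Rightarrow> nat \<Rightarrow> bool" where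
  "buffer_inv G m i pc pp merged A F B c \<longleftrightarrow>
     c \<le> 1 \<and> latest m (Cur i) = NatV c \<and>
     fresh m (Updater i) (Cur i) \<and> fresh m (Updater i) (Counter i) \<and> fresh m (Updater i) (Hint i) \<and>
     fresh m (Updater i) (LocalS i c) \<and>
     latest m (LocalS i c) = SketchV (sk (map snd A)) \<and>
     latest m (LocalS i (1 - c)) = SketchV (sk B) \<and>
     hint_val_ok G (latest m (Hint i)) \<and> length F \<le> b \<and>
     upc_ok G c (latest m (Counter i)) A pc \<and>
     (prop_val m i \<noteq> 0 \<longrightarrow> hint_ok G (prop_val m i)) \<and>
     (before_flip pc \<or> after_flip pc \<longrightarrow>
        prop_val m i \<noteq> 0 \<and> fresh m (Updater i) (LocalS i (1 - c))) \<and>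
     (after_flip pc \<longrightarrow> B = map snd F) \<and>
     (prop_val m i \<noteq> 0 \<and> \<not> after_flip pc \<longrightarrow>
        F = [] \<and> B = [] \<and> fresh_published m i (LocalS i (1 - c))) \<and>
     (prop_val m i = 0 \<and> at_index pp \<noteq> Some i \<longrightarrow>
        fresh_published m i (Cur i) \<and> fresh_published m i (LocalS i (1 - c)) \<and> B = map snd F) \<and>
     (at_index pp = Some i \<longrightarrow>
        prop_val m i = 0 \<and> fresh m Propagator (Cur i) \<and>
        fresh m Propagator (LocalS i (1 - c)) \<and> ppc_ok G merged F B c pp)"

text \<open>Speaks of the latest shared operation of the propagator. This is a pending merge only at
  \<open>PMerge\<close>, the only program counter whose condition in \<open>ppc_ok\<close> depends
  on the flag.\<close>

definition merge_done :: "('s, 'a, 'q, 'v, 'h, 'c) ghost \<Rightarrow> bool" where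
  "merge_done \<gamma> \<longleftrightarrow> (Propagator, scount \<gamma> Propagator - 1) \<in> fst ` set (slin \<gamma>)"

text \<open>\<open>shared_run\<close> accepts or rejects but returns no state; quantifying over
  continuations \<open>E\<close> expresses that \<open>slin\<close> leaves the shared sketch in
  state \<open>sk (stream \<gamma>)\<close>. The multiset equation describes the gap between the two
  histories exactly, so that the relaxation bound can be read off the buffer lengths.\<close>

definition core_inv ::
    "(thread \<Rightarrow> nat) \<Rightarrow> (thread, ('a, 'q) sketch_op, 'v sketch_ret) event list \<Rightarrow> (thread \<Rightarrow> bool) \<Rightarrow>
     ('s, 'a, 'q, 'v, 'h, 'c) ghost \<Rightarrow> bool" where
  "core_inv n h D \<gamma> \<longleftrightarrow>
     tracks n D h (lin \<gamma>) \<and>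
     r_relaxation (2 * N * b) (propagated \<gamma>) (lin \<gamma>) \<and>
     seq_run S (init S) (propagated \<gamma>) \<and>
     sk (updates_of (propagated \<gamma>)) = sk (stream \<gamma>) \<and>
     mset (lin \<gamma>) = mset (propagated \<gamma>) +
       (\<Sum>i\<in>{1..N}. mset (map update_entry (active \<gamma> i @ inflight \<gamma> i))) \<and>
     (\<forall>E. shared_run S (init S) (slin \<gamma> @ E) \<longrightarrow> shared_run S (sk (stream \<gamma>)) E) \<and>
     (\<forall>i x r. (i, x, Hinted r) \<in> set (slin \<gamma>) \<longrightarrow> r \<noteq> 0 \<and> hint_ok (stream \<gamma>) r) \<and>
     (\<forall>k j. (Querier k, j) \<in> fst ` set (lin \<gamma>) \<longrightarrow> (Querier k, j) \<in> fst ` set (slin \<gamma>)) \<and>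
     (\<forall>k j x s. ((Querier k, j), x, Copy s) \<in> set (slin \<gamma>) \<longrightarrow>
        (\<exists>q. ((Querier k, j), Query q, Val (query S s q)) \<in> set (lin \<gamma>)))"

text \<open>Kept apart from the equation of \<open>slin\<close> with
  \<open>f (sexec \<gamma>)\<close>, which fails while newly linearised operations are absorbed one
  by one; \<open>opt_inv\<close> restores it after each step.\<close>

definition ghost_inv ::
    "(thread \<Rightarrow> nat) \<Rightarrow> (thread, ('a, 'q) sketch_op, 'v sketch_ret) event list \<Rightarrow>
     ('s, 'a, 'q, 'v, 'h, 'c) state \<Rightarrow> ('s, 'a, 'q, 'v, 'h, 'c) ghost \<Rightarrow> bool" where
  "ghost_inv n h st \<gamma> \<longleftrightarrow>
     core_inv n h (busy (upc st) (qpc st)) \<gamma> \<and> mem_ok (mem st) \<and>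
     (\<forall>i. buffer_inv (stream \<gamma>) (mem st) i (upc st i) (ppc st) (merge_done \<gamma>)
        (active \<gamma> i) (inflight \<gamma> i) (other \<gamma> i) (cur \<gamma> i)) \<and>
     (\<forall>i. updater_inv N n h (lin \<gamma>) i (upc st i)) \<and>
     (\<forall>k. querier_inv S (n (Querier k)) (scount \<gamma> (Querier k)) h (lin \<gamma>) k (qpc st k)) \<and>
     remaining (ppc st) \<subseteq> {1..N} \<and> (\<forall>i. at_index (ppc st) = Some i \<longrightarrow> i \<in> {1..N}) \<and>
     (\<forall>t k. (t, k) \<in> fst ` set (slin \<gamma>) \<longrightarrow> k < scount \<gamma> t)"

abbreviation pending_ops ::
    "('s, 'a, 'q, 'v, 'h, 'c) state \<Rightarrow> ('s, 'a, 'q, 'v, 'h, 'c) ghost \<Rightarrow> thread \<Rightarrow> 's shared_op option"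
  where
  "pending_ops st \<gamma> \<equiv> pending_of (ppc st) (qpc st) (\<lambda>i. sk (other \<gamma> i))"

definition opt_inv ::
    "(thread \<Rightarrow> nat) \<Rightarrow> (thread, ('a, 'q) sketch_op, 'v sketch_ret) event list \<Rightarrow>
     ('s, 'a, 'q, 'v, 'h, 'c) state \<Rightarrow> ('s, 'a, 'q, 'v, 'h, 'c) ghost \<Rightarrow> bool" where
  "opt_inv n h st \<gamma> \<longleftrightarrow> ghost_inv n h st \<gamma> \<and>
     shared_exec S (sexec \<gamma>) (globalS st) (pending_ops st \<gamma>) (scount \<gamma>) \<and>
     slin \<gamma> = f (sexec \<gamma>) \<and> slin \<gamma> \<in> shared_spec S"

section \<open>Stability of the buffer invariant\<close>

lemma upc_ok_mono: "upc_ok G c kv A pc \<Longrightarrow> upc_ok (G @ G') c kv A pc"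
  by (cases pc) (auto simp: hint_ok_append)

lemma ppc_ok_mono: "ppc_ok G d F B c pp \<Longrightarrow> ppc_ok (G @ G') d F B c pp"
  by (cases pp) (auto simp: hint_ok_append)

lemma hint_val_ok_mono: "hint_val_ok G v \<Longrightarrow> hint_val_ok (G @ G') v"
  by (cases v) (auto simp: hint_ok_append)

lemma buffer_inv_mono:
  "buffer_inv G m i pc pp d A F B c \<Longrightarrow> buffer_inv (G @ G') m i pc pp d A F B c"
  unfolding buffer_inv_def by (simp add: upc_ok_mono ppc_ok_mono hint_val_ok_mono hint_ok_append)

lemma ppc_ok_merged:
  "(\<And>T i. pp \<noteq> PMerge T i) \<Longrightarrow> ppc_ok G d F B c pp \<longleftrightarrow> ppc_ok G d' F B c pp"
  by (cases pp) auto

lemma buffer_inv_merged: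
  "(\<And>T i. pp \<noteq> PMerge T i) \<Longrightarrow>
   buffer_inv G m i pc pp d A F B c \<longleftrightarrow> buffer_inv G m i pc pp d' A F B c"
  unfolding buffer_inv_def by (subst ppc_ok_merged[of pp G d F B c d']) auto

lemma buffer_inv_elsewhere:
  "at_index pp \<noteq> Some i \<Longrightarrow> at_index pp' \<noteq> Some i \<Longrightarrow>
   buffer_inv G m i pc pp d A F B c \<longleftrightarrow> buffer_inv G m i pc pp' d' A F B c"
  by (simp add: buffer_inv_def)

lemma length_active: "upc_ok G c kv A pc \<Longrightarrow> length A \<le> b"
  by (cases pc) auto

subsection \<open>Linearised operations of the shared sketch\<close>

text \<open>By the multiset equation, \<open>propagated\<close> together with one in-flight buffer
  is a sub-multiset of \<open>lin\<close>, whose identities are distinct.\<close>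

lemma core_propagated_wf:
  assumes "core_inv n h D \<gamma>" and "i \<in> {1..N}"
  shows "wf_seq (propagated \<gamma> @ map update_entry (inflight \<gamma> i))"
    and "set (map update_entry (inflight \<gamma> i)) \<subseteq> set (lin \<gamma>)"
proof -
  have eq: "mset (lin \<gamma>) = mset (propagated \<gamma>) +
      (\<Sum>i\<in>{1..N}. mset (map update_entry (active \<gamma> i @ inflight \<gamma> i)))"
    using assms(1) unfolding core_inv_def by blast
  have sub: "mset (propagated \<gamma> @ map update_entry (inflight \<gamma> i)) \<subseteq># mset (lin \<gamma>)"
    unfolding eq sum.remove[OF finite_atLeastAtMost assms(2)] by (simp add: add.assoc)
  then have "mset (map fst (propagated \<gamma> @ map update_entry (inflight \<gamma> i))) \<subseteq># mset (map fst (lin \<gamma>))"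
    using image_mset_subseteq_mono unfolding mset_map by blast
  moreover have "distinct (map fst (lin \<gamma>))"
    using assms(1) tracks_wf unfolding core_inv_def by blast
  ultimately show "wf_seq (propagated \<gamma> @ map update_entry (inflight \<gamma> i))"
    unfolding wf_seq_def by (rule distinct_if_mset_subset)
  show "set (map update_entry (inflight \<gamma> i)) \<subseteq> set (lin \<gamma>)"
    using set_mset_mono[OF sub] by auto
qed

text \<open>The state \<open>st\<close> does not move: only the ghost state reacts to the choice of
  \<open>f\<close>. A merge moves a whole in-flight buffer into \<open>propagated\<close>, a
  snapshot linearises its query in both histories, and a hint calculation is merely recorded in
  \<open>slin\<close>.\<close>

lemma absorb_one:
  assumes inv: "ghost_inv n h st \<gamma>" and new: "(t, k) \<notin> fst ` set (slin \<gamma>)"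
    and run: "shared_run S (init S) (slin \<gamma> @ ((t, k), x, r) # E)"
    and k: "Suc k = scount \<gamma> t" and op: "pending_ops st \<gamma> t = Some x"
  shows "\<exists>\<gamma>'. ghost_inv n h st \<gamma>' \<and> slin \<gamma>' = slin \<gamma> @ [((t, k), x, r)] \<and>
    other \<gamma>' = other \<gamma> \<and> scount \<gamma>' = scount \<gamma> \<and> prefix (lin \<gamma>) (lin \<gamma>')"
proof -
  let ?d = "((t, k), x, r)"
  have core: "core_inv n h (busy (upc st) (qpc st)) \<gamma>"
    using inv by (simp add: ghost_inv_def)
  have shared: "shared_run S (sk (stream \<gamma>)) E" if "shared_run S (init S) (slin \<gamma> @ E)" for E
    using core that unfolding core_inv_def by blast
  note run' = shared[OF run]
  have rel: "r_relaxation (2 * N * b) (propagated \<gamma>) (lin \<gamma>)"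
    and seq: "seq_run S (init S) (propagated \<gamma>)"
    and sk_eq: "sk (updates_of (propagated \<gamma>)) = sk (stream \<gamma>)"
    and tracks: "tracks n (busy (upc st) (qpc st)) h (lin \<gamma>)"
    using core unfolding core_inv_def by blast+
  have seq_eq: "foldl (update S) (init S) (updates_of (propagated \<gamma>)) = sk (stream \<gamma>)"
    using sk_eq by (simp add: sk_def)
  show ?thesis
  proof (cases x)
    case (Merge s)
    obtain T i where t: "t = Propagator" and pp: "ppc st = PMerge T i" and s: "s = sk (other \<gamma> i)"
      using op Merge by (cases t) (auto split: prop_pc.splits qry_pc.splits)
    have i: "i \<in> {1..N}"
      using inv pp by (simp add: ghost_inv_def)
    have k': "scount \<gamma> Propagator = Suc k"
      using k t by simp
    \<comment> \<open>The merge carries the latest number of the propagator and is not in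
      \<open>slin\<close> yet, so the in-flight buffer is still exactly what is being
      merged.\<close>
    have "\<not> merge_done \<gamma>"
      using new t by (simp add: merge_done_def k')
    have bi: "buffer_inv (stream \<gamma>) (mem st) j (upc st j) (ppc st) (merge_done \<gamma>)
        (active \<gamma> j) (inflight \<gamma> j) (other \<gamma> j) (cur \<gamma> j)" for j
      using inv by (simp add: ghost_inv_def)
    then have oth: "other \<gamma> i = map snd (inflight \<gamma> i)"
      using \<open>\<not> merge_done \<gamma>\<close> pp bi[of i] by (simp add: buffer_inv_def)
    \<comment> \<open>\<open>lin\<close> stays as it is: the updates of the buffer entered it when
      they were written to the local sketch.\<close>
    define \<gamma>' where "\<gamma>' = \<gamma>\<lparr>propagated := propagated \<gamma> @ map update_entry (inflight \<gamma> i),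
      stream := stream \<gamma> @ map snd (inflight \<gamma> i), inflight := (inflight \<gamma>)(i := []),
      slin := slin \<gamma> @ [?d]\<rparr>"
    have "merge_done \<gamma>'"
      using t by (simp add: merge_done_def \<gamma>'_def k')
    have "buffer_inv (stream \<gamma>') (mem st) j (upc st j) (ppc st) (merge_done \<gamma>')
        (active \<gamma>' j) (inflight \<gamma>' j) (other \<gamma>' j) (cur \<gamma>' j)" for j
    proof (cases "j = i")
      case True
      have "buffer_inv (stream \<gamma> @ map snd (inflight \<gamma> i)) (mem st) i (upc st i) (ppc st)
          (merge_done \<gamma>) (active \<gamma> i) (inflight \<gamma> i) (other \<gamma> i) (cur \<gamma> i)"
        by (rule buffer_inv_mono[OF bi])
      then show ?thesis
        using True pp \<open>merge_done \<gamma>'\<close> by (auto simp: \<gamma>'_def buffer_inv_def)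
    next
      case False
      then have ne: "at_index (ppc st) \<noteq> Some j"
        using pp by simp
      have "buffer_inv (stream \<gamma>') (mem st) j (upc st j) (ppc st) (merge_done \<gamma>')
          (active \<gamma> j) (inflight \<gamma> j) (other \<gamma> j) (cur \<gamma> j)"
        by (rule iffD1[OF buffer_inv_elsewhere[OF ne ne, of _ _ _ "merge_done \<gamma>"]])
          (use buffer_inv_mono[OF bi[of j]] in \<open>simp_all add: \<gamma>'_def\<close>)
      then show ?thesis
        using False by (simp add: \<gamma>'_def)
    qed
    moreover have "core_inv n h (busy (upc st) (qpc st)) \<gamma>'"
      unfolding core_inv_def
    proof (intro conjI)
      show "tracks n (busy (upc st) (qpc st)) h (lin \<gamma>')"
        using tracks by (simp add: \<gamma>'_def)
      show "r_relaxation (2 * N * b) (propagated \<gamma>') (lin \<gamma>')"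
        using r_relaxation_append_left[OF rel core_propagated_wf[OF core i]] by (simp add: \<gamma>'_def)
      show "seq_run S (init S) (propagated \<gamma>')"
        using seq by (simp add: \<gamma>'_def seq_run_append)
      show "sk (updates_of (propagated \<gamma>')) = sk (stream \<gamma>')"
        using sk_append_cong[OF sk_eq] by (simp add: \<gamma>'_def updates_of_append)
      show "mset (lin \<gamma>') = mset (propagated \<gamma>') +
          (\<Sum>i\<in>{1..N}. mset (map update_entry (active \<gamma>' i @ inflight \<gamma>' i)))"
      proof -
        have "mset (lin \<gamma>) = mset (propagated \<gamma>) +
            (\<Sum>i\<in>{1..N}. mset (map update_entry (active \<gamma> i @ inflight \<gamma> i)))"
          using core unfolding core_inv_def by blast
        moreover have "(\<Sum>j\<in>{1..N} - {i}. mset (map update_entry (active \<gamma>' j @ inflight \<gamma>' j))) =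
            (\<Sum>j\<in>{1..N} - {i}. mset (map update_entry (active \<gamma> j @ inflight \<gamma> j)))"
          by (rule sum.cong) (auto simp: \<gamma>'_def)
        ultimately show ?thesis
          unfolding sum.remove[OF finite_atLeastAtMost i] by (simp add: \<gamma>'_def ac_simps)
      qed
      show "\<forall>E. shared_run S (init S) (slin \<gamma>' @ E) \<longrightarrow> shared_run S (sk (stream \<gamma>')) E"
        using shared[of "?d # E" for E] by (auto simp: \<gamma>'_def Merge s oth merge_sk)
      show "\<forall>i x r. (i, x, Hinted r) \<in> set (slin \<gamma>') \<longrightarrow> r \<noteq> 0 \<and> hint_ok (stream \<gamma>') r"
        using core run' unfolding core_inv_def
        by (auto simp: \<gamma>'_def Merge hint_ok_append)
      show "\<forall>k j. (Querier k, j) \<in> fst ` set (lin \<gamma>') \<longrightarrow> (Querier k, j) \<in> fst ` set (slin \<gamma>')"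
        using core unfolding core_inv_def by (auto simp: \<gamma>'_def)
      show "\<forall>k j x s. ((Querier k, j), x, Copy s) \<in> set (slin \<gamma>') \<longrightarrow>
          (\<exists>q. ((Querier k, j), Query q, Val (query S s q)) \<in> set (lin \<gamma>'))"
        using core unfolding core_inv_def by (auto simp: \<gamma>'_def t)
    qed
    ultimately have "ghost_inv n h st \<gamma>'"
      using inv t k unfolding ghost_inv_def by (auto simp: \<gamma>'_def)
    then show ?thesis
      by (intro exI[of _ \<gamma>']) (simp add: \<gamma>'_def)
  next
    case Snapshot
    obtain j q where t: "t = Querier j" and qp: "qpc st j = QSnapshot q"
      using op Snapshot by (cases t) (auto split: prop_pc.splits qry_pc.splits)
    obtain s where r: "r = Copy s" and s: "\<And>q. query S s q = query S (sk (stream \<gamma>)) q"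
      using run' Snapshot by auto
    \<comment> \<open>The query takes over the identity of its snapshot; its value is the one that
      the querier will compute from the copy \<open>s\<close>.\<close>
    define e where "e = ((t, k), Query q :: ('a, 'q) sketch_op, Val (query S s q))"
    define \<gamma>' where "\<gamma>' = \<gamma>\<lparr>lin := lin \<gamma> @ [e], propagated := propagated \<gamma> @ [e],
      slin := slin \<gamma> @ [?d]\<rparr>"
    have qi: "querier_inv S (n (Querier i)) (scount \<gamma> (Querier i)) h (lin \<gamma>) i (qpc st i)" for i
      using inv by (simp add: ghost_inv_def)
    have "n (Querier j) = Suc k"
      using qi[of j] qp k t by simp
    then have inv_e: "Inv (t, k) (Query q) \<in> set h"
      using qi[of j] qp t by simp
    \<comment> \<open>A query is in \<open>lin\<close> only if the snapshot with the same identity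
      is in \<open>slin\<close>.\<close>
    have new_e: "(t, k) \<notin> fst ` set (lin \<gamma>)"
      using core new t unfolding core_inv_def by blast
    have tracks': "tracks n (busy (upc st) (qpc st)) h (lin \<gamma>')"
      using tracks_linearise[OF tracks inv_e new_e] by (simp add: \<gamma>'_def e_def)
    have "merge_done \<gamma>' = merge_done \<gamma>"
      using t by (simp add: merge_done_def \<gamma>'_def)
    moreover have "core_inv n h (busy (upc st) (qpc st)) \<gamma>'"
      unfolding core_inv_def
    proof (intro conjI)
      show "tracks n (busy (upc st) (qpc st)) h (lin \<gamma>')"
        by (rule tracks')
      show "r_relaxation (2 * N * b) (propagated \<gamma>') (lin \<gamma>')"
        using r_relaxation_append_both[OF rel, of e] tracks_wf[OF tracks']
        by (simp add: \<gamma>'_def wf_seq_def)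
      show "seq_run S (init S) (propagated \<gamma>')"
        using seq s by (simp add: \<gamma>'_def seq_run_append seq_eq e_def)
      show "sk (updates_of (propagated \<gamma>')) = sk (stream \<gamma>')"
        using sk_eq by (simp add: \<gamma>'_def updates_of_append e_def)
      show "mset (lin \<gamma>') = mset (propagated \<gamma>') +
          (\<Sum>i\<in>{1..N}. mset (map update_entry (active \<gamma>' i @ inflight \<gamma>' i)))"
        using core by (simp add: \<gamma>'_def core_inv_def)
      show "\<forall>E. shared_run S (init S) (slin \<gamma>' @ E) \<longrightarrow> shared_run S (sk (stream \<gamma>')) E"
        using shared[of "?d # E" for E] by (auto simp: \<gamma>'_def Snapshot)
      show "\<forall>i x r. (i, x, Hinted r) \<in> set (slin \<gamma>') \<longrightarrow> r \<noteq> 0 \<and> hint_ok (stream \<gamma>') r"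
        using core r unfolding core_inv_def by (auto simp: \<gamma>'_def)
      show "\<forall>k j. (Querier k, j) \<in> fst ` set (lin \<gamma>') \<longrightarrow> (Querier k, j) \<in> fst ` set (slin \<gamma>')"
        using core unfolding core_inv_def by (auto simp: \<gamma>'_def e_def)
      show "\<forall>k j x s. ((Querier k, j), x, Copy s) \<in> set (slin \<gamma>') \<longrightarrow>
          (\<exists>q. ((Querier k, j), Query q, Val (query S s q)) \<in> set (lin \<gamma>'))"
        using core r unfolding core_inv_def by (fastforce simp: \<gamma>'_def e_def)
    qed
    moreover have "updater_inv N n h (lin \<gamma>') i (upc st i)" for i
    proof -
      have "updater_inv N n h (lin \<gamma>) i (upc st i)"
        using inv by (simp add: ghost_inv_def)
      then show ?thesis
        using t by (auto simp: updater_inv_def \<gamma>'_def e_def split: option.splits)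
    qed
    moreover have "querier_inv S (n (Querier i)) (scount \<gamma>' (Querier i)) h (lin \<gamma>') i (qpc st i)" for i
      using qi[of i] by (cases "qpc st i") (auto simp: \<gamma>'_def)
    ultimately have "ghost_inv n h st \<gamma>'"
      using inv k unfolding ghost_inv_def by (auto simp: \<gamma>'_def)
    then show ?thesis
      by (intro exI[of _ \<gamma>']) (simp add: \<gamma>'_def)
  next
    case CalcHint
    obtain T i where t: "t = Propagator" and pp: "ppc st = PHint T i"
      using op CalcHint by (cases t) (auto split: prop_pc.splits qry_pc.splits)
    have r: "r = Hinted (calc_hint S (sk (stream \<gamma>)))"
      using run' CalcHint by simp
    have hint: "calc_hint S (sk (stream \<gamma>)) \<noteq> 0" "hint_ok (stream \<gamma>) (calc_hint S (sk (stream \<gamma>)))"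
      using calc_hint_sound[OF summarises_sk] by (auto simp: hint_ok_def)
    define \<gamma>' where "\<gamma>' = \<gamma>\<lparr>slin := slin \<gamma> @ [?d]\<rparr>"
    have "buffer_inv (stream \<gamma>') (mem st) j (upc st j) (ppc st) (merge_done \<gamma>')
        (active \<gamma>' j) (inflight \<gamma>' j) (other \<gamma>' j) (cur \<gamma>' j)" for j
      by (rule iffD1[OF buffer_inv_merged[of "ppc st" _ _ _ _ "merge_done \<gamma>"]])
        (use inv pp in \<open>auto simp: ghost_inv_def \<gamma>'_def\<close>)
    moreover have "core_inv n h (busy (upc st) (qpc st)) \<gamma>'"
    proof -
      have "shared_run S (sk (stream \<gamma>)) E" if "shared_run S (init S) (slin \<gamma> @ ?d # E)" for E
        using shared[OF that] CalcHint by simp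
      then show ?thesis
        using core hint t r unfolding core_inv_def by (auto simp: \<gamma>'_def)
    qed
    ultimately have "ghost_inv n h st \<gamma>'"
      using inv t k unfolding ghost_inv_def by (auto simp: \<gamma>'_def)
    then show ?thesis
      by (intro exI[of _ \<gamma>']) (simp add: \<gamma>'_def)
  qed
qed

text \<open>One step may make \<open>f\<close> append operations of several threads.
  \<open>other\<close> and \<open>scount\<close> are preserved, so the pending operations that
  identify the remaining entries are the same after each absorption.\<close>

lemma absorb:
  assumes "ghost_inv n h st \<gamma>" and "wf_seq (slin \<gamma> @ D)" and "shared_run S (init S) (slin \<gamma> @ D)"
    and "\<And>t k x r. ((t, k), x, r) \<in> set D \<Longrightarrow> Suc k = scount \<gamma> t \<and> pending_ops st \<gamma> t = Some x"
  shows "\<exists>\<gamma>'. ghost_inv n h st \<gamma>' \<and> slin \<gamma>' = slin \<gamma> @ D \<and>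
    other \<gamma>' = other \<gamma> \<and> scount \<gamma>' = scount \<gamma> \<and> prefix (lin \<gamma>) (lin \<gamma>')"
  using assms
proof (induction D arbitrary: \<gamma>)
  case Nil
  then show ?case by auto
next
  case (Cons d D)
  obtain t k x r where d: "d = ((t, k), x, r)"
    by (metis prod.exhaust)
  have op: "Suc k = scount \<gamma> t" "pending_ops st \<gamma> t = Some x"
    using Cons.prems(4)[of t k x r] by (simp_all add: d)
  have "(t, k) \<notin> fst ` set (slin \<gamma>)"
    using Cons.prems(2) by (auto simp: wf_seq_def d)
  from absorb_one[OF Cons.prems(1) this _ op, of r D] Cons.prems(3)
  obtain \<gamma>1 where \<gamma>1: "ghost_inv n h st \<gamma>1" "slin \<gamma>1 = slin \<gamma> @ [d]" "other \<gamma>1 = other \<gamma>"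
      "scount \<gamma>1 = scount \<gamma>" "prefix (lin \<gamma>) (lin \<gamma>1)"
    by (auto simp: d)
  have "Suc k = scount \<gamma>1 t \<and> pending_ops st \<gamma>1 t = Some x"
    if "((t, k), x, r) \<in> set D" for t k x r
    using Cons.prems(4)[of t k x r] that \<gamma>1 by simp
  then have "\<exists>\<gamma>'. ghost_inv n h st \<gamma>' \<and> slin \<gamma>' = slin \<gamma>1 @ D \<and> other \<gamma>' = other \<gamma>1 \<and>
      scount \<gamma>' = scount \<gamma>1 \<and> prefix (lin \<gamma>1) (lin \<gamma>')"
    using Cons.prems(2,3) \<gamma>1 by (intro Cons.IH) simp_all
  then show ?case
    using \<gamma>1 by (auto intro: prefix_order.trans)
qed

lemma ghost_inv_globalS [simp]: "ghost_inv n h (st\<lparr>globalS := g\<rparr>) \<gamma> = ghost_inv n h st \<gamma>"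
  by (simp add: ghost_inv_def)

lemma ghost_inv_sexec [simp]: "ghost_inv n h st (\<gamma>\<lparr>sexec := \<sigma>\<rparr>) = ghost_inv n h st \<gamma>"
  by (simp add: ghost_inv_def core_inv_def merge_done_def)

text \<open>
  A step of the shared sketch: a call first changes the program counters (giving \<open>st1\<close>), then the
  newly linearised operations are absorbed; a response changes the program counters afterwards.
\<close>

lemma shared_step:
  assumes inv: "opt_inv n h st \<gamma>" and trans: "transition (shared S) (globalS st) l g"
    and perm: "permits S (pending_ops st \<gamma>) l"
    and pre: "ghost_inv n h st1 (\<gamma>\<lparr>scount := count_call (scount \<gamma>) l\<rparr>)"
    and ops: "pending_ops st1 \<gamma> =
      (case l of Call t x \<Rightarrow> pend (pending_ops st \<gamma>) l | _ \<Rightarrow> pending_ops st \<gamma>)"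
  shows "\<exists>\<gamma>'. ghost_inv n h st1 \<gamma>' \<and> other \<gamma>' = other \<gamma> \<and> scount \<gamma>' = count_call (scount \<gamma>) l \<and>
    prefix (lin \<gamma>) (lin \<gamma>') \<and> shared_exec S (sexec \<gamma>') g (pend (pending_ops st \<gamma>) l) (scount \<gamma>') \<and>
    slin \<gamma>' = f (sexec \<gamma>') \<and> slin \<gamma>' \<in> shared_spec S \<and>
    (\<forall>t r. l = Ret t r \<longrightarrow> (\<exists>x. ((t, scount \<gamma> t - 1), x, r) \<in> set (slin \<gamma>')))"
proof -
  have exec: "shared_exec S (sexec \<gamma>) (globalS st) (pending_ops st \<gamma>) (scount \<gamma>)"
    and slin: "slin \<gamma> = f (sexec \<gamma>)"
    using inv by (auto simp: opt_inv_def)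
  have wf: "H \<in> shared_spec S \<Longrightarrow> wf_seq H" for H
    by (simp add: shared_spec_def)
  obtain \<sigma> D where \<sigma>: "shared_exec S \<sigma> g (pend (pending_ops st \<gamma>) l) (count_call (scount \<gamma>) l)"
      "f \<sigma> = slin \<gamma> @ D" "f \<sigma> \<in> shared_spec S"
      "\<And>t k x r. ((t, k), x, r) \<in> set D \<Longrightarrow> Suc k = count_call (scount \<gamma>) l t \<and>
        (case l of Call t' y \<Rightarrow> pend (pending_ops st \<gamma>) l t | _ \<Rightarrow> pending_ops st \<gamma> t) = Some x"
      "\<And>t r. l = Ret t r \<Longrightarrow> \<exists>x. ((t, scount \<gamma> t - 1), x, r) \<in> set (f \<sigma>)"
    using shared_exec_step[OF f_linearisation f_prefix exec trans perm wf] unfolding slin by blast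
  have "\<exists>\<gamma>'. ghost_inv n h st1 \<gamma>' \<and> slin \<gamma>' = slin (\<gamma>\<lparr>scount := count_call (scount \<gamma>) l\<rparr>) @ D \<and>
      other \<gamma>' = other (\<gamma>\<lparr>scount := count_call (scount \<gamma>) l\<rparr>) \<and>
      scount \<gamma>' = scount (\<gamma>\<lparr>scount := count_call (scount \<gamma>) l\<rparr>) \<and>
      prefix (lin (\<gamma>\<lparr>scount := count_call (scount \<gamma>) l\<rparr>)) (lin \<gamma>')"
  proof (rule absorb[OF pre])
    show "Suc k = scount (\<gamma>\<lparr>scount := count_call (scount \<gamma>) l\<rparr>) t \<and>
        pending_ops st1 (\<gamma>\<lparr>scount := count_call (scount \<gamma>) l\<rparr>) t = Some x"
      if "((t, k), x, r) \<in> set D" for t k x r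
      using \<sigma>(4)[OF that] by (cases l) (simp_all add: ops)
  qed (use \<sigma>(2,3) in \<open>auto simp: shared_spec_def\<close>)
  then obtain \<gamma>' where "ghost_inv n h st1 \<gamma>'" "slin \<gamma>' = slin \<gamma> @ D" "other \<gamma>' = other \<gamma>"
      "scount \<gamma>' = count_call (scount \<gamma>) l" "prefix (lin \<gamma>) (lin \<gamma>')"
    by auto
  then show ?thesis
    using \<sigma> by (intro exI[of _ "\<gamma>'\<lparr>sexec := \<sigma>\<rparr>"]) auto
qed

lemma shared_call:
  assumes inv: "opt_inv n h st \<gamma>" and trans: "transition (shared S) (globalS st) (Call t x) g"
    and perm: "permits S (pending_ops st \<gamma>) (Call t x)"
    and pre: "ghost_inv n h st1 (\<gamma>\<lparr>scount := (scount \<gamma>)(t := Suc (scount \<gamma> t))\<rparr>)"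
    and ops: "pending_ops st1 \<gamma> = (pending_ops st \<gamma>)(t := Some x)"
  shows "\<exists>\<gamma>'. opt_inv n h (st1\<lparr>globalS := g\<rparr>) \<gamma>' \<and> prefix (lin \<gamma>) (lin \<gamma>')"
  using shared_step[OF inv trans perm, of st1] pre ops by (auto simp: opt_inv_def)

lemma shared_internal:
  assumes inv: "opt_inv n h st \<gamma>" and trans: "transition (shared S) (globalS st) (Step t) g"
    and "pending_ops st \<gamma> t \<noteq> None"
  shows "\<exists>\<gamma>'. opt_inv n h (st\<lparr>globalS := g\<rparr>) \<gamma>' \<and> prefix (lin \<gamma>) (lin \<gamma>')"
  using shared_step[OF inv trans, of st] assms(3) inv by (auto simp: opt_inv_def)

text \<open>The response may itself trigger linearisations. The change of program counters is
  therefore justified for an arbitrary ghost state \<gamma>' after absorption, in which the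
  returning operation is certain to be linearised.\<close>

lemma shared_return:
  assumes inv: "opt_inv n h st \<gamma>" and trans: "transition (shared S) (globalS st) (Ret t r) g"
    and "pending_ops st \<gamma> t \<noteq> None"
    and post: "\<And>\<gamma>' x. ghost_inv n h st \<gamma>' \<Longrightarrow> ((t, scount \<gamma>' t - 1), x, r) \<in> set (slin \<gamma>') \<Longrightarrow>
      ghost_inv n h st' \<gamma>' \<and> pending_ops st' \<gamma>' = (pending_ops st \<gamma>')(t := None)"
  shows "\<exists>\<gamma>'. opt_inv n h (st'\<lparr>globalS := g\<rparr>) \<gamma>' \<and> prefix (lin \<gamma>) (lin \<gamma>')"
proof -
  obtain \<gamma>' x where \<gamma>': "ghost_inv n h st \<gamma>'" "other \<gamma>' = other \<gamma>" "scount \<gamma>' = scount \<gamma>"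
      "prefix (lin \<gamma>) (lin \<gamma>')"
      "shared_exec S (sexec \<gamma>') g ((pending_ops st \<gamma>)(t := None)) (scount \<gamma>')"
      "slin \<gamma>' = f (sexec \<gamma>')" "slin \<gamma>' \<in> shared_spec S"
      "((t, scount \<gamma> t - 1), x, r) \<in> set (slin \<gamma>')"
    using shared_step[OF inv trans, of st] assms(3) inv by (auto simp: opt_inv_def)
  then have "ghost_inv n h st' \<gamma>' \<and> pending_ops st' \<gamma>' = (pending_ops st \<gamma>')(t := None)"
    using post by metis
  then show ?thesis
    using \<gamma>' by (intro exI[of _ \<gamma>']) (auto simp: opt_inv_def)
qed

section \<open>Steps of the propagator\<close>

lemma ghost_invD:
  assumes "ghost_inv n h st \<gamma>"
  shows ghost_inv_core: "core_inv n h (busy (upc st) (qpc st)) \<gamma>"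
    and ghost_inv_mem_ok: "mem_ok (mem st)"
    and ghost_inv_buffer: "buffer_inv (stream \<gamma>) (mem st) i (upc st i) (ppc st) (merge_done \<gamma>)
        (active \<gamma> i) (inflight \<gamma> i) (other \<gamma> i) (cur \<gamma> i)"
    and ghost_inv_updater: "updater_inv N n h (lin \<gamma>) i (upc st i)"
    and ghost_inv_querier:
      "querier_inv S (n (Querier k)) (scount \<gamma> (Querier k)) h (lin \<gamma>) k (qpc st k)"
    and ghost_inv_remaining: "remaining (ppc st) \<subseteq> {1..N}"
    and ghost_inv_index: "at_index (ppc st) = Some i \<Longrightarrow> i \<in> {1..N}"
    and ghost_inv_scount: "(t, k) \<in> fst ` set (slin \<gamma>) \<Longrightarrow> k < scount \<gamma> t"
  using assms unfolding ghost_inv_def by metis+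

lemma opt_inv_ghost: "opt_inv n h st \<gamma> \<Longrightarrow> ghost_inv n h st \<gamma>"
  by (simp add: opt_inv_def)

lemma pending_of_propagator:
  "(\<And>t. t \<noteq> Propagator \<Longrightarrow> pending_of pp qp s t = pending_of pp' qp s' t)"
  by (case_tac t) auto

text \<open>Only the propagator uses operations other than \<open>Snapshot\<close>, so nothing
  pending can conflict with its call while it has no operation pending itself.\<close>

lemma permits_propagator_call:
  assumes "pending_of pp qp s Propagator = None" and "\<And>s'. x = Merge s' \<Longrightarrow> \<exists>A. summarises S s' A"
  shows "permits S (pending_of pp qp s) (Call Propagator x)"
proof -
  have "pending_of pp qp s t = None \<or> pending_of pp qp s t = Some Snapshot" for t
    using assms(1) by (cases t) (auto split: qry_pc.splits)
  then show ?thesis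
    using assms unfolding permits.simps by blast
qed

lemma ghost_inv_propagator:
  assumes "ghost_inv n h st \<gamma>" and "mem_ok m"
    and "remaining pp \<subseteq> {1..N}" and "\<And>i. at_index pp = Some i \<Longrightarrow> i \<in> {1..N}"
    and "\<And>j. buffer_inv (stream \<gamma>) m j (upc st j) pp (merge_done \<gamma>)
      (active \<gamma> j) (inflight \<gamma> j) (B j) (cur \<gamma> j)"
  shows "ghost_inv n h (st\<lparr>ppc := pp, mem := m\<rparr>) (\<gamma>\<lparr>other := B\<rparr>)"
  using assms unfolding ghost_inv_def core_inv_def merge_done_def by simp

text \<open>The propagator has no shared operation pending before or after, so the pending
  operations and with them \<open>sexec\<close> stay as they are. \<open>B\<close> is the new value
  of \<open>other\<close>, which changes when a local sketch is cleared.\<close>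

lemma propagator_silent:
  assumes inv: "opt_inv n h st \<gamma>" and "mem_ok m"
    and "remaining pp \<subseteq> {1..N}" and "\<And>i. at_index pp = Some i \<Longrightarrow> i \<in> {1..N}"
    and "\<And>j. buffer_inv (stream \<gamma>) m j (upc st j) pp (merge_done \<gamma>)
      (active \<gamma> j) (inflight \<gamma> j) (B j) (cur \<gamma> j)"
    and idle: "\<And>s. pending_of (ppc st) (qpc st) s Propagator = None"
      "\<And>s. pending_of pp (qpc st) s Propagator = None"
  shows "opt_inv n h (st\<lparr>ppc := pp, mem := m\<rparr>) (\<gamma>\<lparr>other := B\<rparr>)"
proof -
  have "pending_of pp (qpc st) (\<lambda>i. sk (B i)) t = pending_ops st \<gamma> t" for t
    using idle pending_of_propagator[of t] by (cases "t = Propagator") auto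
  then have "pending_of pp (qpc st) (\<lambda>i. sk (B i)) = pending_ops st \<gamma>"
    by blast
  then show ?thesis
    using inv ghost_inv_propagator[OF opt_inv_ghost[OF inv] assms(2-5)]
    unfolding opt_inv_def by (elim conjE, intro conjI) simp_all
qed

lemma propagator_silent':
  assumes inv: "opt_inv n h st \<gamma>"
    and "remaining pp \<subseteq> {1..N}" and "\<And>i. at_index pp = Some i \<Longrightarrow> i \<in> {1..N}"
    and "\<And>j. buffer_inv (stream \<gamma>) (mem st) j (upc st j) pp (merge_done \<gamma>)
      (active \<gamma> j) (inflight \<gamma> j) (other \<gamma> j) (cur \<gamma> j)"
    and idle: "\<And>s. pending_of (ppc st) (qpc st) s Propagator = None"
      "\<And>s. pending_of pp (qpc st) s Propagator = None"
  shows "opt_inv n h (st\<lparr>ppc := pp\<rparr>) \<gamma>"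
proof -
  have "mem_ok (mem st)"
    using inv by (simp add: opt_inv_def ghost_inv_def)
  from propagator_silent[OF inv this assms(2-4) idle] show ?thesis
    by simp
qed

lemma opt_inv_p_restart:
  assumes "opt_inv n h st \<gamma>" and "ppc st = PNext {}"
  shows "opt_inv n h (st\<lparr>ppc := PNext {1..N}\<rparr>) \<gamma>"
proof (rule propagator_silent'[OF assms(1)])
  show "buffer_inv (stream \<gamma>) (mem st) j (upc st j) (PNext {1..N}) (merge_done \<gamma>)
      (active \<gamma> j) (inflight \<gamma> j) (other \<gamma> j) (cur \<gamma> j)" for j
    using ghost_inv_buffer[OF opt_inv_ghost[OF assms(1)], of j] assms(2) by (simp add: buffer_inv_def)
qed (use assms(2) in auto)

lemma opt_inv_p_skip:
  assumes "opt_inv n h st \<gamma>" and "ppc st = PNext T"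
  shows "opt_inv n h (st\<lparr>ppc := PNext (T - {i}), mem := acquire Propagator i (mem st)\<rparr>) \<gamma>"
proof -
  have mem: "mem_ok (mem st)" and T: "T \<subseteq> {1..N}"
    using assms by (simp_all add: opt_inv_def ghost_inv_def)
  have "buffer_inv (stream \<gamma>) (acquire Propagator i (mem st)) j (upc st j) (PNext (T - {i}))
      (merge_done \<gamma>) (active \<gamma> j) (inflight \<gamma> j) (other \<gamma> j) (cur \<gamma> j)" for j
    using ghost_inv_buffer[OF opt_inv_ghost[OF assms(1)], of j] assms(2) mem by (simp add: buffer_inv_def)
  from propagator_silent[OF assms(1) _ _ _ this] show ?thesis
    using mem T assms(2) by auto
qed

text \<open>Reading the zero acquires what the update thread published with it:
  \<open>cur\<^sub>i\<close> and the handed-over sketch become fresh for the propagator.\<close>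

lemma opt_inv_p_visit:
  assumes "opt_inv n h st \<gamma>" and "ppc st = PNext T" and "i \<in> T" and "prop_val (mem st) i = 0"
  shows "opt_inv n h (st\<lparr>ppc := PCur (T - {i}) i, mem := acquire Propagator i (mem st)\<rparr>) \<gamma>"
proof -
  have mem: "mem_ok (mem st)" and T: "T \<subseteq> {1..N}"
    using assms by (simp_all add: opt_inv_def ghost_inv_def)
  then have i: "i \<in> {1..N}"
    using assms(3) by blast
  have "buffer_inv (stream \<gamma>) (acquire Propagator i (mem st)) j (upc st j) (PCur (T - {i}) i)
      (merge_done \<gamma>) (active \<gamma> j) (inflight \<gamma> j) (other \<gamma> j) (cur \<gamma> j)" for j
    using ghost_inv_buffer[OF opt_inv_ghost[OF assms(1)], of j] assms mem
    by (cases "j = i") (auto simp: buffer_inv_def)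
  from propagator_silent[OF assms(1) _ _ _ this] show ?thesis
    using mem T i assms by auto
qed

lemma opt_inv_p_cur:
  assumes "opt_inv n h st \<gamma>" and "ppc st = PCur T i" and "reads (mem st) Propagator (Cur i) (NatV j)"
  shows "opt_inv n h (st\<lparr>ppc := PLocal T i (1 - j)\<rparr>) \<gamma>"
proof (rule propagator_silent'[OF assms(1)])
  note inv = opt_inv_ghost[OF assms(1)]
  have "fresh (mem st) Propagator (Cur i)" "latest (mem st) (Cur i) = NatV (cur \<gamma> i)"
    using ghost_inv_buffer[OF inv, of i] assms(2) by (simp_all add: buffer_inv_def)
  then have j: "j = cur \<gamma> i"
    using reads_fresh assms(3) by fastforce
  show "buffer_inv (stream \<gamma>) (mem st) k (upc st k) (PLocal T i (1 - j)) (merge_done \<gamma>)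
      (active \<gamma> k) (inflight \<gamma> k) (other \<gamma> k) (cur \<gamma> k)" for k
    using ghost_inv_buffer[OF inv, of k] assms(2) j by (cases "k = i") (auto simp: buffer_inv_def)
  show "remaining (PLocal T i (1 - j)) \<subseteq> {1..N}"
    "at_index (PLocal T i (1 - j)) = Some k \<Longrightarrow> k \<in> {1..N}" for k
    using ghost_inv_remaining[OF inv] ghost_inv_index[OF inv] assms(2) by auto
qed (use assms(2) in auto)

lemma opt_inv_p_local:
  assumes "opt_inv n h st \<gamma>" and "ppc st = PLocal T i j"
    and "reads (mem st) Propagator (LocalS i j) (SketchV s)"
  shows "opt_inv n h (st\<lparr>ppc := PCallMerge T i s\<rparr>) \<gamma>"
proof (rule propagator_silent'[OF assms(1)])
  note inv = opt_inv_ghost[OF assms(1)]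
  have "fresh (mem st) Propagator (LocalS i j)" "latest (mem st) (LocalS i j) = SketchV (sk (other \<gamma> i))"
    using ghost_inv_buffer[OF inv, of i] assms(2) by (simp_all add: buffer_inv_def)
  then have s: "s = sk (other \<gamma> i)"
    using reads_fresh assms(3) by fastforce
  show "buffer_inv (stream \<gamma>) (mem st) k (upc st k) (PCallMerge T i s) (merge_done \<gamma>)
      (active \<gamma> k) (inflight \<gamma> k) (other \<gamma> k) (cur \<gamma> k)" for k
    using ghost_inv_buffer[OF inv, of k] assms(2) s by (cases "k = i") (auto simp: buffer_inv_def)
  show "remaining (PCallMerge T i s) \<subseteq> {1..N}"
    "at_index (PCallMerge T i s) = Some k \<Longrightarrow> k \<in> {1..N}" for k
    using ghost_inv_remaining[OF inv] ghost_inv_index[OF inv] assms(2) by auto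
qed (use assms(2) in auto)

lemma ghost_inv_ppc:
  assumes inv: "ghost_inv n h st \<gamma>"
    and "remaining pp \<subseteq> {1..N}" and "\<And>i. at_index pp = Some i \<Longrightarrow> i \<in> {1..N}"
    and "\<And>j. buffer_inv (stream \<gamma>) (mem st) j (upc st j) pp (merge_done \<gamma>)
      (active \<gamma> j) (inflight \<gamma> j) (other \<gamma> j) (cur \<gamma> j)"
  shows "ghost_inv n h (st\<lparr>ppc := pp\<rparr>) \<gamma>"
  using ghost_inv_propagator[OF inv ghost_inv_mem_ok[OF inv] assms(2-4)] by simp

lemma opt_inv_p_call_merge:
  assumes inv: "opt_inv n h st \<gamma>" and pp: "ppc st = PCallMerge T i s"
    and trans: "transition (shared S) (globalS st) (Call Propagator (Merge s)) g"
  shows "\<exists>\<gamma>'. opt_inv n h (st\<lparr>ppc := PMerge T i, globalS := g\<rparr>) \<gamma>' \<and> prefix (lin \<gamma>) (lin \<gamma>')"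
proof (rule shared_call[OF inv trans])
  note ginv = opt_inv_ghost[OF inv]
  define \<gamma>1 where "\<gamma>1 = \<gamma>\<lparr>scount := (scount \<gamma>)(Propagator := Suc (scount \<gamma> Propagator))\<rparr>"
  have s: "s = sk (other \<gamma> i)"
    using ghost_inv_buffer[OF ginv, of i] pp by (simp add: buffer_inv_def)
  then show "permits S (pending_ops st \<gamma>) (Call Propagator (Merge s))"
    using pp summarises_sk by (intro permits_propagator_call) auto
  show "pending_ops (st\<lparr>ppc := PMerge T i\<rparr>) \<gamma> = (pending_ops st \<gamma>)(Propagator := Some (Merge s))"
    using s pending_of_propagator by fastforce
  \<comment> \<open>The call takes the number \<open>scount \<gamma> Propagator\<close>, which
    exceeds all numbers of this thread in \<open>slin\<close>.\<close>
  have not_merged: "\<not> merge_done \<gamma>1"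
    using ghost_inv_scount[OF ginv, of Propagator "scount \<gamma> Propagator"]
    by (auto simp: merge_done_def \<gamma>1_def)
  have "ghost_inv n h (st\<lparr>ppc := PMerge T i\<rparr>) \<gamma>1"
  proof -
    have "buffer_inv (stream \<gamma>) (mem st) j (upc st j) (PMerge T i) (merge_done \<gamma>1)
        (active \<gamma> j) (inflight \<gamma> j) (other \<gamma> j) (cur \<gamma> j)" for j
      using ghost_inv_buffer[OF ginv, of j] pp not_merged
      by (cases "j = i") (auto simp: buffer_inv_def)
    then show ?thesis
      using ginv pp unfolding ghost_inv_def by (auto simp: \<gamma>1_def core_inv_def less_Suc_eq)
  qed
  then show "ghost_inv n h (st\<lparr>ppc := PMerge T i\<rparr>)
      (\<gamma>\<lparr>scount := (scount \<gamma>)(Propagator := Suc (scount \<gamma> Propagator))\<rparr>)"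
    by (simp add: \<gamma>1_def)
qed

lemma opt_inv_p_ret_merge:
  assumes inv: "opt_inv n h st \<gamma>" and pp: "ppc st = PMerge T i"
    and trans: "transition (shared S) (globalS st) (Ret Propagator Merged) g"
  shows "\<exists>\<gamma>'. opt_inv n h (st\<lparr>ppc := PCur' T i, globalS := g\<rparr>) \<gamma>' \<and> prefix (lin \<gamma>) (lin \<gamma>')"
proof (rule shared_return[OF inv trans])
  show "pending_ops st \<gamma> Propagator \<noteq> None"
    using pp by simp
  fix \<gamma>' x
  assume ginv: "ghost_inv n h st \<gamma>'"
    and "((Propagator, scount \<gamma>' Propagator - 1), x, Merged) \<in> set (slin \<gamma>')"
  \<comment> \<open>The responding merge is in \<open>slin\<close>, so its buffer has been
    propagated and nothing is in flight.\<close>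
  then have "merge_done \<gamma>'"
    by (force simp: merge_done_def)
  show "ghost_inv n h (st\<lparr>ppc := PCur' T i\<rparr>) \<gamma>' \<and>
      pending_ops (st\<lparr>ppc := PCur' T i\<rparr>) \<gamma>' = (pending_ops st \<gamma>')(Propagator := None)"
  proof
    show "ghost_inv n h (st\<lparr>ppc := PCur' T i\<rparr>) \<gamma>'"
    proof (rule ghost_inv_ppc[OF ginv])
      show "buffer_inv (stream \<gamma>') (mem st) j (upc st j) (PCur' T i) (merge_done \<gamma>')
          (active \<gamma>' j) (inflight \<gamma>' j) (other \<gamma>' j) (cur \<gamma>' j)" for j
        using ghost_inv_buffer[OF ginv, of j] pp \<open>merge_done \<gamma>'\<close>
        by (cases "j = i") (auto simp: buffer_inv_def)
    qed (use ghost_inv_remaining[OF ginv] ghost_inv_index[OF ginv] pp in auto)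
    show "pending_ops (st\<lparr>ppc := PCur' T i\<rparr>) \<gamma>' = (pending_ops st \<gamma>')(Propagator := None)"
      using pending_of_propagator by fastforce
  qed
qed

lemma opt_inv_p_cur':
  assumes "opt_inv n h st \<gamma>" and "ppc st = PCur' T i" and "reads (mem st) Propagator (Cur i) (NatV j)"
  shows "opt_inv n h (st\<lparr>ppc := PClear T i (1 - j)\<rparr>) \<gamma>"
proof (rule propagator_silent'[OF assms(1)])
  note inv = opt_inv_ghost[OF assms(1)]
  have "fresh (mem st) Propagator (Cur i)" "latest (mem st) (Cur i) = NatV (cur \<gamma> i)"
    using ghost_inv_buffer[OF inv, of i] assms(2) by (simp_all add: buffer_inv_def)
  then have j: "j = cur \<gamma> i"
    using reads_fresh assms(3) by fastforce
  show "buffer_inv (stream \<gamma>) (mem st) k (upc st k) (PClear T i (1 - j)) (merge_done \<gamma>)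
      (active \<gamma> k) (inflight \<gamma> k) (other \<gamma> k) (cur \<gamma> k)" for k
    using ghost_inv_buffer[OF inv, of k] assms(2) j by (cases "k = i") (auto simp: buffer_inv_def)
  show "remaining (PClear T i (1 - j)) \<subseteq> {1..N}"
    "at_index (PClear T i (1 - j)) = Some k \<Longrightarrow> k \<in> {1..N}" for k
    using ghost_inv_remaining[OF inv] ghost_inv_index[OF inv] assms(2) by auto
qed (use assms(2) in auto)

lemma opt_inv_p_clear:
  assumes "opt_inv n h st \<gamma>" and pp: "ppc st = PClear T i j"
  shows "opt_inv n h (st\<lparr>ppc := PCallHint T i,
    mem := store Propagator (LocalS i j) (SketchV (init S)) (mem st)\<rparr>) (\<gamma>\<lparr>other := (other \<gamma>)(i := [])\<rparr>)"
proof (rule propagator_silent[OF assms(1)])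
  note inv = opt_inv_ghost[OF assms(1)]
  have mem: "mem_ok (mem st)"
    by (rule ghost_inv_mem_ok[OF inv])
  then show "mem_ok (store Propagator (LocalS i j) (SketchV (init S)) (mem st))"
    by simp
  \<comment> \<open>The cleared sketch is not the current one, so the content and the freshness that
    the update thread relies on survive the store.\<close>
  have ne: "1 - c \<noteq> c" "c \<noteq> 1 - c" if "c \<le> 1" for c :: nat
    using that by arith+
  show "buffer_inv (stream \<gamma>) (store Propagator (LocalS i j) (SketchV (init S)) (mem st)) k (upc st k)
      (PCallHint T i) (merge_done \<gamma>) (active \<gamma> k) (inflight \<gamma> k) (((other \<gamma>)(i := [])) k) (cur \<gamma> k)" for k
    using ghost_inv_buffer[OF inv, of k] pp mem ne[of "cur \<gamma> k"]
    by (cases "k = i") (auto simp: buffer_inv_def sk_def)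
  show "remaining (PCallHint T i) \<subseteq> {1..N}" "at_index (PCallHint T i) = Some k \<Longrightarrow> k \<in> {1..N}" for k
    using ghost_inv_remaining[OF inv] ghost_inv_index[OF inv] assms(2) by auto
qed (use assms(2) in auto)

lemma opt_inv_p_call_hint:
  assumes inv: "opt_inv n h st \<gamma>" and pp: "ppc st = PCallHint T i"
    and trans: "transition (shared S) (globalS st) (Call Propagator CalcHint) g"
  shows "\<exists>\<gamma>'. opt_inv n h (st\<lparr>ppc := PHint T i, globalS := g\<rparr>) \<gamma>' \<and> prefix (lin \<gamma>) (lin \<gamma>')"
proof (rule shared_call[OF inv trans])
  note ginv = opt_inv_ghost[OF inv]
  define \<gamma>1 where "\<gamma>1 = \<gamma>\<lparr>scount := (scount \<gamma>)(Propagator := Suc (scount \<gamma> Propagator))\<rparr>"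
  show "permits S (pending_ops st \<gamma>) (Call Propagator CalcHint)"
    using pp by (intro permits_propagator_call) auto
  show "pending_ops (st\<lparr>ppc := PHint T i\<rparr>) \<gamma> = (pending_ops st \<gamma>)(Propagator := Some CalcHint)"
    using pending_of_propagator by fastforce
  have "ghost_inv n h (st\<lparr>ppc := PHint T i\<rparr>) \<gamma>1"
  proof -
    have "buffer_inv (stream \<gamma>) (mem st) j (upc st j) (PHint T i) (merge_done \<gamma>1)
        (active \<gamma> j) (inflight \<gamma> j) (other \<gamma> j) (cur \<gamma> j)" for j
      using ghost_inv_buffer[OF ginv, of j] pp
      by (cases "j = i") (auto simp: buffer_inv_def)
    then show ?thesis
      using ginv pp unfolding ghost_inv_def by (auto simp: \<gamma>1_def core_inv_def less_Suc_eq)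
  qed
  then show "ghost_inv n h (st\<lparr>ppc := PHint T i\<rparr>)
      (\<gamma>\<lparr>scount := (scount \<gamma>)(Propagator := Suc (scount \<gamma> Propagator))\<rparr>)"
    by (simp add: \<gamma>1_def)
qed

lemma opt_inv_p_ret_hint:
  assumes inv: "opt_inv n h st \<gamma>" and pp: "ppc st = PHint T i"
    and trans: "transition (shared S) (globalS st) (Ret Propagator (Hinted r)) g"
  shows "\<exists>\<gamma>'. opt_inv n h (st\<lparr>ppc := PSetProp T i r, globalS := g\<rparr>) \<gamma>' \<and> prefix (lin \<gamma>) (lin \<gamma>')"
proof (rule shared_return[OF inv trans])
  show "pending_ops st \<gamma> Propagator \<noteq> None"
    using pp by simp
  fix \<gamma>' x
  assume ginv: "ghost_inv n h st \<gamma>'"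
    and "((Propagator, scount \<gamma>' Propagator - 1), x, Hinted r) \<in> set (slin \<gamma>')"
  \<comment> \<open>\<open>core_inv\<close> records every hint in \<open>slin\<close> as non-zero
    and sound for a prefix of the stream, whenever it was linearised.\<close>
  then have r: "r \<noteq> 0" "hint_ok (stream \<gamma>') r"
    using ghost_inv_core[OF ginv] unfolding core_inv_def by blast+
  show "ghost_inv n h (st\<lparr>ppc := PSetProp T i r\<rparr>) \<gamma>' \<and>
      pending_ops (st\<lparr>ppc := PSetProp T i r\<rparr>) \<gamma>' = (pending_ops st \<gamma>')(Propagator := None)"
  proof
    show "ghost_inv n h (st\<lparr>ppc := PSetProp T i r\<rparr>) \<gamma>'"
    proof (rule ghost_inv_ppc[OF ginv])
      show "buffer_inv (stream \<gamma>') (mem st) j (upc st j) (PSetProp T i r) (merge_done \<gamma>')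
          (active \<gamma>' j) (inflight \<gamma>' j) (other \<gamma>' j) (cur \<gamma>' j)" for j
        using ghost_inv_buffer[OF ginv, of j] pp r
        by (cases "j = i") (auto simp: buffer_inv_def)
    qed (use ghost_inv_remaining[OF ginv] ghost_inv_index[OF ginv] pp in auto)
    show "pending_ops (st\<lparr>ppc := PSetProp T i r\<rparr>) \<gamma>' = (pending_ops st \<gamma>')(Propagator := None)"
      using pending_of_propagator by fastforce
  qed
qed

text \<open>The cleared sketch is fresh for the propagator, which has just stored it; this write
  publishes it for the update thread to acquire on seeing a non-zero value.\<close>

lemma opt_inv_p_set_prop:
  assumes "opt_inv n h st \<gamma>" and pp: "ppc st = PSetProp T i r"
  shows "opt_inv n h (st\<lparr>ppc := PNext T, mem := write_prop Propagator i r (mem st)\<rparr>) \<gamma>"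
proof -
  note inv = opt_inv_ghost[OF assms(1)]
  have mem: "mem_ok (mem st)" and T: "T \<subseteq> {1..N}"
    using inv pp by (simp_all add: ghost_inv_def)
  have "buffer_inv (stream \<gamma>) (write_prop Propagator i r (mem st)) j (upc st j) (PNext T)
      (merge_done \<gamma>) (active \<gamma> j) (inflight \<gamma> j) (other \<gamma> j) (cur \<gamma> j)" for j
    using ghost_inv_buffer[OF inv, of j] pp mem
    by (cases "j = i") (auto simp: buffer_inv_def)
  from propagator_silent[OF assms(1) _ _ _ this] show ?thesis
    using mem T assms by auto
qed

section \<open>Steps of the query threads\<close>

lemma busy_querier: "busy up (qp(k := pc)) = (busy up qp)(Querier k := (pc \<noteq> QIdle))"
proof
  show "busy up (qp(k := pc)) t = ((busy up qp)(Querier k := (pc \<noteq> QIdle))) t" for t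
    by (cases t) auto
qed

lemma pending_of_querier:
  "pending_of pp (qp(k := pc)) s =
     (pending_of pp qp s)(Querier k := (case pc of QSnapshot q \<Rightarrow> Some Snapshot | _ \<Rightarrow> None))"
proof
  show "pending_of pp (qp(k := pc)) s t =
     ((pending_of pp qp s)(Querier k := (case pc of QSnapshot q \<Rightarrow> Some Snapshot | _ \<Rightarrow> None))) t" for t
    by (cases t) auto
qed

lemma state_qpc_globalS:
  fixes st :: "('s, 'a, 'q, 'v, 'h, 'c) state"
  shows "st\<lparr>qpc := qp, globalS := g\<rparr> = st\<lparr>globalS := g, qpc := qp\<rparr>"
  by (cases st) simp

lemma core_inv_tracks:
  "core_inv n h D \<gamma> \<Longrightarrow> tracks n' D' h' (lin \<gamma>) \<Longrightarrow> core_inv n' h' D' \<gamma>"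
  by (simp add: core_inv_def)

lemma core_tracks: "core_inv n h D \<gamma> \<Longrightarrow> tracks n D h (lin \<gamma>)"
  by (simp add: core_inv_def)

lemma updater_inv_mono:
  assumes "updater_inv N n h H i pc" and "n' (Updater i) = n (Updater i)"
    and "set h \<subseteq> set h'" and "set H \<subseteq> set H'"
    and "\<And>j. (Updater i, j) \<in> fst ` set H' \<Longrightarrow> (Updater i, j) \<in> fst ` set H"
  shows "updater_inv N n' h' H' i pc"
proof (cases "update_arg pc")
  case None
  then show ?thesis
    using assms(1,2,4) by (auto simp: updater_inv_def)
next
  case (Some a)
  then show ?thesis
    using assms(1,2,3) assms(5)[of "n (Updater i) - 1"] by (auto simp: updater_inv_def)
qed

lemma querier_inv_mono:
  "querier_inv S m sn h H k pc \<Longrightarrow> set h \<subseteq> set h' \<Longrightarrow> set H \<subseteq> set H' \<Longrightarrow>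
   querier_inv S m sn h' H' k pc"
  by (cases pc) auto

text \<open>\<open>sn\<close> lets the count of snapshots advance together with the program counter,
  as the call of a snapshot requires.\<close>

lemma ghost_inv_goto_q:
  assumes ginv: "ghost_inv n h st \<gamma>"
    and tracks: "tracks n' (busy (upc st) ((qpc st)(k := pc))) h' (lin \<gamma>)"
    and n': "\<And>t. t \<noteq> Querier k \<Longrightarrow> n' t = n t" and h': "set h \<subseteq> set h'"
    and sn: "\<And>t. t \<noteq> Querier k \<Longrightarrow> sn t = scount \<gamma> t" "\<And>t. scount \<gamma> t \<le> sn t"
    and qinv: "querier_inv S (n' (Querier k)) (sn (Querier k)) h' (lin \<gamma>) k pc"
  shows "ghost_inv n' h' (goto_q k pc st) (\<gamma>\<lparr>scount := sn\<rparr>)"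
proof -
  have "updater_inv N n' h' (lin \<gamma>) i (upc st i)" for i
    by (rule updater_inv_mono[OF ghost_inv_updater[OF ginv]]) (use n' h' in auto)
  moreover have "querier_inv S (n' (Querier j)) (sn (Querier j)) h' (lin \<gamma>) j
      (((qpc st)(k := pc)) j)" for j
    using ghost_inv_querier[OF ginv, of j] n'[of "Querier j"] sn(1)[of "Querier j"] h' qinv
      querier_inv_mono[of _ _ h "lin \<gamma>" j _ h' "lin \<gamma>"]
    by (cases "j = k") auto
  moreover have "merge_done (\<gamma>\<lparr>scount := sn\<rparr>) = merge_done \<gamma>"
    using sn(1)[of Propagator] by (simp add: merge_done_def)
  moreover have "core_inv n' h' (busy (upc st) ((qpc st)(k := pc))) (\<gamma>\<lparr>scount := sn\<rparr>)"
    using core_inv_tracks[OF ghost_inv_core[OF ginv] tracks] by (simp add: core_inv_def)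
  moreover have "j < sn t" if "(t, j) \<in> fst ` set (slin \<gamma>)" for t j
    using ghost_inv_scount[OF ginv that] sn(2)[of t] by simp
  ultimately show ?thesis
    using ginv unfolding ghost_inv_def by simp
qed

lemma ghost_inv_goto_q':
  assumes "ghost_inv n h st \<gamma>"
    and "tracks n' (busy (upc st) ((qpc st)(k := pc))) h' (lin \<gamma>)"
    and "\<And>t. t \<noteq> Querier k \<Longrightarrow> n' t = n t" and "set h \<subseteq> set h'"
    and "querier_inv S (n' (Querier k)) (scount \<gamma> (Querier k)) h' (lin \<gamma>) k pc"
  shows "ghost_inv n' h' (goto_q k pc st) \<gamma>"
  using ghost_inv_goto_q[OF assms(1-4), of "scount \<gamma>"] assms(5) by simp

lemma ghost_inv_tracks: "ghost_inv n h st \<gamma> \<Longrightarrow> tracks n (busy (upc st) (qpc st)) h (lin \<gamma>)"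
  by (simp add: ghost_inv_def core_inv_def)

lemma tracks_querier_busy:
  assumes "ghost_inv n h st \<gamma>" and "qpc st k \<noteq> QIdle" and "pc \<noteq> QIdle"
  shows "tracks n (busy (upc st) ((qpc st)(k := pc))) h (lin \<gamma>)"
proof -
  have "(busy (upc st) (qpc st))(Querier k := True) = busy (upc st) (qpc st)"
    using assms(2) by (intro fun_upd_idem) simp
  then show ?thesis
    using ghost_inv_tracks[OF assms(1)] assms(3) by (simp add: busy_querier)
qed

lemma querier_local:
  assumes inv: "opt_inv n h st \<gamma>" and ghost: "ghost_inv n' h' (goto_q k pc st) \<gamma>"
    and "\<And>q. qpc st k \<noteq> QSnapshot q" and "\<And>q. pc \<noteq> QSnapshot q"
  shows "opt_inv n' h' (goto_q k pc st) \<gamma>"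
proof -
  have "pending_ops st \<gamma> (Querier k) = None"
    using assms(3) by (auto split: qry_pc.splits)
  then have "(pending_ops st \<gamma>)(Querier k := None) = pending_ops st \<gamma>"
    by (rule fun_upd_idem)
  moreover have "(case pc of QSnapshot q \<Rightarrow> Some (Snapshot :: 's shared_op) | _ \<Rightarrow> None) = None"
    using assms(4) by (auto split: qry_pc.splits)
  ultimately have "pending_ops (goto_q k pc st) \<gamma> = pending_ops st \<gamma>"
    by (simp add: pending_of_querier)
  then show ?thesis
    using inv ghost unfolding opt_inv_def by (elim conjE, intro conjI) simp_all
qed

lemma opt_inv_q_call:
  assumes inv: "opt_inv n h st \<gamma>" and pc: "qpc st k = QIdle"
  shows "opt_inv (n(Querier k := Suc (n (Querier k)))) (h @ [Inv (Querier k, n (Querier k)) (Query q)])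
    (goto_q k (QCall q) st) \<gamma>"
proof (rule querier_local[OF inv ghost_inv_goto_q'])
  note ginv = opt_inv_ghost[OF inv]
  show "ghost_inv n h st \<gamma>" by (rule ginv)
  show "tracks (n(Querier k := Suc (n (Querier k)))) (busy (upc st) ((qpc st)(k := QCall q)))
      (h @ [Inv (Querier k, n (Querier k)) (Query q)]) (lin \<gamma>)"
    using tracks_call[OF ghost_inv_tracks[OF ginv], of "Querier k"] pc by (simp add: busy_querier)
  show "querier_inv S ((n(Querier k := Suc (n (Querier k)))) (Querier k)) (scount \<gamma> (Querier k))
      (h @ [Inv (Querier k, n (Querier k)) (Query q)]) (lin \<gamma>) k (QCall q)"
    using ghost_inv_querier[OF ginv, of k] pc by simp
qed (use pc in auto)

lemma opt_inv_q_call_snapshot: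
  assumes inv: "opt_inv n h st \<gamma>" and pc: "qpc st k = QCall q"
    and trans: "transition (shared S) (globalS st) (Call (Querier k) Snapshot) g"
  shows "\<exists>\<gamma>'. opt_inv n h (goto_q k (QSnapshot q) (st\<lparr>globalS := g\<rparr>)) \<gamma>' \<and> prefix (lin \<gamma>) (lin \<gamma>')"
proof -
  note ginv = opt_inv_ghost[OF inv]
  have "\<exists>\<gamma>'. opt_inv n h ((goto_q k (QSnapshot q) st)\<lparr>globalS := g\<rparr>) \<gamma>' \<and> prefix (lin \<gamma>) (lin \<gamma>')"
  proof (rule shared_call[OF inv trans])
    show "permits S (pending_ops st \<gamma>) (Call (Querier k) Snapshot)"
      using pc by simp
    show "pending_ops (goto_q k (QSnapshot q) st) \<gamma> = (pending_ops st \<gamma>)(Querier k := Some Snapshot)"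
      by (simp add: pending_of_querier)
    show "ghost_inv n h (goto_q k (QSnapshot q) st)
        (\<gamma>\<lparr>scount := (scount \<gamma>)(Querier k := Suc (scount \<gamma> (Querier k)))\<rparr>)"
      using ghost_inv_querier[OF ginv, of k] pc tracks_querier_busy[OF ginv]
      by (intro ghost_inv_goto_q[OF ginv]) auto
  qed
  then show ?thesis by (simp add: state_qpc_globalS)
qed

lemma opt_inv_q_ret_snapshot:
  assumes inv: "opt_inv n h st \<gamma>" and pc: "qpc st k = QSnapshot q"
    and trans: "transition (shared S) (globalS st) (Ret (Querier k) (Copy s)) g"
  shows "\<exists>\<gamma>'. opt_inv n h (goto_q k (QQuery q s) (st\<lparr>globalS := g\<rparr>)) \<gamma>' \<and> prefix (lin \<gamma>) (lin \<gamma>')"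
proof -
  have "\<exists>\<gamma>'. opt_inv n h ((goto_q k (QQuery q s) st)\<lparr>globalS := g\<rparr>) \<gamma>' \<and> prefix (lin \<gamma>) (lin \<gamma>')"
  proof (rule shared_return[OF inv trans])
    show "pending_ops st \<gamma> (Querier k) \<noteq> None"
      using pc by simp
    fix \<gamma>' x
    assume ginv: "ghost_inv n h st \<gamma>'"
      and mem: "((Querier k, scount \<gamma>' (Querier k) - 1), x, Copy s) \<in> set (slin \<gamma>')"
    have qinv: "scount \<gamma>' (Querier k) = n (Querier k)"
        "Inv (Querier k, n (Querier k) - 1) (Query q) \<in> set h"
      using ghost_inv_querier[OF ginv, of k] pc by simp_all
    have "\<forall>k j x s. ((Querier k, j), x, Copy s) \<in> set (slin \<gamma>') \<longrightarrow>
        (\<exists>q. ((Querier k, j), Query q, Val (query S s q)) \<in> set (lin \<gamma>'))"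
      using ghost_inv_core[OF ginv] by (simp add: core_inv_def)
    with mem obtain q' where
        q': "((Querier k, n (Querier k) - 1), Query q', Val (query S s q')) \<in> set (lin \<gamma>')"
      unfolding qinv(1) by blast
    note tracks = ghost_inv_tracks[OF ginv]
    \<comment> \<open>The snapshot only yields some linearised query \<open>q'\<close> with the
      right identity; since an identity has one invocation, it is the pending query.\<close>
    have "Query q' = (Query q :: ('a, 'q) sketch_op)"
      by (rule tracks_inv_unique[OF tracks tracks_inv[OF tracks q'] qinv(2)])
    then have "\<exists>x. ((Querier k, n (Querier k) - 1), x, Val (query S s q)) \<in> set (lin \<gamma>')"
      using q' by blast
    then have qinv': "querier_inv S (n (Querier k)) (scount \<gamma>' (Querier k)) h (lin \<gamma>') k (QQuery q s)"
      by (simp add: qinv(1))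
    have tracks': "tracks n (busy (upc st) ((qpc st)(k := QQuery q s))) h (lin \<gamma>')"
      by (rule tracks_querier_busy[OF ginv]) (simp_all add: pc)
    show "ghost_inv n h (goto_q k (QQuery q s) st) \<gamma>' \<and>
        pending_ops (goto_q k (QQuery q s) st) \<gamma>' = (pending_ops st \<gamma>')(Querier k := None)"
    proof
      show "ghost_inv n h (goto_q k (QQuery q s) st) \<gamma>'"
        by (rule ghost_inv_goto_q'[OF ginv tracks' _ _ qinv']) simp_all
    qed (simp add: pending_of_querier)
  qed
  then show ?thesis by (simp add: state_qpc_globalS)
qed

lemma opt_inv_q_query:
  assumes inv: "opt_inv n h st \<gamma>" and pc: "qpc st k = QQuery q s"
  shows "opt_inv n h (goto_q k (QReturn (query S s q)) st) \<gamma>"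
proof (rule querier_local[OF inv ghost_inv_goto_q'])
  note ginv = opt_inv_ghost[OF inv]
  show "ghost_inv n h st \<gamma>" by (rule ginv)
  show "tracks n (busy (upc st) ((qpc st)(k := QReturn (query S s q)))) h (lin \<gamma>)"
    using tracks_querier_busy[OF ginv] pc by simp
  show "querier_inv S (n (Querier k)) (scount \<gamma> (Querier k)) h (lin \<gamma>) k (QReturn (query S s q))"
    using ghost_inv_querier[OF ginv, of k] pc by simp
qed (use pc in auto)

lemma opt_inv_q_return:
  assumes inv: "opt_inv n h st \<gamma>" and pc: "qpc st k = QReturn v"
  shows "opt_inv n (h @ [Res (Querier k, n (Querier k) - 1) (Val v)]) (goto_q k QIdle st) \<gamma>"
proof (rule querier_local[OF inv ghost_inv_goto_q'])
  note ginv = opt_inv_ghost[OF inv]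
  show "ghost_inv n h st \<gamma>" by (rule ginv)
  obtain x where "((Querier k, n (Querier k) - 1), x, Val v) \<in> set (lin \<gamma>)"
    using ghost_inv_querier[OF ginv, of k] pc by auto
  then show "tracks n (busy (upc st) ((qpc st)(k := QIdle)))
      (h @ [Res (Querier k, n (Querier k) - 1) (Val v)]) (lin \<gamma>)"
    using tracks_ret[OF ghost_inv_tracks[OF ginv], of "Querier k"] pc by (simp add: busy_querier)
  show "querier_inv S (n (Querier k)) (scount \<gamma> (Querier k))
      (h @ [Res (Querier k, n (Querier k) - 1) (Val v)]) (lin \<gamma>) k QIdle"
    using ghost_inv_querier[OF ginv, of k] pc by simp
qed (use pc in auto)

section \<open>Steps of the update threads\<close>

lemma busy_updater: "busy (up(i := pc)) qp = (busy up qp)(Updater i := (pc \<noteq> UIdle))"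
proof
  show "busy (up(i := pc)) qp t = ((busy up qp)(Updater i := (pc \<noteq> UIdle))) t" for t
    by (cases t) auto
qed

text \<open>\<open>lin\<close> may grow only by entries of \<open>Updater i\<close>, and
  \<open>other\<close> may change only where the propagator is not at work; this preserves the
  invariants of the other threads and the argument of a pending merge.\<close>

lemma updater_step:
  assumes inv: "opt_inv n h st \<gamma>" and mem: "mem_ok m"
    and core: "core_inv n' h' ((busy (upc st) (qpc st))(Updater i := (pc \<noteq> UIdle))) \<gamma>'"
    and n': "\<And>t. t \<noteq> Updater i \<Longrightarrow> n' t = n t" and h': "set h \<subseteq> set h'"
    and lin: "set (lin \<gamma>) \<subseteq> set (lin \<gamma>')"
      "\<And>e. e \<in> set (lin \<gamma>') \<Longrightarrow> e \<in> set (lin \<gamma>) \<or> fst (fst e) = Updater i"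
    and upd: "updater_inv N n' h' (lin \<gamma>') i pc"
    and own: "buffer_inv (stream \<gamma>) m i pc (ppc st) (merge_done \<gamma>)
      (active \<gamma>' i) (inflight \<gamma>' i) (other \<gamma>' i) (cur \<gamma>' i)"
    and others: "\<And>j. j \<noteq> i \<Longrightarrow> buffer_inv (stream \<gamma>) m j (upc st j) (ppc st) (merge_done \<gamma>)
      (active \<gamma>' j) (inflight \<gamma>' j) (other \<gamma>' j) (cur \<gamma>' j)"
    and same: "stream \<gamma>' = stream \<gamma>" "slin \<gamma>' = slin \<gamma>" "scount \<gamma>' = scount \<gamma>" "sexec \<gamma>' = sexec \<gamma>"
    and other: "\<And>j. at_index (ppc st) = Some j \<Longrightarrow> other \<gamma>' j = other \<gamma> j"
  shows "opt_inv n' h' (goto_u i pc (st\<lparr>mem := m\<rparr>)) \<gamma>'"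
proof -
  note ginv = opt_inv_ghost[OF inv]
  have "updater_inv N n' h' (lin \<gamma>') j (upc st j)" if "j \<noteq> i" for j
  proof (rule updater_inv_mono[OF ghost_inv_updater[OF ginv]])
    show "(Updater j, k) \<in> fst ` set (lin \<gamma>)" if "(Updater j, k) \<in> fst ` set (lin \<gamma>')" for k
      using that lin(2) \<open>j \<noteq> i\<close> by force
  qed (use n' h' lin(1) that in auto)
  moreover have "querier_inv S (n' (Querier k)) (scount \<gamma> (Querier k)) h' (lin \<gamma>') k (qpc st k)" for k
    using querier_inv_mono[OF ghost_inv_querier[OF ginv] h' lin(1)] n' by simp
  moreover have "merge_done \<gamma>' = merge_done \<gamma>"
    using same by (simp add: merge_done_def)
  moreover have "buffer_inv (stream \<gamma>) m j (((upc st)(i := pc)) j) (ppc st) (merge_done \<gamma>)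
      (active \<gamma>' j) (inflight \<gamma>' j) (other \<gamma>' j) (cur \<gamma>' j)" for j
    using own others[of j] by (cases "j = i") simp_all
  moreover have "updater_inv N n' h' (lin \<gamma>') j (((upc st)(i := pc)) j)" for j
    using upd calculation(1)[of j] by (cases "j = i") simp_all
  moreover have "core_inv n' h' (busy ((upc st)(i := pc)) (qpc st)) \<gamma>'"
    using core by (simp only: busy_updater)
  ultimately have ghost: "ghost_inv n' h' (goto_u i pc (st\<lparr>mem := m\<rparr>)) \<gamma>'"
    using mem ghost_inv_remaining[OF ginv] ghost_inv_index[OF ginv] ghost_inv_scount[OF ginv]
    unfolding ghost_inv_def by (simp add: same)
  have "pending_of (ppc st) (qpc st) (\<lambda>i. sk (other \<gamma>' i)) t = pending_ops st \<gamma> t" for t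
  proof (cases t)
    case Propagator
    then show ?thesis
      using other by (cases "ppc st") simp_all
  qed simp_all
  then have pending: "pending_of (ppc st) (qpc st) (\<lambda>i. sk (other \<gamma>' i)) = pending_ops st \<gamma>"
    by blast
  show ?thesis
    unfolding opt_inv_def
  proof (intro conjI)
    show "shared_exec S (sexec \<gamma>') (globalS (goto_u i pc (st\<lparr>mem := m\<rparr>)))
        (pending_ops (goto_u i pc (st\<lparr>mem := m\<rparr>)) \<gamma>') (scount \<gamma>')"
      using inv by (simp add: opt_inv_def same pending)
    show "slin \<gamma>' = f (sexec \<gamma>')" "slin \<gamma>' \<in> shared_spec S"
      unfolding same using inv unfolding opt_inv_def by blast+
  qed (rule ghost)
qed

lemma busy_updater_same:
  "upc st i \<noteq> UIdle \<Longrightarrow> (busy (upc st) (qpc st))(Updater i := True) = busy (upc st) (qpc st)"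
  by (intro fun_upd_idem) simp

lemma updater_silent:
  assumes inv: "opt_inv n h st \<gamma>" and pc: "upc st i \<noteq> UIdle" "pc \<noteq> UIdle"
    and arg: "update_arg pc = update_arg (upc st i)" and mem: "mem_ok m"
    and own: "buffer_inv (stream \<gamma>) m i pc (ppc st) (merge_done \<gamma>)
      (active \<gamma> i) (inflight \<gamma> i) (other \<gamma> i) (cur \<gamma> i)"
    and others: "\<And>j. j \<noteq> i \<Longrightarrow> buffer_inv (stream \<gamma>) m j (upc st j) (ppc st) (merge_done \<gamma>)
      (active \<gamma> j) (inflight \<gamma> j) (other \<gamma> j) (cur \<gamma> j)"
  shows "opt_inv n h (goto_u i pc (st\<lparr>mem := m\<rparr>)) \<gamma>"
proof (rule updater_step[OF inv mem])
  note ginv = opt_inv_ghost[OF inv]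
  show "core_inv n h ((busy (upc st) (qpc st))(Updater i := (pc \<noteq> UIdle))) \<gamma>"
    using ghost_inv_core[OF ginv] pc by (simp add: busy_updater_same)
  show "updater_inv N n h (lin \<gamma>) i pc"
    using ghost_inv_updater[OF ginv, of i] pc arg
    by (cases "update_arg (upc st i)") (simp_all add: updater_inv_def)
qed (use own others in auto)

lemma updater_local:
  assumes inv: "opt_inv n h st \<gamma>" and pc: "upc st i \<noteq> UIdle" "pc \<noteq> UIdle"
    and arg: "update_arg pc = update_arg (upc st i)"
    and own: "buffer_inv (stream \<gamma>) (mem st) i pc (ppc st) (merge_done \<gamma>)
      (active \<gamma> i) (inflight \<gamma> i) (other \<gamma> i) (cur \<gamma> i)"
  shows "opt_inv n h (goto_u i pc st) \<gamma>"
proof -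
  note ginv = opt_inv_ghost[OF inv]
  have "opt_inv n h (goto_u i pc (st\<lparr>mem := mem st\<rparr>)) \<gamma>"
    by (rule updater_silent[OF inv pc arg ghost_inv_mem_ok[OF ginv] own ghost_inv_buffer[OF ginv]])
  then show ?thesis by simp
qed

fun owner :: "loc \<Rightarrow> nat" where
  "owner (LocalS i j) = i"
| "owner (Cur i) = i"
| "owner (Counter i) = i"
| "owner (Hint i) = i"

text \<open>Update thread \<open>i\<close> writes only its own locations and
  \<open>prop\<^sub>i\<close> and changes only its own view, none of which the invariant for
  \<open>j\<close> mentions.\<close>

lemma buffer_inv_frame:
  assumes "mem_ok m" and "j \<noteq> i"
  shows buffer_inv_store: "owner x = i \<Longrightarrow>
      buffer_inv G (store (Updater i) x v m) j pc pp d A F B c \<longleftrightarrow> buffer_inv G m j pc pp d A F B c"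
    and buffer_inv_acquire:
      "buffer_inv G (acquire (Updater i) k m) j pc pp d A F B c \<longleftrightarrow> buffer_inv G m j pc pp d A F B c"
    and buffer_inv_write_prop:
      "buffer_inv G (write_prop (Updater i) i r m) j pc pp d A F B c \<longleftrightarrow> buffer_inv G m j pc pp d A F B c"
proof -
  assume "owner x = i"
  then have "Cur j \<noteq> x" "Counter j \<noteq> x" "Hint j \<noteq> x" "LocalS j k \<noteq> x" for k
    using assms(2) by auto
  then show "buffer_inv G (store (Updater i) x v m) j pc pp d A F B c \<longleftrightarrow> buffer_inv G m j pc pp d A F B c"
    using assms(1) by (simp add: buffer_inv_def)
qed (use assms in \<open>simp_all add: buffer_inv_def\<close>)

lemma updater_store:
  assumes inv: "opt_inv n h st \<gamma>" and pc: "upc st i \<noteq> UIdle" "pc \<noteq> UIdle"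
    and arg: "update_arg pc = update_arg (upc st i)" and x: "owner x = i"
    and own: "buffer_inv (stream \<gamma>) (store (Updater i) x v (mem st)) i pc (ppc st) (merge_done \<gamma>)
      (active \<gamma> i) (inflight \<gamma> i) (other \<gamma> i) (cur \<gamma> i)"
  shows "opt_inv n h (goto_u i pc (st\<lparr>mem := store (Updater i) x v (mem st)\<rparr>)) \<gamma>"
proof (rule updater_silent[OF inv pc arg _ own])
  note ginv = opt_inv_ghost[OF inv]
  show "mem_ok (store (Updater i) x v (mem st))"
    using ghost_inv_mem_ok[OF ginv] by simp
  show "buffer_inv (stream \<gamma>) (store (Updater i) x v (mem st)) j (upc st j) (ppc st) (merge_done \<gamma>)
      (active \<gamma> j) (inflight \<gamma> j) (other \<gamma> j) (cur \<gamma> j)" if "j \<noteq> i" for j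
    using ghost_inv_buffer[OF ginv] by (simp add: buffer_inv_store[OF ghost_inv_mem_ok[OF ginv] that x])
qed

lemma updater_acquire:
  assumes inv: "opt_inv n h st \<gamma>" and pc: "upc st i \<noteq> UIdle" "pc \<noteq> UIdle"
    and arg: "update_arg pc = update_arg (upc st i)"
    and own: "buffer_inv (stream \<gamma>) (acquire (Updater i) i (mem st)) i pc (ppc st) (merge_done \<gamma>)
      (active \<gamma> i) (inflight \<gamma> i) (other \<gamma> i) (cur \<gamma> i)"
  shows "opt_inv n h (goto_u i pc (st\<lparr>mem := acquire (Updater i) i (mem st)\<rparr>)) \<gamma>"
proof (rule updater_silent[OF inv pc arg _ own])
  note ginv = opt_inv_ghost[OF inv]
  show "mem_ok (acquire (Updater i) i (mem st))"
    using ghost_inv_mem_ok[OF ginv] by simp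
  show "buffer_inv (stream \<gamma>) (acquire (Updater i) i (mem st)) j (upc st j) (ppc st) (merge_done \<gamma>)
      (active \<gamma> j) (inflight \<gamma> j) (other \<gamma> j) (cur \<gamma> j)" if "j \<noteq> i" for j
    using ghost_inv_buffer[OF ginv] by (simp add: buffer_inv_acquire[OF ghost_inv_mem_ok[OF ginv] that])
qed

lemma opt_inv_u_call:
  assumes inv: "opt_inv n h st \<gamma>" and i: "i \<in> {1..N}" and pc: "upc st i = UIdle"
  shows "opt_inv (n(Updater i := Suc (n (Updater i)))) (h @ [Inv (Updater i, n (Updater i)) (Update a)])
    (goto_u i (UCheck a) st) \<gamma>"
proof -
  note ginv = opt_inv_ghost[OF inv]
  note tracks = ghost_inv_tracks[OF ginv]
  have new: "(Updater i, n (Updater i)) \<notin> fst ` set (lin \<gamma>)"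
  proof
    assume "(Updater i, n (Updater i)) \<in> fst ` set (lin \<gamma>)"
    then obtain x r where "((Updater i, n (Updater i)), x, r) \<in> set (lin \<gamma>)"
      by auto
    from tracks_inv_less[OF tracks tracks_inv[OF tracks this]] show False
      by simp
  qed
  have "opt_inv (n(Updater i := Suc (n (Updater i)))) (h @ [Inv (Updater i, n (Updater i)) (Update a)])
    (goto_u i (UCheck a) (st\<lparr>mem := mem st\<rparr>)) \<gamma>"
  proof (rule updater_step[OF inv])
    show "core_inv (n(Updater i := Suc (n (Updater i)))) (h @ [Inv (Updater i, n (Updater i)) (Update a)])
        ((busy (upc st) (qpc st))(Updater i := (UCheck a \<noteq> UIdle))) \<gamma>"
      using core_inv_tracks[OF ghost_inv_core[OF ginv] tracks_call[OF tracks]] pc by simp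
    show "updater_inv N (n(Updater i := Suc (n (Updater i))))
        (h @ [Inv (Updater i, n (Updater i)) (Update a)]) (lin \<gamma>) i (UCheck a)"
      using i new by (simp add: updater_inv_def)
    show "buffer_inv (stream \<gamma>) (mem st) i (UCheck a) (ppc st) (merge_done \<gamma>)
        (active \<gamma> i) (inflight \<gamma> i) (other \<gamma> i) (cur \<gamma> i)"
      using ghost_inv_buffer[OF ginv, of i] pc by (simp add: buffer_inv_def)
  qed (use ghost_inv_mem_ok[OF ginv] ghost_inv_buffer[OF ginv] in auto)
  then show ?thesis by simp
qed

lemma opt_inv_u_return:
  assumes inv: "opt_inv n h st \<gamma>" and pc: "upc st i = UReturn"
  shows "opt_inv n (h @ [Res (Updater i, n (Updater i) - 1) Ack]) (goto_u i UIdle st) \<gamma>"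
proof -
  note ginv = opt_inv_ghost[OF inv]
  note tracks = ghost_inv_tracks[OF ginv]
  obtain x where x: "((Updater i, n (Updater i) - 1), x, Ack) \<in> set (lin \<gamma>)"
    using ghost_inv_updater[OF ginv, of i] pc by (auto simp: updater_inv_def)
  have "opt_inv n (h @ [Res (Updater i, n (Updater i) - 1) Ack])
    (goto_u i UIdle (st\<lparr>mem := mem st\<rparr>)) \<gamma>"
  proof (rule updater_step[OF inv])
    show "core_inv n (h @ [Res (Updater i, n (Updater i) - 1) Ack])
        ((busy (upc st) (qpc st))(Updater i := (UIdle \<noteq> (UIdle :: ('s, 'a, 'h) upd_pc)))) \<gamma>"
      using core_inv_tracks[OF ghost_inv_core[OF ginv] tracks_ret[OF tracks _ x]] pc by simp
    show "updater_inv N n (h @ [Res (Updater i, n (Updater i) - 1) Ack]) (lin \<gamma>) i UIdle"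
      by (simp add: updater_inv_def)
    show "buffer_inv (stream \<gamma>) (mem st) i UIdle (ppc st) (merge_done \<gamma>)
        (active \<gamma> i) (inflight \<gamma> i) (other \<gamma> i) (cur \<gamma> i)"
      using ghost_inv_buffer[OF ginv, of i] pc by (simp add: buffer_inv_def)
  qed (use ghost_inv_mem_ok[OF ginv] ghost_inv_buffer[OF ginv] in auto)
  then show ?thesis by simp
qed

lemma opt_inv_u_add:
  assumes inv: "opt_inv n h st \<gamma>" and pc: "upc st i = UCheck a"
  shows "opt_inv n h (goto_u i (UCount a) st) \<gamma>"
proof (rule updater_local[OF inv])
  show "buffer_inv (stream \<gamma>) (mem st) i (UCount a) (ppc st) (merge_done \<gamma>)
      (active \<gamma> i) (inflight \<gamma> i) (other \<gamma> i) (cur \<gamma> i)"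
    using ghost_inv_buffer[OF opt_inv_ghost[OF inv], of i] pc by (auto simp: buffer_inv_def)
qed (use pc in simp_all)

lemma opt_inv_u_count:
  assumes inv: "opt_inv n h st \<gamma>" and pc: "upc st i = UCount a"
    and reads: "reads (mem st) (Updater i) (Counter i) (NatV c)"
  shows "opt_inv n h (goto_u i (UCount' a c) st) \<gamma>"
proof (rule updater_local[OF inv])
  note bi = ghost_inv_buffer[OF opt_inv_ghost[OF inv], of i]
  have "latest (mem st) (Counter i) = NatV c"
    using reads_fresh[OF _ reads] bi by (simp add: buffer_inv_def)
  then show "buffer_inv (stream \<gamma>) (mem st) i (UCount' a c) (ppc st) (merge_done \<gamma>)
      (active \<gamma> i) (inflight \<gamma> i) (other \<gamma> i) (cur \<gamma> i)"
    using bi pc by (auto simp: buffer_inv_def)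
qed (use pc in simp_all)

lemma opt_inv_u_count':
  assumes inv: "opt_inv n h st \<gamma>" and pc: "upc st i = UCount' a c"
  shows "opt_inv n h
    (goto_u i (UCur a) (st\<lparr>mem := store (Updater i) (Counter i) (NatV (c + 1)) (mem st)\<rparr>)) \<gamma>"
proof (rule updater_store[OF inv])
  note ginv = opt_inv_ghost[OF inv]
  show "buffer_inv (stream \<gamma>) (store (Updater i) (Counter i) (NatV (c + 1)) (mem st)) i (UCur a)
      (ppc st) (merge_done \<gamma>) (active \<gamma> i) (inflight \<gamma> i) (other \<gamma> i) (cur \<gamma> i)"
    using ghost_inv_buffer[OF ginv, of i] ghost_inv_mem_ok[OF ginv] pc by (auto simp: buffer_inv_def)
qed (use pc in simp_all)

lemma opt_inv_u_cur:
  assumes inv: "opt_inv n h st \<gamma>" and pc: "upc st i = UCur a"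
    and reads: "reads (mem st) (Updater i) (Cur i) (NatV j)"
  shows "opt_inv n h (goto_u i (ULocal a j) st) \<gamma>"
proof (rule updater_local[OF inv])
  note bi = ghost_inv_buffer[OF opt_inv_ghost[OF inv], of i]
  have "latest (mem st) (Cur i) = NatV j"
    using reads_fresh[OF _ reads] bi by (simp add: buffer_inv_def)
  then show "buffer_inv (stream \<gamma>) (mem st) i (ULocal a j) (ppc st) (merge_done \<gamma>)
      (active \<gamma> i) (inflight \<gamma> i) (other \<gamma> i) (cur \<gamma> i)"
    using bi pc by (auto simp: buffer_inv_def)
qed (use pc in simp_all)

lemma opt_inv_u_local:
  assumes inv: "opt_inv n h st \<gamma>" and pc: "upc st i = ULocal a j"
    and reads: "reads (mem st) (Updater i) (LocalS i j) (SketchV s)"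
  shows "opt_inv n h (goto_u i (ULocal' a j s) st) \<gamma>"
proof (rule updater_local[OF inv])
  note bi = ghost_inv_buffer[OF opt_inv_ghost[OF inv], of i]
  have "latest (mem st) (LocalS i j) = SketchV s"
    using reads_fresh[OF _ reads] bi pc by (simp add: buffer_inv_def)
  then show "buffer_inv (stream \<gamma>) (mem st) i (ULocal' a j s) (ppc st) (merge_done \<gamma>)
      (active \<gamma> i) (inflight \<gamma> i) (other \<gamma> i) (cur \<gamma> i)"
    using bi pc by (auto simp: buffer_inv_def)
qed (use pc in simp_all)

lemma opt_inv_u_test:
  assumes inv: "opt_inv n h st \<gamma>" and pc: "upc st i = UTest"
    and reads: "reads (mem st) (Updater i) (Counter i) (NatV c)"
  shows "c \<noteq> b \<Longrightarrow> opt_inv n h (goto_u i UReturn st) \<gamma>"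
    and "c = b \<Longrightarrow> opt_inv n h (goto_u i UWait st) \<gamma>"
proof -
  note bi = ghost_inv_buffer[OF opt_inv_ghost[OF inv], of i]
  have c: "latest (mem st) (Counter i) = NatV c"
    using reads_fresh[OF _ reads] bi by (simp add: buffer_inv_def)
  show "opt_inv n h (goto_u i UReturn st) \<gamma>" if "c \<noteq> b"
  proof (rule updater_local[OF inv])
    show "buffer_inv (stream \<gamma>) (mem st) i UReturn (ppc st) (merge_done \<gamma>)
        (active \<gamma> i) (inflight \<gamma> i) (other \<gamma> i) (cur \<gamma> i)"
      using bi pc c that by (simp add: buffer_inv_def)
  qed (use pc in simp_all)
  show "opt_inv n h (goto_u i UWait st) \<gamma>" if "c = b"
  proof (rule updater_local[OF inv])
    have len: "length (active \<gamma> i) = b"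
      using bi pc c that by (simp add: buffer_inv_def)
    show "buffer_inv (stream \<gamma>) (mem st) i UWait (ppc st) (merge_done \<gamma>)
        (active \<gamma> i) (inflight \<gamma> i) (other \<gamma> i) (cur \<gamma> i)"
      using bi pc len by (simp add: buffer_inv_def)
  qed (use pc in simp_all)
qed

lemma opt_inv_u_wait:
  assumes inv: "opt_inv n h st \<gamma>" and pc: "upc st i = UWait"
  shows "opt_inv n h (st\<lparr>mem := acquire (Updater i) i (mem st)\<rparr>) \<gamma>"
proof -
  note ginv = opt_inv_ghost[OF inv]
  have "opt_inv n h (goto_u i UWait (st\<lparr>mem := acquire (Updater i) i (mem st)\<rparr>)) \<gamma>"
  proof (rule updater_acquire[OF inv])
    show "buffer_inv (stream \<gamma>) (acquire (Updater i) i (mem st)) i UWait (ppc st) (merge_done \<gamma>)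
        (active \<gamma> i) (inflight \<gamma> i) (other \<gamma> i) (cur \<gamma> i)"
      using ghost_inv_buffer[OF ginv, of i] ghost_inv_mem_ok[OF ginv] pc by (simp add: buffer_inv_def)
  qed (use pc in simp_all)
  moreover have "(upc st)(i := UWait) = upc st"
    using pc by (intro fun_upd_idem)
  ultimately show ?thesis
    by simp
qed

text \<open>Acquiring what is published with the non-zero value makes the empty second sketch fresh
  for the update thread, which may then write to it after the flip.\<close>

lemma opt_inv_u_proceed:
  assumes inv: "opt_inv n h st \<gamma>" and pc: "upc st i = UWait" and nz: "prop_val (mem st) i \<noteq> 0"
  shows "opt_inv n h (goto_u i UFlip (st\<lparr>mem := acquire (Updater i) i (mem st)\<rparr>)) \<gamma>"
proof (rule updater_acquire[OF inv])
  note ginv = opt_inv_ghost[OF inv]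
  show "buffer_inv (stream \<gamma>) (acquire (Updater i) i (mem st)) i UFlip (ppc st) (merge_done \<gamma>)
      (active \<gamma> i) (inflight \<gamma> i) (other \<gamma> i) (cur \<gamma> i)"
    using ghost_inv_buffer[OF ginv, of i] ghost_inv_mem_ok[OF ginv] pc nz
    by (auto simp: buffer_inv_def)
qed (use pc in simp_all)

lemma opt_inv_u_flip:
  assumes inv: "opt_inv n h st \<gamma>" and pc: "upc st i = UFlip"
    and reads: "reads (mem st) (Updater i) (Cur i) (NatV j)"
  shows "opt_inv n h (goto_u i (UFlip' j) st) \<gamma>"
proof (rule updater_local[OF inv])
  note bi = ghost_inv_buffer[OF opt_inv_ghost[OF inv], of i]
  have "latest (mem st) (Cur i) = NatV j"
    using reads_fresh[OF _ reads] bi by (simp add: buffer_inv_def)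
  then show "buffer_inv (stream \<gamma>) (mem st) i (UFlip' j) (ppc st) (merge_done \<gamma>)
      (active \<gamma> i) (inflight \<gamma> i) (other \<gamma> i) (cur \<gamma> i)"
    using bi pc by (auto simp: buffer_inv_def)
qed (use pc in simp_all)

text \<open>The buffers enter \<open>core_inv\<close> only through the multiset of all buffered
  entries, so they may be regrouped freely.\<close>

lemma core_inv_buffers:
  fixes \<gamma> :: "('s, 'a, 'q, 'v, 'h, 'c) ghost"
  defines "entry \<equiv> update_entry ::
    thread opid \<times> 'a \<Rightarrow> thread opid \<times> ('a, 'q) sketch_op \<times> 'v sketch_ret"
  assumes "core_inv n h D \<gamma>"
    and "(\<Sum>k\<in>{1..N}. mset (map entry (A k @ F k))) =
      (\<Sum>k\<in>{1..N}. mset (map entry (active \<gamma> k @ inflight \<gamma> k)))"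
  shows "core_inv n h D (\<gamma>\<lparr>active := A, inflight := F, other := B, cur := c\<rparr>)"
  using assms(2,3) unfolding core_inv_def entry_def by (elim conjE, intro conjI) simp_all

text \<open>Nothing is in flight here because \<open>prop\<^sub>i\<close> is non-zero. Moving the
  full active buffer there keeps the multiset of buffered updates, and so the gap between the two
  histories.\<close>

lemma opt_inv_u_flip':
  assumes inv: "opt_inv n h st \<gamma>" and pc: "upc st i = UFlip' j"
  shows "\<exists>\<gamma>'. opt_inv n h
    (goto_u i UHint (st\<lparr>mem := store (Updater i) (Cur i) (NatV (1 - j)) (mem st)\<rparr>)) \<gamma>' \<and>
    lin \<gamma>' = lin \<gamma>"
proof -
  note ginv = opt_inv_ghost[OF inv]
  note mem = ghost_inv_mem_ok[OF ginv]
  note bi = ghost_inv_buffer[OF ginv, of i]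
  define \<gamma>' where "\<gamma>' = \<gamma>\<lparr>active := (active \<gamma>)(i := []), inflight := (inflight \<gamma>)(i := active \<gamma> i),
    other := (other \<gamma>)(i := map snd (active \<gamma> i)), cur := (cur \<gamma>)(i := 1 - cur \<gamma> i)\<rparr>"
  have c: "cur \<gamma> i \<le> 1" "j = cur \<gamma> i" and empty: "inflight \<gamma> i = []" "other \<gamma> i = []"
      and elsewhere: "at_index (ppc st) \<noteq> Some i"
    using bi pc by (auto simp: buffer_inv_def)
  \<comment> \<open>The two cases evaluate \<open>1 - (1 - cur \<gamma> i)\<close>, the index of the
    sketch that ceases to be current.\<close>
  have c01: "cur \<gamma> i = 0 \<or> cur \<gamma> i = 1"
    using c(1) by arith
  have "opt_inv n h
    (goto_u i UHint (st\<lparr>mem := store (Updater i) (Cur i) (NatV (1 - j)) (mem st)\<rparr>)) \<gamma>'"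
  proof (rule updater_step[OF inv])
    show "mem_ok (store (Updater i) (Cur i) (NatV (1 - j)) (mem st))"
      using mem by simp
    let ?entry = "update_entry :: thread opid \<times> 'a \<Rightarrow> thread opid \<times> ('a, 'q) sketch_op \<times> 'v sketch_ret"
    have "mset (map ?entry (active \<gamma>' k @ inflight \<gamma>' k)) =
        mset (map ?entry (active \<gamma> k @ inflight \<gamma> k))" for k
      by (auto simp: \<gamma>'_def empty)
    then have "(\<Sum>k\<in>{1..N}. mset (map ?entry (active \<gamma>' k @ inflight \<gamma>' k))) =
        (\<Sum>k\<in>{1..N}. mset (map ?entry (active \<gamma> k @ inflight \<gamma> k)))"
      by (intro sum.cong refl)
    then have "core_inv n h (busy (upc st) (qpc st)) \<gamma>'"
      unfolding \<gamma>'_def by (intro core_inv_buffers[OF ghost_inv_core[OF ginv]]) simp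
    then show "core_inv n h ((busy (upc st) (qpc st))(Updater i := (UHint \<noteq> (UIdle :: ('s, 'a, 'h) upd_pc)))) \<gamma>'"
      using pc busy_updater_same[of st i] by simp
    show "updater_inv N n h (lin \<gamma>') i UHint"
      using ghost_inv_updater[OF ginv, of i] pc by (simp add: updater_inv_def \<gamma>'_def)
    show "buffer_inv (stream \<gamma>) (store (Updater i) (Cur i) (NatV (1 - j)) (mem st)) i UHint (ppc st)
        (merge_done \<gamma>) (active \<gamma>' i) (inflight \<gamma>' i) (other \<gamma>' i) (cur \<gamma>' i)"
      using bi pc mem elsewhere c01 by (elim disjE) (auto simp: buffer_inv_def \<gamma>'_def)
    show "buffer_inv (stream \<gamma>) (store (Updater i) (Cur i) (NatV (1 - j)) (mem st)) k (upc st k)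
        (ppc st) (merge_done \<gamma>) (active \<gamma>' k) (inflight \<gamma>' k) (other \<gamma>' k) (cur \<gamma>' k)" if "k \<noteq> i" for k
      using ghost_inv_buffer[OF ginv, of k] that by (simp add: buffer_inv_store[OF mem] \<gamma>'_def)
    show "other \<gamma>' k = other \<gamma> k" if "at_index (ppc st) = Some k" for k
      using that elsewhere by (auto simp: \<gamma>'_def)
  qed (auto simp: \<gamma>'_def)
  then show ?thesis
    by (intro exI[of _ \<gamma>']) (simp add: \<gamma>'_def)
qed

lemma opt_inv_u_hint:
  assumes inv: "opt_inv n h st \<gamma>" and pc: "upc st i = UHint"
  shows "opt_inv n h (goto_u i (UHint' (prop_val (mem st) i))
    (st\<lparr>mem := acquire (Updater i) i (mem st)\<rparr>)) \<gamma>"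
proof (rule updater_acquire[OF inv])
  note ginv = opt_inv_ghost[OF inv]
  show "buffer_inv (stream \<gamma>) (acquire (Updater i) i (mem st)) i (UHint' (prop_val (mem st) i)) (ppc st)
      (merge_done \<gamma>) (active \<gamma> i) (inflight \<gamma> i) (other \<gamma> i) (cur \<gamma> i)"
    using ghost_inv_buffer[OF ginv, of i] ghost_inv_mem_ok[OF ginv] pc
    by (auto simp: buffer_inv_def)
qed (use pc in simp_all)

lemma opt_inv_u_hint':
  assumes inv: "opt_inv n h st \<gamma>" and pc: "upc st i = UHint' r"
  shows "opt_inv n h
    (goto_u i UReset (st\<lparr>mem := store (Updater i) (Hint i) (HintV r) (mem st)\<rparr>)) \<gamma>"
proof (rule updater_store[OF inv])
  note ginv = opt_inv_ghost[OF inv]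
  show "buffer_inv (stream \<gamma>) (store (Updater i) (Hint i) (HintV r) (mem st)) i UReset (ppc st)
      (merge_done \<gamma>) (active \<gamma> i) (inflight \<gamma> i) (other \<gamma> i) (cur \<gamma> i)"
    using ghost_inv_buffer[OF ginv, of i] ghost_inv_mem_ok[OF ginv] pc by (auto simp: buffer_inv_def)
qed (use pc in simp_all)

lemma opt_inv_u_reset:
  assumes inv: "opt_inv n h st \<gamma>" and pc: "upc st i = UReset"
  shows "opt_inv n h
    (goto_u i USignal (st\<lparr>mem := store (Updater i) (Counter i) (NatV 0) (mem st)\<rparr>)) \<gamma>"
proof (rule updater_store[OF inv])
  note ginv = opt_inv_ghost[OF inv]
  show "buffer_inv (stream \<gamma>) (store (Updater i) (Counter i) (NatV 0) (mem st)) i USignal (ppc st)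
      (merge_done \<gamma>) (active \<gamma> i) (inflight \<gamma> i) (other \<gamma> i) (cur \<gamma> i)"
    using ghost_inv_buffer[OF ginv, of i] ghost_inv_mem_ok[OF ginv] pc by (auto simp: buffer_inv_def)
qed (use pc in simp_all)

text \<open>\<open>cur\<^sub>i\<close> and the full sketch are fresh for the update thread, so this
  write publishes both; the visit of the propagator relies on that.\<close>

lemma opt_inv_u_signal:
  assumes inv: "opt_inv n h st \<gamma>" and pc: "upc st i = USignal"
  shows "opt_inv n h (goto_u i UReturn (st\<lparr>mem := write_prop (Updater i) i 0 (mem st)\<rparr>)) \<gamma>"
proof (rule updater_silent[OF inv])
  note ginv = opt_inv_ghost[OF inv]
  note mem = ghost_inv_mem_ok[OF ginv]
  show "mem_ok (write_prop (Updater i) i 0 (mem st))"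
    using mem by simp
  \<comment> \<open>\<open>b_pos\<close> enters since outside the hand-over the active buffer must
    be shorter than \<open>b\<close>, and it is now empty.\<close>
  show "buffer_inv (stream \<gamma>) (write_prop (Updater i) i 0 (mem st)) i UReturn (ppc st)
      (merge_done \<gamma>) (active \<gamma> i) (inflight \<gamma> i) (other \<gamma> i) (cur \<gamma> i)"
    using ghost_inv_buffer[OF ginv, of i] mem pc b_pos by (auto simp: buffer_inv_def)
  show "buffer_inv (stream \<gamma>) (write_prop (Updater i) i 0 (mem st)) j (upc st j) (ppc st)
      (merge_done \<gamma>) (active \<gamma> j) (inflight \<gamma> j) (other \<gamma> j) (cur \<gamma> j)" if "j \<noteq> i" for j
    using ghost_inv_buffer[OF ginv, of j] by (simp add: buffer_inv_write_prop[OF mem that])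
qed (use pc in simp_all)

section \<open>The backlog of buffered updates and the linearisation points of updates\<close>

lemma card_unpropagated:
  assumes eq: "mset H' = mset H + (\<Sum>i\<in>{1..N}. mset (map update_entry (A i @ F i)))"
    and len: "\<And>i. length (A i) \<le> b \<and> length (F i) \<le> b"
  shows "card (set H' - set H) \<le> 2 * N * b"
proof -
  have "card (set H' - set H) \<le> (\<Sum>i\<in>{1..N}. length (A i) + length (F i))"
    using card_set_diff_le[OF eq] by (simp add: size_sum_mset)
  also have "\<dots> \<le> (\<Sum>i\<in>{1..N}. 2 * b)"
  proof (rule sum_mono)
    show "length (A i) + length (F i) \<le> 2 * b" for i
      using len[of i] by linarith
  qed
  finally show ?thesis
    by (simp add: ac_simps)
qed

lemma buffer_inv_length:
  "buffer_inv G m i pc pp d A F B c \<Longrightarrow> length A \<le> b \<and> length F \<le> b"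
  using length_active by (auto simp: buffer_inv_def)

lemma opt_inv_u_filtered:
  assumes inv: "opt_inv n h st \<gamma>" and pc: "upc st i = UCheck a"
    and reads: "reads (mem st) (Updater i) (Hint i) (HintV r)" and filter: "\<not> should_add S r a"
  shows "\<exists>\<gamma>'. opt_inv n h (goto_u i UReturn st) \<gamma>' \<and> prefix (lin \<gamma>) (lin \<gamma>')"
proof -
  note ginv = opt_inv_ghost[OF inv]
  note bi = ghost_inv_buffer[OF ginv, of i]
  note core = ghost_inv_core[OF ginv]
  note upd = ghost_inv_updater[OF ginv, of i]
  have "latest (mem st) (Hint i) = HintV r"
    using reads_fresh[OF _ reads] bi by (simp add: buffer_inv_def)
  then have "hint_ok (stream \<gamma>) r"
    using bi by (auto simp: buffer_inv_def dest: sym)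
  then have sk: "sk (stream \<gamma> @ [a]) = sk (stream \<gamma>)"
    using filter by (rule hint_ok_filter)
  let ?id = "(Updater i, n (Updater i) - 1)"
  define e where "e = (?id, Update a :: ('a, 'q) sketch_op, Ack :: 'v sketch_ret)"
  \<comment> \<open>Both histories gain the entry but \<open>stream\<close> does not: the sketch
    state is unchanged, and everything stated relative to \<open>stream\<close> carries
    over.\<close>
  define \<gamma>' where "\<gamma>' = \<gamma>\<lparr>lin := lin \<gamma> @ [e], propagated := propagated \<gamma> @ [e]\<rparr>"
  have tracks: "tracks n (busy (upc st) (qpc st)) h (lin \<gamma>')"
    using tracks_linearise[OF core_tracks[OF core], of ?id "Update a" Ack] upd pc
    by (simp add: updater_inv_def \<gamma>'_def e_def)
  have sk_eq: "sk (updates_of (propagated \<gamma>)) = sk (stream \<gamma>)"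
    using core by (simp add: core_inv_def)
  have "opt_inv n h (goto_u i UReturn (st\<lparr>mem := mem st\<rparr>)) \<gamma>'"
  proof (rule updater_step[OF inv])
    have "core_inv n h (busy (upc st) (qpc st)) \<gamma>'"
      unfolding core_inv_def
    proof (intro conjI)
      show "tracks n (busy (upc st) (qpc st)) h (lin \<gamma>')"
        by (rule tracks)
      show "r_relaxation (2 * N * b) (propagated \<gamma>') (lin \<gamma>')"
        using r_relaxation_append_both[of _ "propagated \<gamma>" "lin \<gamma>" e] core tracks_wf[OF tracks]
        by (simp add: \<gamma>'_def wf_seq_def core_inv_def)
      show "seq_run S (init S) (propagated \<gamma>')"
        using core by (simp add: \<gamma>'_def core_inv_def seq_run_append e_def)
      show "sk (updates_of (propagated \<gamma>')) = sk (stream \<gamma>')"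
        using sk_append_cong[OF sk_eq, of "[a]"] sk by (simp add: \<gamma>'_def updates_of_append e_def)
      show "mset (lin \<gamma>') = mset (propagated \<gamma>') +
          (\<Sum>i\<in>{1..N}. mset (map update_entry (active \<gamma>' i @ inflight \<gamma>' i)))"
        using core by (simp add: \<gamma>'_def core_inv_def)
      show "\<forall>k j. (Querier k, j) \<in> fst ` set (lin \<gamma>') \<longrightarrow> (Querier k, j) \<in> fst ` set (slin \<gamma>')"
        using core unfolding core_inv_def by (auto simp: \<gamma>'_def e_def)
      show "\<forall>k j x s. ((Querier k, j), x, Copy s) \<in> set (slin \<gamma>') \<longrightarrow>
          (\<exists>q. ((Querier k, j), Query q, Val (query S s q)) \<in> set (lin \<gamma>'))"
        using core unfolding core_inv_def by (fastforce simp: \<gamma>'_def)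
    qed (use core in \<open>simp_all add: core_inv_def \<gamma>'_def\<close>)
    then show "core_inv n h ((busy (upc st) (qpc st))(Updater i := (UReturn \<noteq> (UIdle :: ('s, 'a, 'h) upd_pc)))) \<gamma>'"
      using pc busy_updater_same[of st i] by simp
    show "updater_inv N n h (lin \<gamma>') i UReturn"
      using upd pc by (auto simp: updater_inv_def \<gamma>'_def e_def)
    show "buffer_inv (stream \<gamma>) (mem st) i UReturn (ppc st) (merge_done \<gamma>)
        (active \<gamma>' i) (inflight \<gamma>' i) (other \<gamma>' i) (cur \<gamma>' i)"
      using bi pc by (simp add: buffer_inv_def \<gamma>'_def)
    show "buffer_inv (stream \<gamma>) (mem st) j (upc st j) (ppc st) (merge_done \<gamma>)
        (active \<gamma>' j) (inflight \<gamma>' j) (other \<gamma>' j) (cur \<gamma>' j)" for j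
      using ghost_inv_buffer[OF ginv, of j] by (simp add: \<gamma>'_def)
    show "mem_ok (mem st)"
      by (rule ghost_inv_mem_ok[OF ginv])
  qed (auto simp: \<gamma>'_def e_def)
  then show ?thesis
    by (intro exI[of _ \<gamma>']) (simp add: \<gamma>'_def)
qed

text \<open>The only step that extends \<open>lin\<close> without \<open>propagated\<close>, hence
  the only one at which the bound \<open>2 * N * b\<close> has to be checked anew.\<close>

lemma opt_inv_u_local':
  assumes inv: "opt_inv n h st \<gamma>" and pc: "upc st i = ULocal' a j s"
  shows "\<exists>\<gamma>'. opt_inv n h (goto_u i UTest
      (st\<lparr>mem := store (Updater i) (LocalS i j) (SketchV (update S s a)) (mem st)\<rparr>)) \<gamma>' \<and>
    prefix (lin \<gamma>) (lin \<gamma>')"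
proof -
  note ginv = opt_inv_ghost[OF inv]
  note mem = ghost_inv_mem_ok[OF ginv]
  note bi = ghost_inv_buffer[OF ginv, of i]
  note core = ghost_inv_core[OF ginv]
  note upd = ghost_inv_updater[OF ginv, of i]
  let ?id = "(Updater i, n (Updater i) - 1)"
  let ?m = "store (Updater i) (LocalS i j) (SketchV (update S s a)) (mem st)"
  define e where "e = (update_entry (?id, a) :: _ \<times> ('a, 'q) sketch_op \<times> 'v sketch_ret)"
  define \<gamma>' where "\<gamma>' = \<gamma>\<lparr>lin := lin \<gamma> @ [e], active := (active \<gamma>)(i := active \<gamma> i @ [(?id, a)])\<rparr>"
  have i: "i \<in> {1..N}"
    using upd pc by (simp add: updater_inv_def)
  have c: "cur \<gamma> i \<le> 1" and len: "length (active \<gamma> i) < b"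
    using bi pc by (simp_all add: buffer_inv_def)
  have c01: "cur \<gamma> i = 0 \<or> cur \<gamma> i = 1"
    using c by arith
  have tracks: "tracks n (busy (upc st) (qpc st)) h (lin \<gamma>')"
    using tracks_linearise[OF core_tracks[OF core], of ?id "Update a" Ack] upd pc
    by (simp add: updater_inv_def \<gamma>'_def e_def update_entry_def)
  have mset: "mset (lin \<gamma>') = mset (propagated \<gamma>) +
      (\<Sum>k\<in>{1..N}. mset (map update_entry (active \<gamma>' k @ inflight \<gamma> k)))"
  proof -
    have "mset (lin \<gamma>) = mset (propagated \<gamma>) +
        (\<Sum>k\<in>{1..N}. mset (map update_entry (active \<gamma> k @ inflight \<gamma> k)))"
      using core unfolding core_inv_def by blast
    moreover have "(\<Sum>k\<in>{1..N} - {i}. mset (map update_entry (active \<gamma>' k @ inflight \<gamma> k))) =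
        (\<Sum>k\<in>{1..N} - {i}. mset (map update_entry (active \<gamma> k @ inflight \<gamma> k)))"
      by (rule sum.cong) (auto simp: \<gamma>'_def)
    ultimately show ?thesis
      unfolding sum.remove[OF finite_atLeastAtMost i] by (simp add: \<gamma>'_def e_def ac_simps)
  qed
  have "opt_inv n h (goto_u i UTest (st\<lparr>mem := ?m\<rparr>)) \<gamma>'"
  proof (rule updater_step[OF inv])
    have "core_inv n h (busy (upc st) (qpc st)) \<gamma>'"
      unfolding core_inv_def
    proof (intro conjI)
      show "tracks n (busy (upc st) (qpc st)) h (lin \<gamma>')"
        by (rule tracks)
      \<comment> \<open>The strict inequality \<open>len\<close> leaves room for the new entry in
        the active buffer.\<close>
      have "length (active \<gamma>' k) \<le> b \<and> length (inflight \<gamma> k) \<le> b" for k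
        using buffer_inv_length[OF ghost_inv_buffer[OF ginv, of k]] len by (auto simp: \<gamma>'_def)
      from card_unpropagated[OF mset this]
      show "r_relaxation (2 * N * b) (propagated \<gamma>') (lin \<gamma>')"
        using r_relaxation_append_right[of _ "propagated \<gamma>" "lin \<gamma>" e] core tracks_wf[OF tracks]
        by (simp add: \<gamma>'_def wf_seq_def core_inv_def)
      show "mset (lin \<gamma>') = mset (propagated \<gamma>') +
          (\<Sum>i\<in>{1..N}. mset (map update_entry (active \<gamma>' i @ inflight \<gamma>' i)))"
        using mset by (simp add: \<gamma>'_def)
      show "\<forall>k j. (Querier k, j) \<in> fst ` set (lin \<gamma>') \<longrightarrow> (Querier k, j) \<in> fst ` set (slin \<gamma>')"
        using core unfolding core_inv_def by (auto simp: \<gamma>'_def e_def update_entry_def)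
      show "\<forall>k j x s. ((Querier k, j), x, Copy s) \<in> set (slin \<gamma>') \<longrightarrow>
          (\<exists>q. ((Querier k, j), Query q, Val (query S s q)) \<in> set (lin \<gamma>'))"
        using core unfolding core_inv_def by (fastforce simp: \<gamma>'_def)
    qed (use core in \<open>simp_all add: core_inv_def \<gamma>'_def\<close>)
    then show "core_inv n h ((busy (upc st) (qpc st))(Updater i := (UTest \<noteq> (UIdle :: ('s, 'a, 'h) upd_pc)))) \<gamma>'"
      using pc busy_updater_same[of st i] by simp
    show "updater_inv N n h (lin \<gamma>') i UTest"
      using upd pc by (auto simp: updater_inv_def \<gamma>'_def e_def update_entry_def)
    show "buffer_inv (stream \<gamma>) ?m i UTest (ppc st) (merge_done \<gamma>)
        (active \<gamma>' i) (inflight \<gamma>' i) (other \<gamma>' i) (cur \<gamma>' i)"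
      using bi pc mem c01 by (elim disjE) (auto simp: buffer_inv_def \<gamma>'_def update_sk)
    show "buffer_inv (stream \<gamma>) ?m k (upc st k) (ppc st) (merge_done \<gamma>)
        (active \<gamma>' k) (inflight \<gamma>' k) (other \<gamma>' k) (cur \<gamma>' k)" if "k \<noteq> i" for k
      using ghost_inv_buffer[OF ginv, of k] that by (simp add: buffer_inv_store[OF mem] \<gamma>'_def)
    show "mem_ok ?m"
      using mem by simp
  qed (auto simp: \<gamma>'_def e_def update_entry_def)
  then show ?thesis
    by (intro exI[of _ \<gamma>']) (simp add: \<gamma>'_def)
qed

section \<open>Strong linearisability\<close>

lemma opt_inv_start:
  assumes "st \<in> initial_states S N"
  shows "\<exists>\<gamma>. opt_inv (\<lambda>_. 0) [] st \<gamma>"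
proof -
  obtain g where g: "g \<in> start (shared S)" and st: "st =
      \<lparr>mem = \<lparr>written = (\<lambda>x. [initial_val S x]), seen = (\<lambda>_ _. 0),
              prop_val = (\<lambda>_. 1), published = (\<lambda>_ _. 0)\<rparr>,
       globalS = g, ppc = PNext {1..N}, upc = (\<lambda>_. UIdle), qpc = (\<lambda>_. QIdle)\<rparr>"
    using assms by (auto simp: initial_states_def)
  have exec: "shared_exec S (g, []) g (\<lambda>_. None) (\<lambda>_. 0)"
    by (rule shared_exec_start[OF g])
  then have lin: "linearisation (shared_spec S) (history (g, [])) (f (g, []))"
    using f_linearisation unfolding shared_exec_def by blast
  \<comment> \<open>Nothing has been invoked, so \<open>f\<close> can linearise nothing and
    \<open>slin\<close> may start empty.\<close>
  have f: "f (g, []) = []"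
  proof (rule ccontr)
    assume "f (g, []) \<noteq> []"
    then obtain i x r where "(i, x, r) \<in> set (f (g, []))"
      by (cases "f (g, [])") auto
    from linearisation_inv[OF lin this] show False
      by (simp add: history_def labels_def)
  qed
  define \<gamma> :: "('s, 'a, 'q, 'v, 'h, 'c) ghost" where
    "\<gamma> = \<lparr>lin = [], propagated = [], stream = [], active = (\<lambda>_. []), inflight = (\<lambda>_. []),
      other = (\<lambda>_. []), cur = (\<lambda>_. 0), sexec = (g, []), slin = [], scount = (\<lambda>_. 0)\<rparr>"
  have "busy (upc st) (qpc st) = (\<lambda>_. False)"
  proof
    show "busy (upc st) (qpc st) t = False" for t
      by (cases t) (simp_all add: st)
  qed
  then have "core_inv (\<lambda>_. 0) [] (busy (upc st) (qpc st)) \<gamma>"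
    by (simp add: core_inv_def \<gamma>_def tracks_Nil r_relaxation_def wf_seq_def sk_def)
  moreover have "buffer_inv [] (mem st) i UIdle (PNext {1..N}) d [] [] [] 0" for i d
    using b_pos by (simp add: buffer_inv_def st latest_def fresh_def fresh_published_def sk_def
        hint_ok_initial)
  moreover have "mem_ok (mem st)"
    by (simp add: mem_ok_def st)
  ultimately have "ghost_inv (\<lambda>_. 0) [] st \<gamma>"
    unfolding ghost_inv_def by (simp add: \<gamma>_def updater_inv_def st)
  moreover have "pending_ops st \<gamma> = (\<lambda>_. None)"
  proof
    show "pending_ops st \<gamma> t = None" for t
      by (cases t) (simp_all add: st)
  qed
  moreover have "f (g, []) \<in> shared_spec S"
    using lin by (simp add: linearisation_def)
  ultimately have "opt_inv (\<lambda>_. 0) [] st \<gamma>"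
    using exec f by (simp add: opt_inv_def \<gamma>_def st)
  then show ?thesis by blast
qed

lemma opt_inv_step:
  assumes inv: "opt_inv n h st \<gamma>" and step: "opt_step S N b st l st'"
  shows "\<exists>\<gamma>'. opt_inv (count_call n l) (h @ label_events n l) st' \<gamma>' \<and> prefix (lin \<gamma>) (lin \<gamma>')"
proof -
  \<comment> \<open>Steps without a history event either keep \<open>lin\<close> or may linearise
    operations; \<open>silent\<close> and \<open>absorbing\<close> treat the two kinds.\<close>
  have silent: ?thesis
    if "opt_inv n h st' \<gamma>'" "lin \<gamma>' = lin \<gamma>" "l = Step t" for \<gamma>' t
    using that by auto
  have absorbing: ?thesis
    if "\<exists>\<gamma>'. opt_inv n h st' \<gamma>' \<and> prefix (lin \<gamma>) (lin \<gamma>')" "l = Step t" for t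
    using that by auto
  from step show ?thesis
  proof cases
    \<comment> \<open>In every case, facts 1 and 2 are the equations for the label and the successor
      state; the premises of the rule follow from 3 on.\<close>
    case p_restart
    show ?thesis
      by (rule silent[OF _ refl p_restart(1)]) (unfold p_restart(2), rule opt_inv_p_restart[OF inv p_restart(3)])
  next
    case (p_skip T i)
    show ?thesis
      by (rule silent[OF _ refl p_skip(1)]) (unfold p_skip(2), rule opt_inv_p_skip[OF inv p_skip(3)])
  next
    case (p_visit T i)
    show ?thesis
      by (rule silent[OF _ refl p_visit(1)]) (unfold p_visit(2), rule opt_inv_p_visit[OF inv p_visit(3,4,5)])
  next
    case (p_cur T i j)
    show ?thesis
      by (rule silent[OF _ refl p_cur(1)]) (unfold p_cur(2), rule opt_inv_p_cur[OF inv p_cur(3,4)])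
  next
    case (p_local T i j s)
    show ?thesis
      by (rule silent[OF _ refl p_local(1)]) (unfold p_local(2), rule opt_inv_p_local[OF inv p_local(3,4)])
  next
    case (p_call_merge T i s g)
    show ?thesis
      by (rule absorbing[OF _ p_call_merge(1)]) (unfold p_call_merge(2), rule opt_inv_p_call_merge[OF inv p_call_merge(3,4)])
  next
    case (p_in_merge T i g)
    show ?thesis
      by (rule absorbing[OF _ p_in_merge(1)]) (unfold p_in_merge(2), rule shared_internal[OF inv p_in_merge(4)], simp add: p_in_merge(3))
  next
    case (p_ret_merge T i g)
    show ?thesis
      by (rule absorbing[OF _ p_ret_merge(1)]) (unfold p_ret_merge(2), rule opt_inv_p_ret_merge[OF inv p_ret_merge(3,4)])
  next
    case (p_cur' T i j)
    show ?thesis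
      by (rule silent[OF _ refl p_cur'(1)]) (unfold p_cur'(2), rule opt_inv_p_cur'[OF inv p_cur'(3,4)])
  next
    case (p_clear T i j)
    show ?thesis
      by (rule silent[OF _ _ p_clear(1)]) (unfold p_clear(2), rule opt_inv_p_clear[OF inv p_clear(3)], simp)
  next
    case (p_call_hint T i g)
    show ?thesis
      by (rule absorbing[OF _ p_call_hint(1)]) (unfold p_call_hint(2), rule opt_inv_p_call_hint[OF inv p_call_hint(3,4)])
  next
    case (p_in_hint T i g)
    show ?thesis
      by (rule absorbing[OF _ p_in_hint(1)]) (unfold p_in_hint(2), rule shared_internal[OF inv p_in_hint(4)], simp add: p_in_hint(3))
  next
    case (p_ret_hint T i g r)
    show ?thesis
      by (rule absorbing[OF _ p_ret_hint(1)]) (unfold p_ret_hint(2), rule opt_inv_p_ret_hint[OF inv p_ret_hint(3,4)])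
  next
    case (p_set_prop T i r)
    show ?thesis
      by (rule silent[OF _ refl p_set_prop(1)]) (unfold p_set_prop(2), rule opt_inv_p_set_prop[OF inv p_set_prop(3)])
  next
    case (q_call k q)
    show ?thesis
      unfolding q_call(1,2) count_call.simps label_events.simps
      using opt_inv_q_call[OF inv q_call(3)] by blast
  next
    case (q_call_snapshot k q g)
    show ?thesis
      by (rule absorbing[OF _ q_call_snapshot(1)]) (unfold q_call_snapshot(2), rule opt_inv_q_call_snapshot[OF inv q_call_snapshot(3,4)])
  next
    case (q_in_snapshot k q g)
    show ?thesis
      by (rule absorbing[OF _ q_in_snapshot(1)]) (unfold q_in_snapshot(2), rule shared_internal[OF inv q_in_snapshot(4)], simp add: q_in_snapshot(3))
  next
    case (q_ret_snapshot k q g s)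
    show ?thesis
      by (rule absorbing[OF _ q_ret_snapshot(1)]) (unfold q_ret_snapshot(2), rule opt_inv_q_ret_snapshot[OF inv q_ret_snapshot(3,4)])
  next
    case (q_query k q s)
    show ?thesis
      by (rule silent[OF _ refl q_query(1)]) (unfold q_query(2), rule opt_inv_q_query[OF inv q_query(3)])
  next
    case (q_return k v)
    show ?thesis
      unfolding q_return(1,2) count_call.simps label_events.simps
      using opt_inv_q_return[OF inv q_return(3)] by blast
  next
    case (u_call i a)
    show ?thesis
      unfolding u_call(1,2) count_call.simps label_events.simps
      using opt_inv_u_call[OF inv u_call(3,4)] by blast
  next
    case (u_filtered i a r)
    show ?thesis
      by (rule absorbing[OF _ u_filtered(1)]) (unfold u_filtered(2), rule opt_inv_u_filtered[OF inv u_filtered(3,4,5)])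
  next
    case (u_add i a r)
    show ?thesis
      by (rule silent[OF _ refl u_add(1)]) (unfold u_add(2), rule opt_inv_u_add[OF inv u_add(3)])
  next
    case (u_count i a c)
    show ?thesis
      by (rule silent[OF _ refl u_count(1)]) (unfold u_count(2), rule opt_inv_u_count[OF inv u_count(3,4)])
  next
    case (u_count' i a c)
    show ?thesis
      by (rule silent[OF _ refl u_count'(1)]) (unfold u_count'(2), rule opt_inv_u_count'[OF inv u_count'(3)])
  next
    case (u_cur i a j)
    show ?thesis
      by (rule silent[OF _ refl u_cur(1)]) (unfold u_cur(2), rule opt_inv_u_cur[OF inv u_cur(3,4)])
  next
    case (u_local i a j s)
    show ?thesis
      by (rule silent[OF _ refl u_local(1)]) (unfold u_local(2), rule opt_inv_u_local[OF inv u_local(3,4)])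
  next
    case (u_local' i a j s)
    show ?thesis
      by (rule absorbing[OF _ u_local'(1)]) (unfold u_local'(2), rule opt_inv_u_local'[OF inv u_local'(3)])
  next
    case (u_not_full i c)
    show ?thesis
      by (rule silent[OF _ refl u_not_full(1)]) (unfold u_not_full(2), rule opt_inv_u_test(1)[OF inv u_not_full(3,4,5)])
  next
    case (u_full i c)
    show ?thesis
      by (rule silent[OF _ refl u_full(1)]) (unfold u_full(2), rule opt_inv_u_test(2)[OF inv u_full(3,4,5)])
  next
    case (u_wait i)
    show ?thesis
      by (rule silent[OF _ refl u_wait(1)]) (unfold u_wait(2), rule opt_inv_u_wait[OF inv u_wait(3)])
  next
    case (u_proceed i)
    show ?thesis
      by (rule silent[OF _ refl u_proceed(1)]) (unfold u_proceed(2), rule opt_inv_u_proceed[OF inv u_proceed(3,4)])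
  next
    case (u_flip i j)
    show ?thesis
      by (rule silent[OF _ refl u_flip(1)]) (unfold u_flip(2), rule opt_inv_u_flip[OF inv u_flip(3,4)])
  next
    case (u_flip' i j)
    obtain \<gamma>' where "opt_inv n h st' \<gamma>'" "lin \<gamma>' = lin \<gamma>"
      using opt_inv_u_flip'[OF inv u_flip'(3)] unfolding u_flip'(2) by blast
    then show ?thesis
      by (rule silent) (rule u_flip'(1))
  next
    case (u_hint i)
    show ?thesis
      by (rule silent[OF _ refl u_hint(1)]) (unfold u_hint(2), rule opt_inv_u_hint[OF inv u_hint(3)])
  next
    case (u_hint' i r)
    show ?thesis
      by (rule silent[OF _ refl u_hint'(1)]) (unfold u_hint'(2), rule opt_inv_u_hint'[OF inv u_hint'(3)])
  next
    case (u_reset i)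
    show ?thesis
      by (rule silent[OF _ refl u_reset(1)]) (unfold u_reset(2), rule opt_inv_u_reset[OF inv u_reset(3)])
  next
    case (u_signal i)
    show ?thesis
      by (rule silent[OF _ refl u_signal(1)]) (unfold u_signal(2), rule opt_inv_u_signal[OF inv u_signal(3)])
  next
    case (u_return i)
    show ?thesis
      unfolding u_return(1,2) count_call.simps label_events.simps
      using opt_inv_u_return[OF inv u_return(3)] by blast
  qed
qed

lemma strongly_linearisable_OptParSketch:
  "strongly_linearisable (OptParSketch S N b) (relaxed (2 * N * b) (SeqSketch S))"
proof (rule strongly_linearisable_by_ghost[where J = opt_inv and out = lin])
  fix n h st \<gamma>
  assume inv: "opt_inv n h st \<gamma>"
  note core = ghost_inv_core[OF opt_inv_ghost[OF inv]]
  have "propagated \<gamma> \<in> SeqSketch S"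
    using core by (simp add: core_inv_def SeqSketch_def r_relaxation_def)
  moreover have "r_relaxation (2 * N * b) (propagated \<gamma>) (lin \<gamma>)"
    using core by (simp add: core_inv_def)
  ultimately have "lin \<gamma> \<in> relaxed (2 * N * b) (SeqSketch S)"
    by (auto simp: relaxed_def)
  with core_tracks[OF core] show "linearisation (relaxed (2 * N * b) (SeqSketch S)) h (lin \<gamma>)"
    by (rule tracks_linearisation)
qed (simp_all add: OptParSketch_def opt_inv_start opt_inv_step)

end

theorem theorem1:
  fixes S :: "('s, 'a, 'q, 'v, 'h :: zero_neq_one, 'c) composable" and N b :: nat
  assumes composable: "composable_sketch S"
    and initial_hint: "sound_hint S [] 1"
    and N: "N \<ge> 1"
    and b: "b \<ge> 1"
  shows "strongly_linearisable (OptParSketch S N b) (relaxed (2 * N * b) (SeqSketch S))"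
proof -
  \<comment> \<open>The witness is the function provided by strong linearisability of the shared
    sketch.\<close>
  have "\<exists>f. opt_par_sketch S b f"
    using composable initial_hint b
    unfolding composable_sketch_def strongly_linearisable_on_def opt_par_sketch_def by blast
  then show ?thesis
    using opt_par_sketch.strongly_linearisable_OptParSketch by blast
qed

end
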